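(* Let $Z$ be the final precubical set (one cube in each dimension), regarded as a bi-pointed precubical set whose initial and final vertex are both its unique vertex. Then there is a homotopy equivalence \[ \vec{P}(Z)_{\mathbf 0}^{\mathbf 1}\simeq \coprod_{n\ge 0}\mathrm{UConf}(n,\mathbb{R}^2), \] where $\mathrm{UConf}(n,\mathbb{R}^2)$ is the space of unordered configurations of $n$ distinct points in $\mathbb{R}^2$.
   Context: A precubical set ($\square$-set) $K$ is a sequence of pairwise disjoint sets $(K[n])_{n\ge 0}$ (elements of $K[n]$ are called $n$-cubes, elements of $K[0]$ vertices) with face maps $d^\varepsilon_i:K[n]\to K[n-1]$ for $1\le i\le n$, $\varepsilon\in\{0,1\}$, satisfying $d^\varepsilon_i d^\eta_j=d^\eta_{j-1}d^\varepsilon_i$ for $i<j$. A bi-pointed $\square$-set has a chosen initial vertex $\mathbf 0$ and final vertex $\mathbf 1$ in $K[0]$. The geometric realization is $|K|=\coprod_{n\ge0}K[n]\times[0,1]^n/\sim$, where $\sim$ is generated by $(d^\varepsilon_i c,\mathbf x)\sim(c,\delta^\varepsilon_i\mathbf x)$ with $\delta^\varepsilon_i(x_1,\dots,x_{n-1})=(x_1,\dots,x_{i-1},\varepsilon,x_i,\dots,x_{n-1})$; write $[c;\mathbf x]$ for the class of $(c,\mathbf x)$. A path $\alpha:[0,1]\to|K|$ is a directed path (d-path) if there are $0=t_0<t_1<\dots<t_m=1$, cubes $c_k\in K[n_k]$ and continuous maps $\beta_k:[t_{k-1},t_k]\to[0,1]^{n_k}$ all of whose coordinates are non-decreasing, such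 that $\alpha(t)=[c_k;\beta_k(t)]$ for $t\in[t_{k-1},t_k]$. For a bi-pointed $K$, $\vec P(K)_{\mathbf0}^{\mathbf1}$ denotes the space of d-paths $\alpha$ with $\alpha(0)=\mathbf 0$, $\alpha(1)=\mathbf 1$, with the compact-open topology. $Z$ is the $\square$-set with $Z[n]=\{z^n\}$ for every $n\ge 0$ (face maps are forced: $d^\varepsilon_i z^n=z^{n-1}$), bi-pointed by $\mathbf 0=\mathbf 1=z^0$. *)

theory Defs
  imports "HOL-Analysis.Analysis"
begin

definition quot_topology :: "'a topology \<Rightarrow> ('a \<Rightarrow> 'b) \<Rightarrow> 'b topology" where
  "quot_topology X q = topology (\<lambda>U. U \<subseteq> q ` topspace X \<and> openin X {x \<in> topspace X. q x \<in> U})"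

lemma istopology_quot:
  "istopology (\<lambda>U. U \<subseteq> q ` topspace X \<and> openin X {x \<in> topspace X. q x \<in> U})"
proof -
  have 1: "openin X {x \<in> topspace X. q x \<in> S \<inter> T}"
    if "openin X {x \<in> topspace X. q x \<in> S}" "openin X {x \<in> topspace X. q x \<in> T}" for S T
  proof -
    have "{x \<in> topspace X. q x \<in> S \<inter> T} = {x \<in> topspace X. q x \<in> S} \<inter> {x \<in> topspace X. q x \<in> T}" by auto
    then show ?thesis using that by auto
  qed
  have 2: "openin X {x \<in> topspace X. q x \<in> \<Union>\<K>}"
    if "\<forall>K\<in>\<K>. openin X {x \<in> topspace X. q x \<in> K}" for \<K>
  proof -
    have "{x \<in> topspace X. q x \<in> \<Union>\<K>} = \<Union>((\<lambda>K. {x \<in> topspace X. q x \<in> K}) ` \<K>)" by auto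
    then show ?thesis using that by auto
  qed
  show ?thesis unfolding istopology_def using 1 2 by blast
qed

lemma openin_quot_topology:
  "openin (quot_topology X q) U \<longleftrightarrow> U \<subseteq> q ` topspace X \<and> openin X {x \<in> topspace X. q x \<in> U}"
  unfolding quot_topology_def by (simp add: topology_inverse'[OF istopology_quot])

text \<open>A precubical set is given by its cube sets K n (n-cubes) and face maps
  d i e : K n -> K (n-1) for 1 <= i <= n (e = False means epsilon = 0, e = True means epsilon = 1).\<close>

definition precubical :: "(nat \<Rightarrow> 'c set) \<Rightarrow> (nat \<Rightarrow> bool \<Rightarrow> 'c \<Rightarrow> 'c) \<Rightarrow> bool" where
  "precubical K d \<longleftrightarrow>
     (\<forall>m n. m \<noteq> n \<longrightarrow> K m \<inter> K n = {}) \<and>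
     (\<forall>n i e c. c \<in> K n \<and> 1 \<le> i \<and> i \<le> n \<longrightarrow> d i e c \<in> K (n - 1)) \<and>
     (\<forall>n i j e e' c. c \<in> K n \<and> 1 \<le> i \<and> i < j \<and> j \<le> n \<longrightarrow>
          d i e (d j e' c) = d (j - 1) e' (d i e c))"

text \<open>The standard n-cube [0,1]^n, with points encoded as functions nat => real
  that vanish at indices >= n (coordinate x_k is the value at k-1).\<close>

definition cube :: "nat \<Rightarrow> (nat \<Rightarrow> real) set" where
  "cube n = {x. (\<forall>i<n. 0 \<le> x i \<and> x i \<le> 1) \<and> (\<forall>i\<ge>n. x i = 0)}"

definition coface :: "bool \<Rightarrow> nat \<Rightarrow> (nat \<Rightarrow> real) \<Rightarrow> (nat \<Rightarrow> real)" where
  "coface e i x = (\<lambda>j. if j < i - 1 then x j else if j = i - 1 then (if e then 1 else 0) else x (j - 1))"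

definition rlz_pre :: "(nat \<Rightarrow> 'c set) \<Rightarrow> ((nat \<times> 'c) \<times> (nat \<Rightarrow> real)) topology" where
  "rlz_pre K = sum_topology (\<lambda>(n, c). subtopology euclidean (cube n)) (Sigma UNIV K)"

definition rlz_step :: "(nat \<Rightarrow> 'c set) \<Rightarrow> (nat \<Rightarrow> bool \<Rightarrow> 'c \<Rightarrow> 'c)
    \<Rightarrow> ((nat \<times> 'c) \<times> (nat \<Rightarrow> real)) \<Rightarrow> ((nat \<times> 'c) \<times> (nat \<Rightarrow> real)) \<Rightarrow> bool" where
  "rlz_step K d p q \<longleftrightarrow>
     (\<exists>n c e i x. c \<in> K n \<and> 1 \<le> i \<and> i \<le> n \<and> x \<in> cube (n - 1) \<and>
        p = ((n - 1, d i e c), x) \<and> q = ((n, c), coface e i x))"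

definition rlz_cls :: "(nat \<Rightarrow> 'c set) \<Rightarrow> (nat \<Rightarrow> bool \<Rightarrow> 'c \<Rightarrow> 'c)
    \<Rightarrow> ((nat \<times> 'c) \<times> (nat \<Rightarrow> real)) \<Rightarrow> ((nat \<times> 'c) \<times> (nat \<Rightarrow> real)) set" where
  "rlz_cls K d p = {q. equivclp (rlz_step K d) p q}"

definition realization :: "(nat \<Rightarrow> 'c set) \<Rightarrow> (nat \<Rightarrow> bool \<Rightarrow> 'c \<Rightarrow> 'c)
    \<Rightarrow> ((nat \<times> 'c) \<times> (nat \<Rightarrow> real)) set topology" where
  "realization K d = quot_topology (rlz_pre K) (rlz_cls K d)"

definition rlz_vertex :: "(nat \<Rightarrow> 'c set) \<Rightarrow> (nat \<Rightarrow> bool \<Rightarrow> 'c \<Rightarrow> 'c) \<Rightarrow> 'c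
    \<Rightarrow> ((nat \<times> 'c) \<times> (nat \<Rightarrow> real)) set" where
  "rlz_vertex K d v = rlz_cls K d ((0, v), (\<lambda>_. 0))"

definition is_dpath :: "(nat \<Rightarrow> 'c set) \<Rightarrow> (nat \<Rightarrow> bool \<Rightarrow> 'c \<Rightarrow> 'c)
    \<Rightarrow> (real \<Rightarrow> ((nat \<times> 'c) \<times> (nat \<Rightarrow> real)) set) \<Rightarrow> bool" where
  "is_dpath K d \<alpha> \<longleftrightarrow>
     continuous_map (top_of_set {0..1}) (realization K d) \<alpha> \<and>
     (\<exists>(m::nat) (t::nat \<Rightarrow> real) (n::nat \<Rightarrow> nat) (c::nat \<Rightarrow> 'c) (\<beta>::nat \<Rightarrow> real \<Rightarrow> (nat \<Rightarrow> real)).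
        t 0 = 0 \<and> t m = 1 \<and> (\<forall>k<m. t k < t (Suc k)) \<and>
        (\<forall>k\<in>{1..m}.
           c k \<in> K (n k) \<and>
           continuous_on {t (k - 1)..t k} (\<beta> k) \<and>
           \<beta> k ` {t (k - 1)..t k} \<subseteq> cube (n k) \<and>
           (\<forall>i<n k. mono_on {t (k - 1)..t k} (\<lambda>s. \<beta> k s i)) \<and>
           (\<forall>s\<in>{t (k - 1)..t k}. \<alpha> s = rlz_cls K d ((n k, c k), \<beta> k s))))"

text \<open>Compact-open topology on functions X -> Y (as a topology on all functions;
  one restricts to a subspace of continuous maps).\<close>

definition compact_open :: "'a topology \<Rightarrow> 'b topology \<Rightarrow> ('a \<Rightarrow> 'b) topology" where
  "compact_open X Y = topology_generated_by
     {{f. f ` C \<subseteq> U} | C U. compactin X C \<and> openin Y U}"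

text \<open>The space of d-paths from v0 to v1; paths are functions on [0,1], made
  unique by requiring them to be extensional (undefined outside [0,1]).\<close>

definition dpath_space :: "(nat \<Rightarrow> 'c set) \<Rightarrow> (nat \<Rightarrow> bool \<Rightarrow> 'c \<Rightarrow> 'c) \<Rightarrow> 'c \<Rightarrow> 'c
    \<Rightarrow> (real \<Rightarrow> ((nat \<times> 'c) \<times> (nat \<Rightarrow> real)) set) topology" where
  "dpath_space K d v0 v1 =
     subtopology (compact_open (top_of_set {0..1}) (realization K d))
       {\<alpha>. \<alpha> \<in> extensional {0..1} \<and> is_dpath K d \<alpha> \<and>
            \<alpha> 0 = rlz_vertex K d v0 \<and> \<alpha> 1 = rlz_vertex K d v1}"

definition Zcubes :: "nat \<Rightarrow> nat set" where
  "Zcubes n = {n}"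

definition Zface :: "nat \<Rightarrow> bool \<Rightarrow> nat \<Rightarrow> nat" where
  "Zface i e c = c - 1"

lemma precubical_Z: "precubical Zcubes Zface"
  unfolding precubical_def Zcubes_def Zface_def by auto

text \<open>Ordered configurations of n distinct points in R^2, encoded as functions
  nat => R^2 injective on {..<n} and vanishing elsewhere (product topology).\<close>

definition OConf :: "nat \<Rightarrow> (nat \<Rightarrow> real \<times> real) set" where
  "OConf n = {f. inj_on f {..<n} \<and> (\<forall>i\<ge>n. f i = 0)}"

text \<open>UConf(n, R^2) = Conf(n, R^2) / S_n, realised as n-element subsets of R^2
  with the quotient topology.\<close>

definition UConf :: "nat \<Rightarrow> (real \<times> real) set topology" where
  "UConf n = quot_topology (subtopology euclidean (OConf n)) (\<lambda>f. f ` {..<n})"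

end

theory Submission
  imports Defs
begin

text \<open>
  The realization of \<open>Z\<close> is the set of words over the open unit interval: letters 0 and 1 may be
  inserted and deleted freely. Every directed loop lifts to a single cube: it is given by \<open>n\<close> strands,
  nondecreasing functions from 0 to 1, and this lift is unique up to permutations that keep the order of
  strands alive (strictly between 0 and 1) at the same time. The sum of the letters modulo 1 is
  continuous on the realization, so loops close to a given one have lifts close to its lifts; with
  compactness of the monotone functions this makes the path space a quotient of the space of lifts.

  Every strand crosses the decreasing line \<open>u = 3/4 - t/2\<close> exactly once. The time of crossing and a
  level computed from the order of the other letters at that time form a configuration of \<open>n\<close> points
  in the plane. Conversely a configuration gives steep strands crossing the line at the prescribed times,
  ordered by the second coordinate. If the strands are steep enough, strands alive at the same time
  have different levels, so both composites are homotopic to the identity by making strands steeper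
  and then interpolating linearly.
\<close>

section \<open>Points of the realization as words\<close>

text \<open>A loop does not determine its lift: strands never alive together may be listed in either
  order. Every number computed from a lift (level, slope, separation) must ignore that order, hence
  the weights that vanish on dead strands. Maps and homotopies are explicit formulas on lifts and
  descend along the quotient maps. A strand may also stand still, so the times at which it takes a
  given value can fill an interval. Relative to a line of slope -1/2 every nondecreasing strand
  gains at rate at least 1/2, which makes its crossing time unique and continuous in the strand.
  Lifts carry the topology of pointwise convergence: Tychonoff supplies compactness there, and
  monotonicity supplies the uniformity that pointwise convergence lacks. The strands built from a
  configuration need not reproduce its levels; they only keep the order of levels at equal times.
  The composite on configurations is therefore only homotopic to the identity, by moving the second
  coordinates linearly.\<close>

definition live :: "real \<Rightarrow> bool" where
  "live u \<longleftrightarrow> 0 < u \<and> u < 1"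

definition tup :: "real list \<Rightarrow> nat \<Rightarrow> real" where
  "tup l = (\<lambda>i. if i < length l then l ! i else 0)"

definition coords :: "nat \<Rightarrow> (nat \<Rightarrow> real) \<Rightarrow> real list" where
  "coords n x = map x [0..<n]"

definition zpt :: "nat \<Rightarrow> (nat \<Rightarrow> real) \<Rightarrow> ((nat \<times> nat) \<times> (nat \<Rightarrow> real)) set" where
  "zpt n x = rlz_cls Zcubes Zface ((n, n), x)"

definition word :: "nat \<Rightarrow> (nat \<Rightarrow> real) \<Rightarrow> real list" where
  "word n x = filter live (coords n x)"

lemma length_coords [simp]: "length (coords n x) = n"
  by (simp add: coords_def)

lemma tup_coords: "x \<in> cube n \<Longrightarrow> tup (coords n x) = x"
  by (auto simp: coords_def tup_def cube_def)

lemma set_coords: "x \<in> cube n \<Longrightarrow> set (coords n x) \<subseteq> {0..1}"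
  by (auto simp: cube_def coords_def)

lemma live_dead: "u \<in> {0..1} \<Longrightarrow> \<not> live u \<longleftrightarrow> u = 0 \<or> u = 1"
  by (auto simp: live_def)

lemma coords_coface:
  assumes "1 \<le> i" "i \<le> n"
  shows "coords n (coface e i x) =
     coords (i - 1) x @ (if e then 1 else 0) # map x [i - 1..<n - 1]"
proof -
  have "[0..<n] = [0..<i - 1] @ (i - 1) # [i..<n]"
    using assms upt_add_eq_append[of 0 "i - 1" "n - (i - 1)"] upt_conv_Cons[of "i - 1" n] by simp
  moreover have "[i..<n] = map Suc [i - 1..<n - 1]"
    using assms by (simp add: map_Suc_upt)
  ultimately show ?thesis
    using assms by (auto simp: coords_def coface_def)
qed

lemma coords_split:
  assumes "i \<le> n" shows "coords n x = coords i x @ map x [i..<n]"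
  using assms upt_add_eq_append[of 0 i "n - i"] by (simp add: coords_def)

text \<open>The inserted coordinate is 0 or 1, hence dead, and filtering removes it.\<close>

lemma word_coface:
  assumes "1 \<le> i" "i \<le> n"
  shows "word n (coface e i x) = word (n - 1) x"
proof -
  have "i - 1 \<le> n - 1" using assms by simp
  then show ?thesis
    unfolding word_def coords_coface[OF assms] coords_split[OF \<open>i - 1 \<le> n - 1\<close>, of x]
    by (simp add: live_def)
qed

lemma word_equivclp:
  assumes "equivclp (rlz_step Zcubes Zface) p q"
  shows "word (fst (fst p)) (snd p) = word (fst (fst q)) (snd q)"
proof -
  have inv: "word (fst (fst p)) (snd p) = word (fst (fst q)) (snd q)"
    if "rlz_step Zcubes Zface p q" for p q
    using that unfolding rlz_step_def by (auto simp: word_coface)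
  show ?thesis
    using assms
  proof (induction rule: equivclp_induct)
    case (step y z)
    then show ?case using inv[of y z] inv[of z y] by metis
  qed simp
qed

lemma rlz_cls_eq: "rlz_cls K d p = rlz_cls K d q \<longleftrightarrow> equivclp (rlz_step K d) p q"
proof
  assume "rlz_cls K d p = rlz_cls K d q"
  then have "q \<in> rlz_cls K d p"
    by (simp add: rlz_cls_def reflpD[OF reflp_equivclp])
  then show "equivclp (rlz_step K d) p q" by (simp add: rlz_cls_def)
next
  assume "equivclp (rlz_step K d) p q"
  then show "rlz_cls K d p = rlz_cls K d q"
    unfolding rlz_cls_def
    by (auto intro: transpD[OF transp_equivclp] dest: equivclp_sym)
qed

text \<open>Induction on the dimension: a coordinate equal to 0 or 1 exhibits the point as lying on a face.\<close>
lemma zpt_word: "x \<in> cube n \<Longrightarrow> zpt n x = zpt (length (word n x)) (tup (word n x))"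
proof (induction n arbitrary: x)
  case 0
  then show ?case using tup_coords[of x 0] by (simp add: word_def coords_def)
next
  case (Suc n)
  show ?case
  proof (cases "\<forall>i<Suc n. live (x i)")
    case True
    then have "word (Suc n) x = coords (Suc n) x"
      unfolding word_def by (intro filter_True) (auto simp: coords_def)
    then show ?thesis using tup_coords[OF Suc.prems] by simp
  next
    case False
    then obtain i where i: "i < Suc n" "\<not> live (x i)" by blast
    define e where "e = (x i = 1)"
    have xi: "x i = (if e then 1 else 0)"
      using live_dead[of "x i"] i Suc.prems by (auto simp: e_def cube_def)
    define y where "y = (\<lambda>j. if j < i then x j else x (Suc j))"
    have y: "y \<in> cube n"
      using Suc.prems i by (auto simp: cube_def y_def)
    have xy: "x = coface e (Suc i) y"
    proof
      fix j
      consider "j < i" | "j = i" | "i < j" by linarith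
      then show "x j = coface e (Suc i) y j"
        by cases (use xi in \<open>auto simp: coface_def y_def\<close>)
    qed
    have "rlz_step Zcubes Zface ((n, n), y) ((Suc n, Suc n), x)"
      unfolding rlz_step_def
      by (rule exI[of _ "Suc n"], rule exI[of _ "Suc n"], rule exI[of _ e], rule exI[of _ "Suc i"], rule exI[of _ y])
        (use i y xy in \<open>auto simp: Zcubes_def Zface_def\<close>)
    then have "zpt n y = zpt (Suc n) x"
      unfolding zpt_def rlz_cls_eq by (metis equivclp_def r_into_rtranclp symclpI1)
    moreover have "word (Suc n) x = word n y"
      using word_coface[of "Suc i" "Suc n" e y] xy i by simp
    ultimately show ?thesis using Suc.IH[OF y] by simp
  qed
qed

text \<open>The word is a complete invariant: passing to a face deletes only a dead letter, and
  conversely every point equals the one whose coordinates are its word.\<close>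

lemma zpt_eq_iff:
  assumes "x \<in> cube n" "y \<in> cube m"
  shows "zpt n x = zpt m y \<longleftrightarrow> word n x = word m y"
  using zpt_word assms word_equivclp[of "((n, n), x)" "((m, m), y)"]
  by (metis fst_conv rlz_cls_eq snd_conv zpt_def)

text \<open>A point is an equivalence class, so its word is read off an arbitrary representative;
  \<open>word_equivclp\<close> makes the choice immaterial.\<close>

definition wof :: "((nat \<times> nat) \<times> (nat \<Rightarrow> real)) set \<Rightarrow> real list" where
  "wof P = (let p = SOME p. p \<in> P in word (fst (fst p)) (snd p))"

lemma wof_zpt [simp]: "wof (zpt n x) = word n x"
proof -
  have "((n, n), x) \<in> zpt n x"
    by (simp add: zpt_def rlz_cls_def reflpD[OF reflp_equivclp])
  then have "(SOME p. p \<in> zpt n x) \<in> zpt n x" by (rule someI)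
  then show ?thesis
    unfolding wof_def Let_def
    using word_equivclp[of "((n, n), x)"] by (simp add: zpt_def rlz_cls_def)
qed

section \<open>Topology of the realization of \<open>Z\<close>\<close>

abbreviation ZZ :: "((nat \<times> nat) \<times> (nat \<Rightarrow> real)) set topology" where
  "ZZ \<equiv> realization Zcubes Zface"

lemma topspace_pre:
  "topspace (rlz_pre Zcubes) = {((n, n), x) | n x. x \<in> cube n}"
  by (auto simp: rlz_pre_def Zcubes_def)

lemma topspace_ZZ: "topspace ZZ = {zpt n x | n x. x \<in> cube n}"
proof -
  have "topspace ZZ = rlz_cls Zcubes Zface ` topspace (rlz_pre Zcubes)"
  proof -
    have "{x \<in> topspace (rlz_pre Zcubes). rlz_cls Zcubes Zface x \<in> rlz_cls Zcubes Zface ` topspace (rlz_pre Zcubes)} = topspace (rlz_pre Zcubes)"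
      by blast
    then have "openin ZZ (rlz_cls Zcubes Zface ` topspace (rlz_pre Zcubes))"
      unfolding realization_def openin_quot_topology by simp
    moreover have "topspace ZZ \<subseteq> rlz_cls Zcubes Zface ` topspace (rlz_pre Zcubes)"
      using openin_topspace[of ZZ] unfolding realization_def openin_quot_topology by blast
    ultimately show ?thesis using openin_subset by blast
  qed
  then show ?thesis unfolding topspace_pre zpt_def by blast
qed

text \<open>\<open>Z\<close> has a single cube in each dimension, so openness is tested once for
  every \<open>n\<close>.\<close>

lemma openin_ZZ:
  "openin ZZ U \<longleftrightarrow> U \<subseteq> topspace ZZ \<and> (\<forall>n. openin (top_of_set (cube n)) {x \<in> cube n. zpt n x \<in> U})"
proof -
  have *: "rlz_cls Zcubes Zface ` topspace (rlz_pre Zcubes) = topspace ZZ"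
    unfolding topspace_ZZ topspace_pre zpt_def by blast
  have "openin (rlz_pre Zcubes) {p \<in> topspace (rlz_pre Zcubes). rlz_cls Zcubes Zface p \<in> U} \<longleftrightarrow>
     (\<forall>n. openin (top_of_set (cube n)) {x \<in> cube n. zpt n x \<in> U})"
    unfolding rlz_pre_def openin_sum_topology
    by (auto simp: Zcubes_def zpt_def)
  then show ?thesis
    unfolding realization_def openin_quot_topology *[unfolded realization_def] by simp
qed

lemma zpt_in [simp, intro]: "x \<in> cube n \<Longrightarrow> zpt n x \<in> topspace ZZ"
  by (auto simp: topspace_ZZ)

lemma continuous_zpt: "continuous_map (top_of_set (cube n)) ZZ (zpt n)"
  unfolding continuous_map_def by (auto simp: openin_ZZ)

lemma continuous_from_ZZ:
  assumes "\<And>n. continuous_map (top_of_set (cube n)) Y (\<lambda>x. g (zpt n x))"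
  shows "continuous_map ZZ Y g"
  unfolding continuous_map_def
proof (intro conjI allI impI)
  show "g \<in> topspace ZZ \<rightarrow> topspace Y"
    using assms by (auto simp: topspace_ZZ continuous_map_def)
  fix U assume U: "openin Y U"
  have "{x \<in> cube n. zpt n x \<in> {x \<in> topspace ZZ. g x \<in> U}} = {x \<in> cube n. g (zpt n x) \<in> U}" for n
    by auto
  then show "openin ZZ {x \<in> topspace ZZ. g x \<in> U}"
    using assms U unfolding openin_ZZ continuous_map_def by auto
qed

text \<open>Ignores the letters 0 and 1 when the weights vanish there, and so descends to the realization.\<close>
fun subseq_sum :: "(real \<Rightarrow> real) list \<Rightarrow> real list \<Rightarrow> real" where
  "subseq_sum [] ws = 1"
| "subseq_sum (g # gs) [] = 0"
| "subseq_sum (g # gs) (w # ws) = g w * subseq_sum gs ws + subseq_sum (g # gs) ws"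

lemma subseq_sum_filter:
  "\<lbrakk>\<forall>g\<in>set gs. g 0 = 0 \<and> g 1 = 0; set l \<subseteq> {0..1}\<rbrakk> \<Longrightarrow> subseq_sum gs (filter live l) = subseq_sum gs l"
  by (induction gs l rule: subseq_sum.induct) (auto simp: live_dead[simplified])

lemma continuous_on_coord:
  fixes x :: "'a::topological_space \<Rightarrow> 'i \<Rightarrow> 'b::topological_space"
  shows "continuous_on A x \<Longrightarrow> continuous_on A (\<lambda>a. x a i)"
  by (rule continuous_on_product_then_coordinatewise)

lemma continuous_on_subseq_sum:
  "\<forall>g\<in>set gs. continuous_on UNIV g \<Longrightarrow> continuous_on A (\<lambda>x::nat \<Rightarrow> real. subseq_sum gs (map x is))"
proof (induction gs arbitrary: "is")
  case (Cons g gs)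
  have g: "continuous_on A (\<lambda>x. g (x i))" for i
    by (rule continuous_on_compose2[of UNIV g]) (use Cons.prems in \<open>auto intro!: continuous_on_coord continuous_on_id\<close>)
  show ?case
    by (induction "is") (use Cons g in \<open>auto intro!: continuous_intros\<close>)
qed auto

lemma subseq_sum_short: "length ws < length gs \<Longrightarrow> subseq_sum gs ws = 0"
  by (induction gs ws rule: subseq_sum.induct) auto

lemma subseq_sum_same_length:
  "length ws = length gs \<Longrightarrow> subseq_sum gs ws = (\<Prod>i<length gs. (gs ! i) (ws ! i))"
proof (induction gs ws rule: subseq_sum.induct)
  case (3 g gs w ws)
  then show ?case
    by (simp add: subseq_sum_short prod.lessThan_Suc_shift del: prod.lessThan_Suc)
qed auto

lemma finite_pos_lower_bound:
  fixes S :: "real set"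
  assumes "finite S" "\<And>s. s \<in> S \<Longrightarrow> 0 < s"
  shows "\<exists>c>0. \<forall>s\<in>S. c \<le> s"
proof (cases "S = {}")
  case False
  then show ?thesis using assms by (intro exI[of _ "Min S"]) auto
qed (auto intro: exI[of _ 1])

lemma continuous_subseq_sum_ZZ:
  assumes "\<forall>g\<in>set gs. continuous_on UNIV g \<and> g 0 = 0 \<and> g 1 = 0"
  shows "continuous_map ZZ euclideanreal (\<lambda>P. subseq_sum gs (wof P))"
proof (rule continuous_from_ZZ)
  fix n
  have "continuous_on (cube n) (\<lambda>x. subseq_sum gs (map x [0..<n]))"
    by (rule continuous_on_subseq_sum) (use assms in auto)
  then have "continuous_on (cube n) (\<lambda>x. subseq_sum gs (word n x))"
    by (rule continuous_on_eq)
      (use assms set_coords in \<open>simp add: word_def subseq_sum_filter coords_def\<close>)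
  then show "continuous_map (top_of_set (cube n)) euclideanreal (\<lambda>x. subseq_sum gs (wof (zpt n x)))"
    by simp
qed

text \<open>Tent functions centred at the letters of the longer word \<open>w\<close> detect
  \<open>w\<close>: a shorter \<open>w'\<close> has no subsequence of that length, and a
  \<open>w'\<close> of equal length contributes only itself, with a factor 0 at a position where the
  letters differ.\<close>

lemma separate_words:
  assumes "list_all live w" "w \<noteq> w'" "length w' \<le> length w"
  shows "\<exists>gs. (\<forall>g\<in>set gs. continuous_on UNIV g \<and> g 0 = 0 \<and> g 1 = 0) \<and> subseq_sum gs w \<noteq> subseq_sum gs w'"
proof -
  \<comment> \<open>Distances of the letters of \<open>w\<close> from 0, from 1 and from the
    different letters of \<open>w'\<close>; a common lower bound \<open>c\<close> becomes height and
    radius of the tents.\<close>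
  let ?S = "set w \<union> (\<lambda>a. 1 - a) ` set w \<union> (((\<lambda>(a, b). \<bar>a - b\<bar>) ` (set w \<times> set w')) - {0})"
  have "\<exists>c>0. \<forall>s\<in>?S. c \<le> s"
    by (rule finite_pos_lower_bound) (use assms(1) in \<open>auto simp: list_all_iff live_def\<close>)
  then obtain c where c: "c > 0" "\<And>a. a \<in> set w \<Longrightarrow> c \<le> a \<and> c \<le> 1 - a"
    "\<And>a b. a \<in> set w \<Longrightarrow> b \<in> set w' \<Longrightarrow> a \<noteq> b \<Longrightarrow> c \<le> \<bar>a - b\<bar>" by fastforce
  define gs where "gs = map (\<lambda>a u::real. max 0 (c - \<bar>u - a\<bar>)) w"
  have len: "length gs = length w" by (simp add: gs_def)
  have gs: "\<forall>g\<in>set gs. continuous_on UNIV g \<and> g 0 = 0 \<and> g 1 = 0"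
    using c(2) by (force simp: gs_def intro!: continuous_intros)
  have pos: "subseq_sum gs w > 0"
    using c(1) by (simp add: subseq_sum_same_length len) (simp add: gs_def prod_pos)
  have "subseq_sum gs w' = 0"
  proof (cases "length w' = length w")
    case True
    then obtain i where i: "i < length w" "w ! i \<noteq> w' ! i"
      using assms(2) nth_equalityI by metis
    then have "c \<le> \<bar>w ! i - w' ! i\<bar>"
      using c(3) True by (metis nth_mem)
    with i have "(gs ! i) (w' ! i) = 0" by (simp add: gs_def)
    with i True show ?thesis by (auto simp: subseq_sum_same_length len intro: prod_zero)
  next
    case False
    with assms(3) show ?thesis by (simp add: subseq_sum_short len)
  qed
  with pos gs show ?thesis by (metis less_irrefl)
qed

lemma live_word: "list_all live (word n x)"
  by (simp add: word_def list_all_iff)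

text \<open>Distinct points have distinct words, and a real function of the form
  \<open>subseq_sum gs\<close> separates these. Needed to identify the limit of lifts of paths with
  a lift of the limit path.\<close>

lemma Hausdorff_ZZ: "Hausdorff_space ZZ"
  unfolding Hausdorff_space_def
proof (intro allI impI, elim conjE)
  fix P Q assume PQ: "P \<in> topspace ZZ" "Q \<in> topspace ZZ" "P \<noteq> Q"
  then obtain n x m y where *: "P = zpt n x" "x \<in> cube n" "Q = zpt m y" "y \<in> cube m"
    by (auto simp: topspace_ZZ)
  then have "word n x \<noteq> word m y" using PQ zpt_eq_iff by metis
  then obtain gs where gs: "\<forall>g\<in>set gs. continuous_on UNIV g \<and> g 0 = 0 \<and> g 1 = 0"
    "subseq_sum gs (word n x) \<noteq> subseq_sum gs (word m y)"
    using separate_words live_word nle_le by (metis (no_types, lifting))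
  let ?f = "\<lambda>P. subseq_sum gs (wof P)"
  have f: "continuous_map ZZ euclideanreal ?f" using gs continuous_subseq_sum_ZZ by blast
  have "?f P \<noteq> ?f Q" using gs * by simp
  then obtain U V where UV: "open U" "open V" "?f P \<in> U" "?f Q \<in> V" "U \<inter> V = {}"
    by (meson hausdorff)
  show "\<exists>U V. openin ZZ U \<and> openin ZZ V \<and> P \<in> U \<and> Q \<in> V \<and> disjnt U V"
  proof (intro exI conjI)
    show "openin ZZ {p \<in> topspace ZZ. ?f p \<in> U}" "openin ZZ {p \<in> topspace ZZ. ?f p \<in> V}"
      using f UV by (auto simp: continuous_map_def)
  qed (use PQ UV in \<open>auto simp: disjnt_def\<close>)
qed

definition ecis :: "((nat \<times> nat) \<times> (nat \<Rightarrow> real)) set \<Rightarrow> complex" where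
  "ecis P = cis (2 * pi * sum_list (wof P))"

text \<open>A removed letter changes the sum by 0 or 1, which the exponential does not see.\<close>

lemma cis_filter_live:
  "set l \<subseteq> {0..1} \<Longrightarrow> cis (2 * pi * sum_list (filter live l)) = cis (2 * pi * sum_list l)"
proof (induction l)
  case (Cons a l)
  then show ?case
    using live_dead[of a]
    by (auto simp: distrib_left cis_mult[symmetric])
qed simp

lemma ecis_zpt:
  assumes "x \<in> cube n" shows "ecis (zpt n x) = cis (2 * pi * (\<Sum>i<n. x i))"
  using cis_filter_live[OF set_coords[OF assms]]
  by (simp add: ecis_def word_def) (simp add: coords_def sum_list_sum_nth atLeast0LessThan)

lemma continuous_ecis: "continuous_map ZZ euclidean ecis"
proof (rule continuous_from_ZZ)
  fix n
  have "continuous_on (cube n) (\<lambda>x. cis (2 * pi * (\<Sum>i<n. x i)))"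
    unfolding cis_conv_exp by (intro continuous_intros continuous_on_coord continuous_on_id)
  then have "continuous_on (cube n) (\<lambda>x. ecis (zpt n x))"
    by (rule continuous_on_eq) (simp add: ecis_zpt)
  then show "continuous_map (top_of_set (cube n)) euclidean (\<lambda>x. ecis (zpt n x))" by simp
qed

text \<open>Continuity into the quotient is checked through local lifts to cubes; the dimension of
  the cube may change from point to point.\<close>

lemma continuous_into_ZZ:
  fixes h :: "'t::topological_space \<Rightarrow> _"
  assumes "\<And>a. a \<in> A \<Longrightarrow> \<exists>N n v. openin (top_of_set A) N \<and> a \<in> N \<and> continuous_on N v \<and>
     v ` N \<subseteq> cube n \<and> (\<forall>b\<in>N. h b = zpt n (v b))"
  shows "continuous_map (top_of_set A) ZZ h"
  unfolding continuous_map_def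
proof (intro conjI allI impI)
  show "h \<in> topspace (top_of_set A) \<rightarrow> topspace ZZ"
    using assms by fastforce
  fix U assume U: "openin ZZ U"
  show "openin (top_of_set A) {a \<in> topspace (top_of_set A). h a \<in> U}"
  proof (subst openin_subopen, intro ballI)
    fix a assume "a \<in> {a \<in> topspace (top_of_set A). h a \<in> U}"
    then have a: "a \<in> A" "h a \<in> U" by auto
    then obtain N n v where N: "openin (top_of_set A) N" "a \<in> N" "continuous_on N v"
      "v ` N \<subseteq> cube n" "\<forall>b\<in>N. h b = zpt n (v b)" using assms by metis
    have "continuous_map (top_of_set N) ZZ (zpt n \<circ> v)"
      using N by (intro continuous_map_compose[OF _ continuous_zpt]) (auto simp: continuous_map_in_subtopology)
    then have "openin (top_of_set N) {b \<in> N. zpt n (v b) \<in> U}"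
      using U by (auto simp: continuous_map_def)
    then have "openin (top_of_set A) {b \<in> N. zpt n (v b) \<in> U}"
      using N(1) openin_trans by blast
    moreover have "a \<in> {b \<in> N. zpt n (v b) \<in> U}" using N a by auto
    moreover have "{b \<in> N. zpt n (v b) \<in> U} \<subseteq> {a \<in> topspace (top_of_set A). h a \<in> U}"
      using N openin_imp_subset[OF N(1)] by auto
    ultimately show "\<exists>T. openin (top_of_set A) T \<and> a \<in> T \<and> T \<subseteq> {a \<in> topspace (top_of_set A). h a \<in> U}"
      by blast
  qed
qed

section \<open>Directed paths in cubes\<close>

text \<open>The direction of the exponential law that holds for arbitrary spaces: by the tube lemma,
  a compact \<open>C\<close> sent into \<open>U\<close> at parameter \<open>s\<close> is sent into
  \<open>U\<close> at all nearby parameters.\<close>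

lemma continuous_into_compact_open:
  assumes H: "continuous_map (prod_topology T X) Y (\<lambda>(s, t). h s t)"
  shows "continuous_map T (compact_open X Y) h"
  unfolding compact_open_def
proof (rule continuous_on_generated_topo)
  fix \<U> assume "\<U> \<in> {{f. f ` C \<subseteq> U} | C U. compactin X C \<and> openin Y U}"
  then obtain C U where CU: "\<U> = {f. f ` C \<subseteq> U}" "compactin X C" "openin Y U" by blast
  let ?W = "{p \<in> topspace (prod_topology T X). (\<lambda>(s, t). h s t) p \<in> U}"
  have W: "openin (prod_topology T X) ?W"
    using H CU(3) by (rule openin_continuous_map_preimage)
  show "openin T (h -` \<U> \<inter> topspace T)"
  proof (subst openin_subopen, intro ballI)
    fix s assume s: "s \<in> h -` \<U> \<inter> topspace T"
    then have "{s} \<times> C \<subseteq> ?W"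
      using CU compactin_subset_topspace by fastforce
    moreover have "s \<in> topspace T" using s by simp
    ultimately have "\<exists>V V'. openin T V \<and> openin X V' \<and> s \<in> V \<and> C \<subseteq> V' \<and> V \<times> V' \<subseteq> ?W"
      by (intro tube_lemma_right[OF W CU(2)])
    then obtain V V' where V: "openin T V" "openin X V'" "s \<in> V" "C \<subseteq> V'" "V \<times> V' \<subseteq> ?W"
      by (elim exE conjE)
    have "V \<subseteq> h -` \<U> \<inter> topspace T"
    proof
      fix r assume r: "r \<in> V"
      have "h r c \<in> U" if "c \<in> C" for c
      proof -
        have "(r, c) \<in> ?W" by (rule subsetD[OF V(5)]) (use r that V(4) in auto)
        then show ?thesis by simp
      qed
      then show "r \<in> h -` \<U> \<inter> topspace T"
        using openin_subset[OF V(1)] r CU by auto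
    qed
    with V show "\<exists>V. openin T V \<and> s \<in> V \<and> V \<subseteq> h -` \<U> \<inter> topspace T" by blast
  qed
next
  \<comment> \<open>The subbasic set with empty \<open>C\<close> and \<open>U\<close> contains every
    function, so the subbasis covers the image of \<open>h\<close>.\<close>
  have "h s \<in> {f. f ` {} \<subseteq> {}}" for s by simp
  then show "h ` topspace T \<subseteq> \<Union> {{f. f ` C \<subseteq> U} | C U. compactin X C \<and> openin Y U}"
    by (force intro: exI[of _ "{}"])
qed

lemma openin_compact_open:
  "compactin X C \<Longrightarrow> openin Y U \<Longrightarrow> openin (compact_open X Y) {f. f ` C \<subseteq> U}"
  unfolding compact_open_def by (rule topology_generated_by_Basis) blast

lemma topspace_compact_open [simp]: "topspace (compact_open X Y) = UNIV"
proof -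
  have "UNIV = {f. f ` {} \<subseteq> {}}" by simp
  then have "UNIV \<in> {{f. f ` C \<subseteq> U} | C U. compactin X C \<and> openin Y U}"
    using compactin_empty[of X] openin_empty[of Y] by blast
  then show ?thesis unfolding compact_open_def topology_generated_by_topspace by blast
qed

section \<open>The space of lifts and its projection to the path space\<close>

abbreviation PP :: "(real \<Rightarrow> ((nat \<times> nat) \<times> (nat \<Rightarrow> real)) set) topology" where
  "PP \<equiv> dpath_space Zcubes Zface 0 0"

text \<open>Lifts are total functions with the value 0 prescribed outside [0,1] and in coordinates
  beyond \<open>n\<close>. They thereby form a subspace of a product of real lines, whose topology
  is pointwise convergence.\<close>

definition cpaths :: "nat \<Rightarrow> (real \<Rightarrow> nat \<Rightarrow> real) set" where
  "cpaths n = {\<beta>. (\<forall>t\<in>{0..1}. \<beta> t \<in> cube n) \<and>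
     (\<forall>i. continuous_on {0..1} (\<lambda>t. \<beta> t i)) \<and> (\<forall>i. mono_on {0..1} (\<lambda>t. \<beta> t i)) \<and>
     (\<forall>i<n. \<beta> 0 i = 0 \<and> \<beta> 1 i = 1) \<and> (\<forall>t. t \<notin> {0..1} \<longrightarrow> \<beta> t = (\<lambda>_. 0))}"

definition all_cpaths :: "(real \<Rightarrow> nat \<Rightarrow> real) set" where
  "all_cpaths = (\<Union>n. cpaths n)"

text \<open>At time 1 the coordinates below the dimension equal 1 and all others 0, so the dimension
  can be recovered from the function alone.\<close>

definition deg :: "(real \<Rightarrow> nat \<Rightarrow> real) \<Rightarrow> nat" where
  "deg \<beta> = (LEAST i. \<beta> 1 i = 0)"

definition toP :: "(real \<Rightarrow> nat \<Rightarrow> real) \<Rightarrow> real \<Rightarrow> ((nat \<times> nat) \<times> (nat \<Rightarrow> real)) set" where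
  "toP \<beta> = (\<lambda>t\<in>{0..1}. zpt (deg \<beta>) (\<beta> t))"

lemma cpathsD:
  assumes "\<beta> \<in> cpaths n"
  shows "t \<in> {0..1} \<Longrightarrow> \<beta> t \<in> cube n" "continuous_on {0..1} (\<lambda>t. \<beta> t i)"
    "mono_on {0..1} (\<lambda>t. \<beta> t i)" "i < n \<Longrightarrow> \<beta> 0 i = 0" "i < n \<Longrightarrow> \<beta> 1 i = 1"
    "t \<notin> {0..1} \<Longrightarrow> \<beta> t = (\<lambda>_. 0)" "t \<in> {0..1} \<Longrightarrow> n \<le> i \<Longrightarrow> \<beta> t i = 0"
    "t \<in> {0..1} \<Longrightarrow> 0 \<le> \<beta> t i" "t \<in> {0..1} \<Longrightarrow> \<beta> t i \<le> 1" "\<beta> 0 i = 0"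
    "s \<in> {0..1} \<Longrightarrow> t \<in> {0..1} \<Longrightarrow> s \<le> t \<Longrightarrow> \<beta> s i \<le> \<beta> t i"
proof -
  show 1: "t \<in> {0..1} \<Longrightarrow> \<beta> t \<in> cube n" "continuous_on {0..1} (\<lambda>t. \<beta> t i)"
    "mono_on {0..1} (\<lambda>t. \<beta> t i)" "i < n \<Longrightarrow> \<beta> 0 i = 0" "i < n \<Longrightarrow> \<beta> 1 i = 1"
    "t \<notin> {0..1} \<Longrightarrow> \<beta> t = (\<lambda>_. 0)" for t i
    using assms by (auto simp: cpaths_def)
  show 2: "t \<in> {0..1} \<Longrightarrow> n \<le> i \<Longrightarrow> \<beta> t i = 0" for t i
    using 1(1) by (auto simp: cube_def)
  show "t \<in> {0..1} \<Longrightarrow> 0 \<le> \<beta> t i" "t \<in> {0..1} \<Longrightarrow> \<beta> t i \<le> 1"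
    using 1(1)[of t] 2[of t i] by (cases "i < n"; simp add: cube_def)+
  show "\<beta> 0 i = 0" using 1(4)[of i] 2[of 0 i] by (cases "i < n") auto
  show "s \<in> {0..1} \<Longrightarrow> t \<in> {0..1} \<Longrightarrow> s \<le> t \<Longrightarrow> \<beta> s i \<le> \<beta> t i"
    using 1(3)[of i] by (auto simp: mono_on_def)
qed

lemma deg_cpaths: "\<beta> \<in> cpaths n \<Longrightarrow> deg \<beta> = n"
  unfolding deg_def
  by (rule Least_equality) (use cpathsD(5)[of \<beta> n] cpathsD(7)[of \<beta> n 1] in \<open>force simp: linorder_not_less[symmetric]\<close>)+

lemma continuous_on_at:
  fixes A :: "('a \<Rightarrow> 'b \<Rightarrow> 'c::topological_space) set"
  shows "continuous_on A (\<lambda>\<beta>. \<beta> t i)"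
  by (rule continuous_on_coord, rule continuous_on_coord, rule continuous_on_id)

text \<open>The values at time 1 are 0 or 1, so comparing finitely many of them with 1/2 fixes the
  dimension. Continuity on \<open>all_cpaths\<close> may thus be checked one dimension at a
  time.\<close>

lemma openin_cpaths: "openin (top_of_set all_cpaths) (cpaths n)"
proof -
  have "cpaths n = all_cpaths \<inter> ((\<Inter>i\<in>{..<n}. {\<beta>. \<beta> 1 i > 1/2}) \<inter> {\<beta>. \<beta> 1 n < 1/2})" (is "_ = _ \<inter> ?U")
  proof (intro equalityI subsetI IntI)
    fix \<beta> assume "\<beta> \<in> all_cpaths \<inter> ?U"
    then obtain m where m: "\<beta> \<in> cpaths m" "\<And>i. i < n \<Longrightarrow> \<beta> 1 i > 1/2" "\<beta> 1 n < 1/2"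
      by (auto simp: all_cpaths_def)
    have "n = m"
      using cpathsD(5,7)[OF m(1)] m(2,3) by (intro antisym leI) fastforce+
    with m show "\<beta> \<in> cpaths n" by simp
  next
    fix \<beta> assume \<beta>: "\<beta> \<in> cpaths n"
    show "\<beta> \<in> all_cpaths" using \<beta> by (auto simp: all_cpaths_def)
    show "\<beta> \<in> (\<Inter>i\<in>{..<n}. {\<beta>. \<beta> 1 i > 1/2})" "\<beta> \<in> {\<beta>. \<beta> 1 n < 1/2}"
      using cpathsD(5)[OF \<beta>] cpathsD(7)[OF \<beta>, of 1 n] by auto
  qed
  moreover have "open ?U"
    by (intro open_Int open_INT ballI open_Collect_less continuous_on_const continuous_on_at) auto
  ultimately show ?thesis unfolding openin_open by blast
qed

text \<open>Joint continuity of evaluation does not come with pointwise convergence; it comes from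
  monotonicity. Near \<open>t\<close> the value of a nearby path is squeezed between its values at
  two fixed times \<open>a\<close> and \<open>b\<close>.\<close>

lemma continuous_on_eval: "continuous_on (cpaths n \<times> {0..1}) (\<lambda>(\<beta>, t). \<beta> t i)"
  unfolding continuous_on_def
proof (intro ballI tendstoI)
  fix p e assume "p \<in> cpaths n \<times> {0..1::real}" "(0::real) < e"
  then obtain \<beta> t where p: "p = (\<beta>, t)" "\<beta> \<in> cpaths n" "t \<in> {0..1}" and e: "0 < e" by auto
  have "continuous_on {0..1} (\<lambda>t. \<beta> t i)" using cpathsD(2)[OF p(2)] .
  then obtain r where r: "r > 0" "\<And>s. s \<in> {0..1} \<Longrightarrow> \<bar>s - t\<bar> < r \<Longrightarrow> \<bar>\<beta> s i - \<beta> t i\<bar> < e / 2"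
    using p(3) half_gt_zero[OF e] unfolding continuous_on_iff dist_real_def by blast
  define d where "d = r / 2"
  have d: "d > 0" "\<And>s. s \<in> {0..1} \<Longrightarrow> \<bar>s - t\<bar> \<le> d \<Longrightarrow> \<bar>\<beta> s i - \<beta> t i\<bar> < e / 2"
    using r by (auto simp: d_def)
  \<comment> \<open>The bracketing times are clamped to [0,1], where monotonicity is
    available.\<close>
  define a where "a = max 0 (t - d)"
  define b where "b = min 1 (t + d)"
  have ab: "a \<in> {0..1}" "b \<in> {0..1}" "\<bar>\<beta> a i - \<beta> t i\<bar> < e / 2" "\<bar>\<beta> b i - \<beta> t i\<bar> < e / 2"
    using d p(3) by (auto simp: a_def b_def)
  let ?U = "{\<gamma>. \<bar>\<gamma> a i - \<beta> a i\<bar> < e / 2} \<inter> {\<gamma>. \<bar>\<gamma> b i - \<beta> b i\<bar> < e / 2}"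
  have "open ?U"
    by (intro open_Int open_Collect_less continuous_intros continuous_on_at)
  then have "open (?U \<times> ball t d)" by (intro open_Times open_ball)
  moreover have "p \<in> ?U \<times> ball t d" using p d e by simp
  moreover have "dist ((\<lambda>(\<beta>, t). \<beta> t i) q) ((\<lambda>(\<beta>, t). \<beta> t i) p) < e"
    if q: "q \<in> ?U \<times> ball t d" "q \<in> cpaths n \<times> {0..1}" for q
  proof -
    obtain \<gamma> s where qs: "q = (\<gamma>, s)" "\<gamma> \<in> cpaths n" "s \<in> {0..1}" using q by auto
    have "a \<le> s" "s \<le> b" using q qs by (auto simp: a_def b_def dist_real_def)
    then have "\<gamma> a i \<le> \<gamma> s i" "\<gamma> s i \<le> \<gamma> b i" using cpathsD(11)[OF qs(2)] ab qs by blast+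
    moreover have "\<bar>\<gamma> a i - \<beta> a i\<bar> < e / 2" "\<bar>\<gamma> b i - \<beta> b i\<bar> < e / 2" using q by (auto simp: qs)
    ultimately show ?thesis using ab(3,4) unfolding qs p dist_real_def prod.case by linarith
  qed
  ultimately show "\<forall>\<^sub>F q in at p within cpaths n \<times> {0..1}.
      dist ((\<lambda>(\<beta>, t). \<beta> t i) q) ((\<lambda>(\<beta>, t). \<beta> t i) p) < e"
    unfolding eventually_at_topological by blast
qed

lemma toP_apply: "\<beta> \<in> cpaths n \<Longrightarrow> t \<in> {0..1} \<Longrightarrow> toP \<beta> t = zpt n (\<beta> t)"
  by (simp add: toP_def deg_cpaths)

lemma topspace_PP:
  "topspace PP = {\<alpha> \<in> extensional {0..1}. is_dpath Zcubes Zface \<alpha> \<and>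
     \<alpha> 0 = zpt 0 (\<lambda>_. 0) \<and> \<alpha> 1 = zpt 0 (\<lambda>_. 0)}"
  by (auto simp: dpath_space_def rlz_vertex_def zpt_def)

lemma continuous_on_into_fun:
  fixes f :: "'a::topological_space \<Rightarrow> 'i \<Rightarrow> 'b::topological_space"
  shows "(\<And>i. continuous_on A (\<lambda>a. f a i)) \<Longrightarrow> continuous_on A f"
  by (rule continuous_on_coordinatewise_then_product)

lemma cpaths_continuous: "\<beta> \<in> cpaths n \<Longrightarrow> continuous_on {0..1} \<beta>"
  by (rule continuous_on_into_fun) (rule cpathsD)

lemma zpt_vertex: "(\<And>i. i < n \<Longrightarrow> x i = 0 \<or> x i = 1) \<Longrightarrow> x \<in> cube n \<Longrightarrow> zpt n x = zpt 0 (\<lambda>_. 0)"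
proof -
  assume x: "\<And>i. i < n \<Longrightarrow> x i = 0 \<or> x i = 1" "x \<in> cube n"
  have "word n x = []"
    using x(1) by (force simp: word_def coords_def filter_empty_conv live_def)
  moreover have "(\<lambda>_. 0) \<in> cube 0" "word 0 (\<lambda>_. 0) = []" by (auto simp: cube_def word_def coords_def)
  ultimately show "zpt n x = zpt 0 (\<lambda>_. 0)" using zpt_eq_iff x(2) by metis
qed

lemma toP_in_PP:
  assumes "\<beta> \<in> cpaths n" shows "toP \<beta> \<in> topspace PP"
proof -
  have cont: "continuous_map (top_of_set {0..1}) ZZ (toP \<beta>)"
  proof (rule continuous_into_ZZ)
    fix t :: real assume t: "t \<in> {0..1}"
    show "\<exists>N m v. openin (top_of_set {0..1}) N \<and> t \<in> N \<and> continuous_on N v \<and>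
       v ` N \<subseteq> cube m \<and> (\<forall>b\<in>N. toP \<beta> b = zpt m (v b))"
      by (rule exI[of _ "{0..1}"], rule exI[of _ n], rule exI[of _ \<beta>])
        (use t assms cpathsD(1)[OF assms] cpaths_continuous[OF assms] in \<open>auto simp: toP_apply\<close>)
  qed
  have "is_dpath Zcubes Zface (toP \<beta>)"
    unfolding is_dpath_def
  proof (intro conjI cont exI)
    show "(\<lambda>k. if k = 0 then 0 else 1) (0::nat) = (0::real)"
      "(\<lambda>k. if k = 0 then 0 else 1) (1::nat) = (1::real)"
      "\<forall>k<(1::nat). (if k = 0 then 0 else 1::real) < (if Suc k = 0 then 0 else 1)" by auto
    show "\<forall>k\<in>{1..1::nat}. (\<lambda>_. n) k \<in> Zcubes ((\<lambda>_. n) k) \<and>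
       continuous_on {if k - 1 = 0 then 0 else 1..if k = 0 then 0 else 1} ((\<lambda>_. \<beta>) k) \<and>
       (\<lambda>_. \<beta>) k ` {if k - 1 = 0 then 0 else 1..if k = 0 then 0 else 1} \<subseteq> cube ((\<lambda>_. n) k) \<and>
       (\<forall>i<(\<lambda>_. n) k. mono_on {if k - 1 = 0 then 0 else 1..if k = 0 then 0 else 1} (\<lambda>s. (\<lambda>_. \<beta>) k s i)) \<and>
       (\<forall>s\<in>{if k - 1 = 0 then 0 else 1..if k = 0 then 0 else 1}.
          toP \<beta> s = rlz_cls Zcubes Zface (((\<lambda>_. n) k, (\<lambda>_. n) k), (\<lambda>_. \<beta>) k s))"
      using cpathsD[OF assms] cpaths_continuous[OF assms] toP_apply[OF assms]
      by (auto simp: Zcubes_def zpt_def)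
  qed
  moreover have "toP \<beta> 0 = zpt 0 (\<lambda>_. 0)" "toP \<beta> 1 = zpt 0 (\<lambda>_. 0)"
    using assms cpathsD[OF assms] zpt_vertex by (auto simp: toP_apply[OF assms])
  ultimately show ?thesis by (auto simp: topspace_PP toP_def)
qed

lemma continuous_into_PP:
  assumes h: "continuous_map (top_of_set (A \<times> {0..1})) ZZ (\<lambda>(s, t). h s t)"
    and P: "\<And>s. s \<in> A \<Longrightarrow> h s \<in> topspace PP"
  shows "continuous_map (top_of_set A) PP h"
proof -
  have "continuous_map (top_of_set A) (compact_open (top_of_set {0..1}) ZZ) h"
    by (rule continuous_into_compact_open) (use h in \<open>simp add: prod_topology_subtopology_eu\<close>)
  with P show ?thesis unfolding dpath_space_def continuous_map_in_subtopology by auto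
qed

lemma continuous_toP: "continuous_map (top_of_set all_cpaths) PP toP"
proof (rule continuous_into_PP)
  show "continuous_map (top_of_set (all_cpaths \<times> {0..1})) ZZ (\<lambda>(\<beta>, t). toP \<beta> t)"
  proof (rule continuous_into_ZZ)
    fix p assume "p \<in> all_cpaths \<times> {0..1::real}"
    then obtain n where n: "p \<in> cpaths n \<times> {0..1}" by (auto simp: all_cpaths_def)
    have "openin (top_of_set (all_cpaths \<times> {0..1})) (cpaths n \<times> {0..1})"
      by (simp add: openin_Times openin_cpaths)
    moreover have "continuous_on (cpaths n \<times> {0..1}) (\<lambda>(\<beta>, t). \<beta> t)"
      by (rule continuous_on_into_fun) (use continuous_on_eval in \<open>simp add: case_prod_unfold\<close>)
    ultimately show "\<exists>N m v. openin (top_of_set (all_cpaths \<times> {0..1})) N \<and> p \<in> N \<and> continuous_on N v \<and>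
       v ` N \<subseteq> cube m \<and> (\<forall>b\<in>N. (\<lambda>(\<beta>, t). toP \<beta> t) b = zpt m (v b))"
      using n cpathsD(1)
      by (intro exI[of _ "cpaths n \<times> {0..1}"] exI[of _ n] exI[of _ "\<lambda>(\<beta>, t). \<beta> t"])
        (auto simp: toP_apply)
  qed
qed (use toP_in_PP in \<open>auto simp: all_cpaths_def\<close>)

section \<open>Lifting directed paths to a cube\<close>

text \<open>Coordinate functions are kept in lists, since gluing two pieces of a path inserts and
  pairs them by position.\<close>

definition coord_fun :: "real \<Rightarrow> real \<Rightarrow> (real \<Rightarrow> real) \<Rightarrow> bool" where
  "coord_fun l r h \<longleftrightarrow> continuous_on {l..r} h \<and> mono_on {l..r} h \<and> h ` {l..r} \<subseteq> {0..1}"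

definition word_at :: "real \<Rightarrow> (real \<Rightarrow> real) list \<Rightarrow> real list" where
  "word_at s hs = filter live (map (\<lambda>h. h s) hs)"

lemma coord_fun_min:
  assumes "coord_fun 0 a f" "0 \<le> a" shows "coord_fun 0 b (\<lambda>s. f (min s a))"
  unfolding coord_fun_def
proof (intro conjI)
  show "continuous_on {0..b} (\<lambda>s. f (min s a))"
    by (rule continuous_on_compose2[of "{0..a}" f]) (use assms in \<open>auto simp: coord_fun_def intro!: continuous_intros\<close>)
  show "mono_on {0..b} (\<lambda>s. f (min s a))"
    using assms by (auto simp: coord_fun_def mono_on_def)
qed (use assms in \<open>auto simp: coord_fun_def image_subset_iff\<close>)

lemma coord_fun_max:
  assumes "coord_fun a b g" "a \<le> b" shows "coord_fun 0 b (\<lambda>s. g (max s a))"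
  unfolding coord_fun_def
proof (intro conjI)
  show "continuous_on {0..b} (\<lambda>s. g (max s a))"
    by (rule continuous_on_compose2[of "{a..b}" g]) (use assms in \<open>auto simp: coord_fun_def intro!: continuous_intros\<close>)
  show "mono_on {0..b} (\<lambda>s. g (max s a))"
    using assms by (auto simp: coord_fun_def mono_on_def)
qed (use assms in \<open>auto simp: coord_fun_def image_subset_iff\<close>)

text \<open>Writing the concatenation as a sum of the two constant prolongations, minus the common
  value, gives continuity and monotonicity without splitting the interval.\<close>

lemma coord_fun_join:
  assumes f: "coord_fun 0 a f" and g: "coord_fun a b g" and ab: "0 \<le> a" "a \<le> b" and eq: "f a = g a"
  shows "coord_fun 0 b (\<lambda>s. f (min s a) + g (max s a) - f a)"
  unfolding coord_fun_def
proof (intro conjI)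
  note F = coord_fun_min[OF f ab(1), of b] and G = coord_fun_max[OF g ab(2)]
  show "continuous_on {0..b} (\<lambda>s. f (min s a) + g (max s a) - f a)"
    using F G by (auto simp: coord_fun_def intro!: continuous_intros)
  show "mono_on {0..b} (\<lambda>s. f (min s a) + g (max s a) - f a)"
    using F G unfolding coord_fun_def mono_on_def by (meson add_mono diff_right_mono)
  show "(\<lambda>s. f (min s a) + g (max s a) - f a) ` {0..b} \<subseteq> {0..1}"
  proof (intro image_subsetI)
    fix s assume "s \<in> {0..b}"
    then show "f (min s a) + g (max s a) - f a \<in> {0..1}"
      using F G eq by (cases "s \<le> a") (auto simp: coord_fun_def image_subset_iff min_def max_def split: if_splits)
  qed
qed

text \<open>Coordinates that are 0 or 1 at time \<open>a\<close> are prolonged by constants; the others are matched by their position in the word.\<close>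
lemma merge_coord_funs:
  assumes ab: "0 \<le> a" "a \<le> b"
  shows "list_all (coord_fun 0 a) fs \<Longrightarrow> list_all (coord_fun a b) gs \<Longrightarrow> word_at a fs = word_at a gs \<Longrightarrow>
    \<exists>hs. list_all (coord_fun 0 b) hs \<and> (\<forall>s\<in>{0..a}. word_at s hs = word_at s fs) \<and>
      (\<forall>s\<in>{a..b}. word_at s hs = word_at s gs)"
proof (induction "length fs + length gs" arbitrary: fs gs rule: less_induct)
  case less
  consider (f) f fs' where "fs = f # fs'" "\<not> live (f a)" | (g) g gs' where "gs = g # gs'" "\<not> live (g a)"
    | (both) f fs' g gs' where "fs = f # fs'" "live (f a)" "gs = g # gs'" "live (g a)"
    | (nil) "fs = []" "gs = []"
  proof (cases fs; cases gs)
    show thesis if "fs = []" "gs = []" using that nil by blast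
    show thesis if "fs = []" "gs = g # gs'" for g gs'
      using that less.prems g by (cases "live (g a)") (auto simp: word_at_def)
    show thesis if "fs = f # fs'" "gs = []" for f fs'
      using that less.prems f by (cases "live (f a)") (auto simp: word_at_def)
    show thesis if "fs = f # fs'" "gs = g # gs'" for f fs' g gs'
      using that f g both by blast
  qed
  then show ?case
  proof cases
    case f
    have "\<exists>hs. list_all (coord_fun 0 b) hs \<and> (\<forall>s\<in>{0..a}. word_at s hs = word_at s fs') \<and>
      (\<forall>s\<in>{a..b}. word_at s hs = word_at s gs)"
      by (rule less.hyps) (use f less.prems in \<open>auto simp: word_at_def\<close>)
    then obtain hs where "list_all (coord_fun 0 b) hs" "\<forall>s\<in>{0..a}. word_at s hs = word_at s fs'"
      "\<forall>s\<in>{a..b}. word_at s hs = word_at s gs" by blast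
    then show ?thesis
      using f less.prems coord_fun_min[of a f b] ab
      by (intro exI[of _ "(\<lambda>s. f (min s a)) # hs"]) (auto simp: word_at_def min_def)
  next
    case g
    have "\<exists>hs. list_all (coord_fun 0 b) hs \<and> (\<forall>s\<in>{0..a}. word_at s hs = word_at s fs) \<and>
      (\<forall>s\<in>{a..b}. word_at s hs = word_at s gs')"
      by (rule less.hyps) (use g less.prems in \<open>auto simp: word_at_def\<close>)
    then obtain hs where "list_all (coord_fun 0 b) hs" "\<forall>s\<in>{0..a}. word_at s hs = word_at s fs"
      "\<forall>s\<in>{a..b}. word_at s hs = word_at s gs'" by blast
    then show ?thesis
      using g less.prems coord_fun_max[of a b g] ab
      by (intro exI[of _ "(\<lambda>s. g (max s a)) # hs"]) (auto simp: word_at_def max_def)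
  next
    case both
    then have eq: "f a = g a" and "word_at a fs' = word_at a gs'"
      using less.prems by (auto simp: word_at_def)
    then have "\<exists>hs. list_all (coord_fun 0 b) hs \<and> (\<forall>s\<in>{0..a}. word_at s hs = word_at s fs') \<and>
      (\<forall>s\<in>{a..b}. word_at s hs = word_at s gs')"
      using both less.prems by (intro less.hyps) auto
    then obtain hs where "list_all (coord_fun 0 b) hs" "\<forall>s\<in>{0..a}. word_at s hs = word_at s fs'"
      "\<forall>s\<in>{a..b}. word_at s hs = word_at s gs'" by blast
    then show ?thesis
      using both less.prems coord_fun_join[of a f b g] ab eq
      by (intro exI[of _ "(\<lambda>s. f (min s a) + g (max s a) - f a) # hs"]) (auto simp: word_at_def max_def min_def)
  next
    case nil
    then show ?thesis by (intro exI[of _ "[]"]) (auto simp: word_at_def)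
  qed
qed

lemma word_at_filter:
  "(\<And>h. h \<in> set hs \<Longrightarrow> \<not> p h \<Longrightarrow> \<not> live (h s)) \<Longrightarrow> word_at s (filter p hs) = word_at s hs"
  by (induction hs) (auto simp: word_at_def)

text \<open>Induction over the segments. At a breakpoint both adjacent cubes represent the same
  point, hence have the same word, which is what merging requires. The start at the vertex, with
  empty word, allows the empty list initially.\<close>

lemma dpath_coord_funs:
  assumes "is_dpath Zcubes Zface \<alpha>" "\<alpha> 0 = zpt 0 (\<lambda>_. 0)"
  shows "\<exists>hs. list_all (coord_fun 0 1) hs \<and> (\<forall>s\<in>{0..1}. wof (\<alpha> s) = word_at s hs)"
proof -
  obtain m t n c \<beta> where D: "t 0 = (0::real) \<and> t m = 1 \<and> (\<forall>k<m. t k < t (Suc k)) \<and>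
        (\<forall>k\<in>{1..m::nat}. c k \<in> Zcubes (n k) \<and> continuous_on {t (k - 1)..t k} (\<beta> k) \<and>
           \<beta> k ` {t (k - 1)..t k} \<subseteq> cube (n k) \<and> (\<forall>i<n k. mono_on {t (k - 1)..t k} (\<lambda>s. \<beta> k s i)) \<and>
           (\<forall>s\<in>{t (k - 1)..t k}. \<alpha> s = rlz_cls Zcubes Zface ((n k, c k), \<beta> k s)))"
    using conjunct2[OF assms(1)[unfolded is_dpath_def]] by (elim exE) (rule that)
  then have t: "t 0 = 0" "t m = 1" "\<And>k::nat. k < m \<Longrightarrow> t k < t (Suc k)" by simp_all
  note \<beta> = bspec[OF conjunct2[OF conjunct2[OF conjunct2[OF D]]]]
  have "0 \<le> t k \<and> (\<exists>hs. list_all (coord_fun 0 (t k)) hs \<and> (\<forall>s\<in>{0..t k}. wof (\<alpha> s) = word_at s hs))"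
    if "k \<le> m" for k
    using that
  proof (induction k)
    case 0
    have "wof (\<alpha> 0) = []" by (simp add: assms(2) word_def coords_def)
    then show ?case using t(1) by (auto intro!: exI[of _ "[]"] simp: word_at_def)
  next
    case (Suc k)
    then obtain fs where fs: "0 \<le> t k" "list_all (coord_fun 0 (t k)) fs"
      "\<And>s. s \<in> {0..t k} \<Longrightarrow> wof (\<alpha> s) = word_at s fs" by auto
    have lt: "t k < t (Suc k)" using t Suc by simp
    let ?N = "n (Suc k)" and ?\<beta> = "\<beta> (Suc k)" and ?I = "{t k..t (Suc k)}"
    have B: "c (Suc k) = ?N" "continuous_on ?I ?\<beta>" "?\<beta> ` ?I \<subseteq> cube ?N"
      "\<And>i. i < ?N \<Longrightarrow> mono_on ?I (\<lambda>s. ?\<beta> s i)" "\<And>s. s \<in> ?I \<Longrightarrow> \<alpha> s = zpt ?N (?\<beta> s)"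
      using \<beta>[of "Suc k"] Suc.prems by (auto simp: Zcubes_def zpt_def)
    define gs where "gs = map (\<lambda>i s. ?\<beta> s i) [0..<?N]"
    have gs: "list_all (coord_fun (t k) (t (Suc k))) gs"
      using B(2-4) unfolding gs_def coord_fun_def list_all_iff
      by (auto simp: image_subset_iff cube_def intro!: continuous_on_coord)
    have wg: "wof (\<alpha> s) = word_at s gs" if "s \<in> ?I" for s
      using B(5)[OF that] by (simp add: word_at_def gs_def word_def coords_def o_def)
    have "\<exists>hs. list_all (coord_fun 0 (t (Suc k))) hs \<and> (\<forall>s\<in>{0..t k}. word_at s hs = word_at s fs) \<and>
      (\<forall>s\<in>?I. word_at s hs = word_at s gs)"
      by (rule merge_coord_funs) (use fs gs lt wg in \<open>auto simp: fs(3)[symmetric]\<close>)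
    then obtain hs where hs: "list_all (coord_fun 0 (t (Suc k))) hs" "\<And>s. s\<in>{0..t k} \<Longrightarrow> word_at s hs = word_at s fs"
      "\<And>s. s\<in>?I \<Longrightarrow> word_at s hs = word_at s gs" by blast
    have "wof (\<alpha> s) = word_at s hs" if "s \<in> {0..t (Suc k)}" for s
      using that hs fs wg by (cases "s \<le> t k") auto
    with hs(1) lt fs(1) show ?case by auto
  qed
  from this[of m] t(2) show ?thesis by simp
qed

text \<open>At both ends the word is empty, so every coordinate starts and ends at 0 or 1. By
  monotonicity those not going from 0 to 1 are constant and never alive; dropping them leaves a
  genuine lift.\<close>

lemma toP_surj:
  assumes "\<alpha> \<in> topspace PP" shows "\<exists>\<beta>\<in>all_cpaths. toP \<beta> = \<alpha>"
proof -
  have \<alpha>: "\<alpha> \<in> extensional {0..1}" "is_dpath Zcubes Zface \<alpha>" "\<alpha> 0 = zpt 0 (\<lambda>_. 0)" "\<alpha> 1 = zpt 0 (\<lambda>_. 0)"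
    using assms by (auto simp: topspace_PP)
  then obtain hs where hs: "list_all (coord_fun 0 1) hs" "\<And>s. s\<in>{0..1} \<Longrightarrow> wof (\<alpha> s) = word_at s hs"
    using dpath_coord_funs by blast
  have nil: "word_at 0 hs = []" "word_at 1 hs = []"
    using hs(2)[of 0] hs(2)[of 1] \<alpha>(3,4) by (auto simp: word_def coords_def)
  have h: "coord_fun 0 1 h" "h 0 = 0 \<or> h 0 = 1" "h 1 = 0 \<or> h 1 = 1" if "h \<in> set hs" for h
  proof -
    show 1: "coord_fun 0 1 h" using hs(1) that by (simp add: list_all_iff)
    have "h 0 \<in> {0..1}" "h 1 \<in> {0..1}" "\<not> live (h 0)" "\<not> live (h 1)"
      using 1 nil that by (auto simp: coord_fun_def image_subset_iff word_at_def filter_empty_conv)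
    then show "h 0 = 0 \<or> h 0 = 1" "h 1 = 0 \<or> h 1 = 1" using live_dead by blast+
  qed
  define ks where "ks = filter (\<lambda>h. h 0 = 0 \<and> h 1 = 1) hs"
  have wks: "word_at s ks = word_at s hs" if s: "s \<in> {0..1}" for s
    unfolding ks_def
  proof (rule word_at_filter)
    fix k assume k: "k \<in> set hs" "\<not> (k 0 = 0 \<and> k 1 = 1)"
    have "k 0 \<le> k s" "k s \<le> k 1" "0 \<le> k s" "k s \<le> 1"
      using h(1)[OF k(1)] s by (auto simp: coord_fun_def mono_on_def image_subset_iff)
    then show "\<not> live (k s)" using h(2,3)[OF k(1)] k(2) by (auto simp: live_def)
  qed
  have ks: "coord_fun 0 1 (ks ! i)" "(ks ! i) 0 = 0" "(ks ! i) 1 = 1" if "i < length ks" for i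
    using nth_mem[OF that] h by (auto simp: ks_def)
  define \<beta> where "\<beta> = (\<lambda>t i. if t \<in> {0..1} \<and> i < length ks then (ks ! i) t else 0)"
  have "continuous_on {0..1} (\<lambda>t. \<beta> t i)" "mono_on {0..1} (\<lambda>t. \<beta> t i)" for i
  proof -
    have "continuous_on {0..1} (\<lambda>t. \<beta> t i) \<longleftrightarrow> continuous_on {0..1} (if i < length ks then ks ! i else (\<lambda>_. 0))"
      by (rule continuous_on_cong) (auto simp: \<beta>_def)
    then show "continuous_on {0..1} (\<lambda>t. \<beta> t i)" using ks(1) by (auto simp: coord_fun_def)
    show "mono_on {0..1} (\<lambda>t. \<beta> t i)"
      using ks(1)[of i] by (auto simp: coord_fun_def \<beta>_def mono_on_def)
  qed
  moreover have cube: "\<beta> t \<in> cube (length ks)" if "t \<in> {0..1}" for t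
    using that ks(1) by (auto simp: cube_def \<beta>_def coord_fun_def image_subset_iff)
  ultimately have B: "\<beta> \<in> cpaths (length ks)"
    using ks(2,3) by (auto simp: cpaths_def) (auto simp: \<beta>_def)
  have "toP \<beta> t = \<alpha> t" if t: "t \<in> {0..1}" for t
  proof -
    have "continuous_map (top_of_set {0..1}) ZZ \<alpha>" using \<alpha>(2) by (simp add: is_dpath_def)
    then have "\<alpha> t \<in> topspace ZZ" using t by (auto simp: continuous_map_def)
    then obtain n x where x: "\<alpha> t = zpt n x" "x \<in> cube n" by (auto simp: topspace_ZZ)
    have "word (length ks) (\<beta> t) = word_at t ks"
    proof -
      have "coords (length ks) (\<beta> t) = map (\<lambda>h. h t) ks"
        using t by (auto simp: coords_def \<beta>_def intro!: nth_equalityI)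
      then show ?thesis by (simp add: word_def word_at_def)
    qed
    also have "\<dots> = word n x" using wks[OF t] hs(2)[OF t] x by simp
    finally show ?thesis using zpt_eq_iff[OF cube[OF t] x(2)] x toP_apply[OF B t] by simp
  qed
  then have "toP \<beta> = \<alpha>"
    using \<alpha>(1) by (intro extensionalityI[of _ "{0..1}"]) (auto simp: toP_def)
  with B show ?thesis by (auto simp: all_cpaths_def)
qed

section \<open>Uniqueness of the lift\<close>

definition live_at :: "nat \<Rightarrow> (nat \<Rightarrow> real) \<Rightarrow> nat list" where
  "live_at n x = filter (\<lambda>i. live (x i)) [0..<n]"

lemma word_live_at: "word n x = map x (live_at n x)"
  by (simp add: word_def coords_def live_at_def filter_map o_def)

lemma live_at_props: "distinct (live_at n x)" "sorted_wrt (<) (live_at n x)" "set (live_at n x) = {i. i < n \<and> live (x i)}"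
  unfolding live_at_def by (auto intro: sorted_wrt_filter)

text \<open>Entries in equal positions have equal values, so a filter on values removes the same
  positions from both lists.\<close>

lemma zip_filter_same:
  "map f xs = map g ys \<Longrightarrow>
    zip (filter (\<lambda>x. P (f x)) xs) (filter (\<lambda>y. P (g y)) ys) = filter (\<lambda>(x, y). P (f x)) (zip xs ys)"
proof (induction xs arbitrary: ys)
  case (Cons x xs)
  then show ?case by (cases ys) auto
qed simp

text \<open>Pairs of coordinates that contribute the letter at the same position of the word. Only
  coordinates alive at time \<open>t\<close> are paired, hence a relation depending on
  \<open>t\<close>.\<close>

definition matched :: "nat \<Rightarrow> nat \<Rightarrow> (real \<Rightarrow> nat \<Rightarrow> real) \<Rightarrow> (real \<Rightarrow> nat \<Rightarrow> real) \<Rightarrow> real \<Rightarrow> (nat \<times> nat) set" where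
  "matched n m \<beta> \<gamma> t = set (zip (live_at n (\<beta> t)) (live_at m (\<gamma> t)))"

lemma matched_converse: "(i, j) \<in> matched n m \<beta> \<gamma> t \<longleftrightarrow> (j, i) \<in> matched m n \<gamma> \<beta> t"
  by (auto simp: matched_def in_set_zip)

text \<open>Both lists of alive indices are strictly increasing, so comparing indices on either side
  amounts to comparing positions in the word.\<close>

lemma matched_order:
  assumes "(i, j) \<in> matched n m \<beta> \<gamma> t" "(k, l) \<in> matched n m \<beta> \<gamma> t"
  shows "i < k \<longleftrightarrow> j < l" "i = k \<longleftrightarrow> j = l"
proof -
  obtain p q where p: "p < length (live_at n (\<beta> t))" "i = live_at n (\<beta> t) ! p" "j = live_at m (\<gamma> t) ! p"
    "p < length (live_at m (\<gamma> t))" and q: "q < length (live_at n (\<beta> t))" "k = live_at n (\<beta> t) ! q" "l = live_at m (\<gamma> t) ! q"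
    "q < length (live_at m (\<gamma> t))"
    using assms by (auto simp: matched_def in_set_zip)
  have *: "xs ! p < xs ! q \<longleftrightarrow> p < q" "xs ! p = xs ! q \<longleftrightarrow> p = q"
    if "sorted_wrt (<) xs" "p < length xs" "q < length xs" for xs :: "nat list"
    using that sorted_wrt_nth_less[OF that(1), of p q] sorted_wrt_nth_less[OF that(1), of q p]
    by (metis less_asym less_irrefl linorder_neqE_nat)+
  show "i < k \<longleftrightarrow> j < l" "i = k \<longleftrightarrow> j = l"
    using * live_at_props(2) p q by blast+
qed

text \<open>Being alive is not locally constant: a dead coordinate can come alive at once. It does
  so with a value close to 0 or 1, so the window from \<open>d\<close> to \<open>1 - d\<close> still
  recognizes at nearby times who was alive at \<open>t\<close>.\<close>

lemma eventually_mid: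
  assumes \<phi>: "continuous_on {0..1} \<phi>" "\<And>t. t \<in> {0..1} \<Longrightarrow> 0 \<le> \<phi> t \<and> \<phi> t \<le> (1::real)" and t: "t \<in> {0..1}"
    and d: "0 < d" "live (\<phi> t) \<Longrightarrow> d < \<phi> t \<and> \<phi> t < 1 - d"
  shows "\<forall>\<^sub>F s in at t within {0..1}. (d < \<phi> s \<and> \<phi> s < 1 - d) = live (\<phi> t)"
proof -
  have lim: "(\<phi> \<longlongrightarrow> \<phi> t) (at t within {0..1})" using \<phi>(1) t by (simp add: continuous_on_def)
  show ?thesis
  proof (cases "live (\<phi> t)")
    case True
    then have "\<forall>\<^sub>F s in at t within {0..1}. d < \<phi> s" "\<forall>\<^sub>F s in at t within {0..1}. \<phi> s < 1 - d"
      using order_tendstoD[OF lim] d(2) by blast+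
    then show ?thesis by eventually_elim (use True in auto)
  next
    case False
    then have "\<phi> t = 0 \<or> \<phi> t = 1" using \<phi>(2)[OF t] by (auto simp: live_def)
    then have "\<phi> t < d \<or> 1 - d < \<phi> t" using d(1) by auto
    then have "(\<forall>\<^sub>F s in at t within {0..1}. \<phi> s < d) \<or> (\<forall>\<^sub>F s in at t within {0..1}. 1 - d < \<phi> s)"
      using order_tendstoD[OF lim] by blast
    then show ?thesis
      by (elim disjE; elim eventually_mono) (use False in auto)
  qed
qed

context
  fixes n m \<beta> \<gamma>
  assumes B: "\<beta> \<in> cpaths n" and G: "\<gamma> \<in> cpaths m"
    and words: "\<forall>t\<in>{0..1}. word n (\<beta> t) = word m (\<gamma> t)"
begin

lemma matched_length: "t \<in> {0..1} \<Longrightarrow> length (live_at n (\<beta> t)) = length (live_at m (\<gamma> t))"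
  using words unfolding word_live_at by (metis length_map)

lemma matchedD:
  assumes t: "t \<in> {0..1}" and ij: "(i, j) \<in> matched n m \<beta> \<gamma> t"
  shows "i < n" "j < m" "live (\<beta> t i)" "\<beta> t i = \<gamma> t j"
proof -
  obtain p where p: "p < length (live_at n (\<beta> t))" "i = live_at n (\<beta> t) ! p" "j = live_at m (\<gamma> t) ! p"
    "p < length (live_at m (\<gamma> t))"
    using ij by (auto simp: matched_def in_set_zip)
  show "i < n" "live (\<beta> t i)" "j < m"
    using nth_mem[OF p(1)] nth_mem[OF p(4)] p live_at_props(3) by auto
  have "map (\<beta> t) (live_at n (\<beta> t)) ! p = map (\<gamma> t) (live_at m (\<gamma> t)) ! p"
    using bspec[OF words t] by (simp add: word_live_at)
  then show "\<beta> t i = \<gamma> t j" using p by simp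
qed

lemma matched_ex:
  assumes t: "t \<in> {0..1}" and i: "i < n" "live (\<beta> t i)" shows "\<exists>j. (i, j) \<in> matched n m \<beta> \<gamma> t"
proof -
  have "i \<in> set (live_at n (\<beta> t))" using i by (simp add: live_at_props)
  then obtain p where "p < length (live_at n (\<beta> t))" "live_at n (\<beta> t) ! p = i" by (auto simp: in_set_conv_nth)
  then have "(i, live_at m (\<gamma> t) ! p) \<in> matched n m \<beta> \<gamma> t"
    unfolding matched_def in_set_zip using matched_length[OF t] by (intro exI[of _ p]) simp
  then show ?thesis ..
qed

text \<open>Near \<open>t\<close> the words may be longer than at \<open>t\<close>. Keeping only the
  letters in the middle window recovers on both sides exactly the coordinates alive at
  \<open>t\<close>; as the words agree, this removes the same positions and keeps the
  pairing.\<close>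

lemma matched_locally_constant:
  assumes t: "t \<in> {0..1}" and ij: "(i, j) \<in> matched n m \<beta> \<gamma> t"
  shows "\<forall>\<^sub>F s in at t within {0..1}. (i, j) \<in> matched n m \<beta> \<gamma> s"
proof -
  define L where "L = {u \<in> \<beta> t ` {..<n} \<union> \<gamma> t ` {..<m}. live u}"
  have "finite L" "\<And>u. u \<in> L \<Longrightarrow> live u" by (simp_all add: L_def)
  then have "\<exists>c>0. \<forall>s\<in>L \<union> (\<lambda>u. 1 - u) ` L. c \<le> s"
    by (intro finite_pos_lower_bound) (auto simp: live_def)
  then obtain c where c: "c > 0" "\<And>s. s \<in> L \<union> (\<lambda>u. 1 - u) ` L \<Longrightarrow> c \<le> s" by blast
  \<comment> \<open>Half the bound, so that the letters alive at \<open>t\<close> lie strictly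
    inside the window.\<close>
  define d where "d = c / 2"
  have d0: "d > 0" using c(1) by (simp add: d_def)
  have d: "d < u \<and> u < 1 - d" if "u \<in> L" for u
  proof -
    have "c \<le> u" by (rule c(2)) (rule UnI1[OF that])
    moreover have "c \<le> 1 - u" by (rule c(2)) (rule UnI2[OF imageI[OF that]])
    ultimately show ?thesis using c(1) unfolding d_def by linarith
  qed
  have dB: "d < \<beta> t i \<and> \<beta> t i < 1 - d" if "i < n" "live (\<beta> t i)" for i
    by (rule d) (use that in \<open>auto simp: L_def\<close>)
  have dG: "d < \<gamma> t i \<and> \<gamma> t i < 1 - d" if "i < m" "live (\<gamma> t i)" for i
    by (rule d) (use that in \<open>auto simp: L_def\<close>)
  define mid where "mid u \<longleftrightarrow> d < u \<and> u < 1 - d" for u :: real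
  have "\<forall>\<^sub>F s in at t within {0..1}. mid (\<beta> s i) = live (\<beta> t i)" if "i < n" for i
    unfolding mid_def
    by (rule eventually_mid[where \<phi> = "\<lambda>s. \<beta> s i"]) (use cpathsD(2,8,9)[OF B] t d0 dB that in auto)
  then have "\<forall>\<^sub>F s in at t within {0..1}. \<forall>i\<in>{..<n}. mid (\<beta> s i) = live (\<beta> t i)"
    by (auto simp: eventually_ball_finite_distrib)
  moreover have "\<forall>\<^sub>F s in at t within {0..1}. mid (\<gamma> s i) = live (\<gamma> t i)" if "i < m" for i
    unfolding mid_def
    by (rule eventually_mid[where \<phi> = "\<lambda>s. \<gamma> s i"]) (use cpathsD(2,8,9)[OF G] t d0 dG that in auto)
  then have "\<forall>\<^sub>F s in at t within {0..1}. \<forall>i\<in>{..<m}. mid (\<gamma> s i) = live (\<gamma> t i)"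
    by (auto simp: eventually_ball_finite_distrib)
  moreover have "\<forall>\<^sub>F s in at t within {0..1}. s \<in> {0..1}"
    by (simp add: eventually_at_filter)
  ultimately show ?thesis
  proof eventually_elim
    case (elim s)
    have ml: "mid u \<Longrightarrow> live u" for u using d0 by (auto simp: mid_def live_def)
    have sub: "live_at k x = filter (\<lambda>i. mid (y i)) (live_at k y)"
      if "\<forall>i\<in>{..<k}. mid (y i) = live (x i)" for k x and y :: "nat \<Rightarrow> real"
      unfolding live_at_def filter_filter using that
      using ml by (intro filter_cong) auto
    have "set (zip (live_at n (\<beta> t)) (live_at m (\<gamma> t))) \<subseteq> set (zip (live_at n (\<beta> s)) (live_at m (\<gamma> s)))"
      unfolding sub[OF elim(1)] sub[OF elim(2)]
      using zip_filter_same[of "\<beta> s" "live_at n (\<beta> s)" "\<gamma> s" "live_at m (\<gamma> s)" mid] bspec[OF words elim(3)]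
      by (simp add: word_live_at)
    then show ?case using ij by (auto simp: matched_def)
  qed
qed

text \<open>By monotonicity the times at which a coordinate is alive form an interval; its partner
  is locally constant there, hence constant.\<close>

lemma matched_persists:
  assumes t: "t \<in> {0..1}" and ij: "(i, j) \<in> matched n m \<beta> \<gamma> t" and s: "s \<in> {0..1}" "live (\<beta> s i)"
  shows "(i, j) \<in> matched n m \<beta> \<gamma> s"
proof -
  let ?J = "{t \<in> {0..1}. live (\<beta> t i)}"
  note ij' = matchedD[OF t ij]
  have "is_interval ?J"
    unfolding is_interval_1
  proof (intro ballI allI impI)
    fix a b x assume "a \<in> ?J" "b \<in> ?J" "a \<le> x \<and> x \<le> b"
    then show "x \<in> ?J"
      using cpathsD(11)[OF B, of a x i] cpathsD(11)[OF B, of x b i] by (auto simp: live_def)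
  qed
  then have "connected ?J" by (simp add: is_interval_connected_1)
  then have "((i, j) \<in> matched n m \<beta> \<gamma> t) = ((i, j) \<in> matched n m \<beta> \<gamma> s)"
  proof (rule connected_local_const[where f = "\<lambda>t. (i, j) \<in> matched n m \<beta> \<gamma> t"])
    show "\<forall>a\<in>?J. \<forall>\<^sub>F b in at a within ?J. ((i, j) \<in> matched n m \<beta> \<gamma> a) = ((i, j) \<in> matched n m \<beta> \<gamma> b)"
    proof
      fix a assume a: "a \<in> ?J"
      then obtain k where k: "(i, k) \<in> matched n m \<beta> \<gamma> a" using matched_ex ij'(1) by blast
      have "\<forall>\<^sub>F b in at a within {0..1}. (i, k) \<in> matched n m \<beta> \<gamma> b"
        using matched_locally_constant[OF _ k] a by blast
      then have "\<forall>\<^sub>F b in at a within ?J. (i, k) \<in> matched n m \<beta> \<gamma> b"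
        by (rule filter_leD[OF at_le, rotated]) auto
      then show "\<forall>\<^sub>F b in at a within ?J. ((i, j) \<in> matched n m \<beta> \<gamma> a) = ((i, j) \<in> matched n m \<beta> \<gamma> b)"
      proof eventually_elim
        case (elim b)
        then show ?case using k matched_order(2) by blast
      qed
    qed
  qed (use t s ij' in auto)
  then show ?thesis using ij by simp
qed

end

lemma cpath_attains:
  assumes "\<beta> \<in> cpaths n" "i < n" "0 \<le> u" "u \<le> 1" shows "\<exists>t\<in>{0..1}. \<beta> t i = u"
  using IVT'[of "\<lambda>t. \<beta> t i" 0 u 1] cpathsD[OF assms(1)] assms by auto

text \<open>The partner of a strand is read off at a time when its value is 1/2 and persists while
  the strand is alive. Order is preserved only for strands alive together, because only those occupy
  different positions of one word.\<close>

theorem cpath_rigidity: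
  assumes B: "\<beta> \<in> cpaths n" and G: "\<gamma> \<in> cpaths m" and eq: "toP \<beta> = toP \<gamma>"
  shows "\<exists>\<pi>. bij_betw \<pi> {..<n} {..<m} \<and> (\<forall>i<n. \<forall>t\<in>{0..1}. \<gamma> t (\<pi> i) = \<beta> t i) \<and>
    (\<forall>i<n. \<forall>k<n. \<forall>t\<in>{0..1}. live (\<beta> t i) \<longrightarrow> live (\<beta> t k) \<longrightarrow> (i < k \<longleftrightarrow> \<pi> i < \<pi> k))"
proof -
  have words: "\<forall>t\<in>{0..1}. word n (\<beta> t) = word m (\<gamma> t)"
    using eq toP_apply[OF B] toP_apply[OF G] wof_zpt by metis
  then have words': "\<forall>t\<in>{0..1}. word m (\<gamma> t) = word n (\<beta> t)" by simp
  note M = B G words and M' = G B words'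
  have ex: "\<exists>j. \<exists>t\<in>{0..1}. \<beta> t i = 1/2 \<and> (i, j) \<in> matched n m \<beta> \<gamma> t" if i: "i < n" for i
  proof -
    obtain t where t: "t \<in> {0..1}" "\<beta> t i = 1/2" using cpath_attains[OF B i, of "1/2"] by auto
    then have "\<exists>j. (i, j) \<in> matched n m \<beta> \<gamma> t"
      by (intro matched_ex[OF M]) (use i in \<open>auto simp: live_def\<close>)
    then show ?thesis using t by blast
  qed
  define \<pi> where "\<pi> i = (SOME j. \<exists>t\<in>{0..1}. \<beta> t i = 1/2 \<and> (i, j) \<in> matched n m \<beta> \<gamma> t)" for i
  have \<pi>: "\<exists>t\<in>{0..1}. \<beta> t i = 1/2 \<and> (i, \<pi> i) \<in> matched n m \<beta> \<gamma> t" if "i < n" for i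
    unfolding \<pi>_def by (rule someI_ex[OF ex[OF that]])
  have mat: "(i, \<pi> i) \<in> matched n m \<beta> \<gamma> s" if i: "i < n" and "s \<in> {0..1}" "live (\<beta> s i)" for i s
  proof -
    obtain t where "t \<in> {0..1}" "(i, \<pi> i) \<in> matched n m \<beta> \<gamma> t" using \<pi>[OF i] by blast
    then show ?thesis by (rule matched_persists[OF M]) (use that in auto)
  qed
  have mat': "(i, \<pi> i) \<in> matched n m \<beta> \<gamma> s" if i: "i < n" and "s \<in> {0..1}" "live (\<gamma> s (\<pi> i))" for i s
  proof -
    obtain t where "t \<in> {0..1}" "(\<pi> i, i) \<in> matched m n \<gamma> \<beta> t"
      using \<pi>[OF i] matched_converse by blast
    then have "(\<pi> i, i) \<in> matched m n \<gamma> \<beta> s" by (rule matched_persists[OF M']) (use that in auto)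
    then show ?thesis using matched_converse by blast
  qed
  have same: "\<gamma> s (\<pi> i) = \<beta> s i" if i: "i < n" and s: "s \<in> {0..1}" for i s
  proof (cases "live (\<beta> s i) \<or> live (\<gamma> s (\<pi> i))")
    case True
    then have "(i, \<pi> i) \<in> matched n m \<beta> \<gamma> s" using mat[OF i s] mat'[OF i s] by blast
    then show ?thesis using matchedD(4)[OF M s] by simp
  next
    case False
    \<comment> \<open>Both values are 0 or 1. Monotonicity against the time \<open>t\<close>, where
      both strands are at 1/2, leaves only 0 before \<open>t\<close> and only 1 after.\<close>
    then have dead: "\<beta> s i = 0 \<or> \<beta> s i = 1" "\<gamma> s (\<pi> i) = 0 \<or> \<gamma> s (\<pi> i) = 1"
      using cpathsD(8,9)[OF B s, of i] cpathsD(8,9)[OF G s, of "\<pi> i"] by (auto simp: live_def)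
    obtain t where t: "t \<in> {0..1}" "\<beta> t i = 1/2" "(i, \<pi> i) \<in> matched n m \<beta> \<gamma> t"
      using \<pi>[OF i] by blast
    have t': "\<gamma> t (\<pi> i) = 1/2" using matchedD(4)[OF M t(1,3)] t(2) by simp
    show ?thesis
    proof (cases "s \<le> t")
      case True
      then show ?thesis using cpathsD(11)[OF B s t(1), of i] cpathsD(11)[OF G s t(1), of "\<pi> i"] dead t t' by auto
    next
      case False
      then show ?thesis using cpathsD(11)[OF B t(1) s, of i] cpathsD(11)[OF G t(1) s, of "\<pi> i"] dead t t' by auto
    qed
  qed
  have inj: "inj_on \<pi> {..<n}"
  proof (rule inj_onI)
    fix i k assume ik: "i \<in> {..<n}" "k \<in> {..<n}" "\<pi> i = \<pi> k"
    obtain t where t: "t \<in> {0..1}" "\<beta> t i = 1/2" "(i, \<pi> i) \<in> matched n m \<beta> \<gamma> t" using \<pi> ik(1) by blast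
    have "\<beta> t k = \<gamma> t (\<pi> k)" "\<beta> t i = \<gamma> t (\<pi> i)" using same t(1) ik(1,2) by auto
    then have "live (\<beta> t k)" using t(2) ik(3) by (simp add: live_def)
    then have "(k, \<pi> k) \<in> matched n m \<beta> \<gamma> t" using mat t(1) ik(2) by blast
    then show "i = k" using matched_order(2)[of i "\<pi> i" n m \<beta> \<gamma> t k "\<pi> k"] t ik(3) by blast
  qed
  have "\<pi> ` {..<n} = {..<m}"
  proof (intro equalityI subsetI)
    fix j assume "j \<in> \<pi> ` {..<n}"
    then obtain i t where "j = \<pi> i" "t \<in> {0..1}" "(i, \<pi> i) \<in> matched n m \<beta> \<gamma> t" using \<pi> by blast
    then show "j \<in> {..<m}" using matchedD(2)[OF M] by blast
  next
    fix j assume "j \<in> {..<m}"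
    then obtain t where t: "t \<in> {0..1}" "\<gamma> t j = 1/2" using cpath_attains[OF G, of j "1/2"] by auto
    then obtain i where i: "(j, i) \<in> matched m n \<gamma> \<beta> t"
      using matched_ex[OF M', of t j] \<open>j \<in> {..<m}\<close> by (auto simp: live_def)
    then have "(i, j) \<in> matched n m \<beta> \<gamma> t" using matched_converse by blast
    moreover have "i < n" "live (\<beta> t i)" using matchedD[OF M t(1) calculation] by auto
    ultimately have "j = \<pi> i" using mat t(1) matched_order(2) by blast
    with \<open>i < n\<close> show "j \<in> \<pi> ` {..<n}" by blast
  qed
  with inj have "bij_betw \<pi> {..<n} {..<m}" by (simp add: bij_betw_def)
  moreover have "i < k \<longleftrightarrow> \<pi> i < \<pi> k" if "i < n" "k < n" "t \<in> {0..1}" "live (\<beta> t i)" "live (\<beta> t k)" for i k t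
    using matched_order(1)[OF mat mat] that by blast
  ultimately show ?thesis using same by blast
qed

section \<open>Path space as a quotient\<close>

text \<open>Uniform continuity of \<open>f\<close> along \<alpha> gives a finite subdivision into
  short intervals; sending each of them into a small preimage is a finite intersection of subbasic
  conditions of the compact-open topology.\<close>

lemma PP_eval_uniform_nbhd:
  fixes f :: "_ \<Rightarrow> 'm::metric_space"
  assumes f: "continuous_map ZZ euclidean f" and \<alpha>: "\<alpha> \<in> topspace PP" and e: "e > 0"
  shows "\<exists>V. openin PP V \<and> \<alpha> \<in> V \<and> (\<forall>\<alpha>'\<in>V. \<forall>t\<in>{0..1}. dist (f (\<alpha>' t)) (f (\<alpha> t)) < e)"
proof -
  have cont\<alpha>: "continuous_map (top_of_set {0..1}) ZZ \<alpha>"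
    using \<alpha> by (simp add: topspace_PP is_dpath_def)
  then have "continuous_map (top_of_set {0..1}) euclidean (f \<circ> \<alpha>)"
    using f by (rule continuous_map_compose)
  then have "continuous_on {0..1} (\<lambda>t. f (\<alpha> t))" by (simp add: o_def)
  then have "uniformly_continuous_on {0..1} (\<lambda>t. f (\<alpha> t))"
    by (rule compact_uniformly_continuous) simp
  then obtain d where d: "d > 0" "\<And>s t. s \<in> {0..1} \<Longrightarrow> t \<in> {0..1} \<Longrightarrow> dist s t < d \<Longrightarrow> dist (f (\<alpha> s)) (f (\<alpha> t)) < e / 2"
    using half_gt_zero[OF e] unfolding uniformly_continuous_on_def by metis
  obtain N :: nat where N: "inverse (real (Suc N)) < d" using reals_Archimedean[OF d(1)] by blast
  let ?M = "real (Suc N)"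
  define I where "I k = {real k / ?M..real (Suc k) / ?M}" for k
  define U where "U k = {p \<in> topspace ZZ. f p \<in> ball (f (\<alpha> (real k / ?M))) (e / 2)}" for k
  define V where "V = topspace PP \<inter> (\<Inter>k\<in>{..N}. {\<alpha>. \<alpha> ` I k \<subseteq> U k})"
  have sub: "I k \<subseteq> {0..1}" if "k \<le> N" for k
    using that by (auto simp: I_def divide_simps)
  have mesh: "dist t (real k / ?M) < d" if "t \<in> I k" for t k
  proof -
    have "real (Suc k) / ?M = real k / ?M + inverse ?M" by (simp add: field_simps)
    with that N show ?thesis unfolding I_def dist_real_def by auto
  qed
  have left: "real k / ?M \<in> I k" for k by (simp add: I_def divide_right_mono)
  have U: "openin ZZ (U k)" for k
    unfolding U_def by (rule openin_continuous_map_preimage[OF f]) simp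
  have "openin (compact_open (top_of_set {0..1}) ZZ) (\<Inter>k\<in>{..N}. {\<alpha>. \<alpha> ` I k \<subseteq> U k})"
    by (intro openin_INT2 openin_compact_open U) (use sub in \<open>auto simp: I_def compactin_subtopology\<close>)
  then have "openin PP V"
    unfolding V_def dpath_space_def by (auto simp: openin_subtopology)
  moreover have "\<alpha> \<in> V"
  proof -
    have "\<alpha> t \<in> U k" if "k \<le> N" "t \<in> I k" for k t
    proof -
      have "t \<in> {0..1}" "real k / ?M \<in> {0..1}" using sub[OF that(1)] that(2) left by blast+
      then show ?thesis
        using d(2)[of "real k / ?M" t] mesh[OF that(2)] cont\<alpha>
        by (auto simp: U_def continuous_map_def dist_commute)
    qed
    then show ?thesis using \<alpha> by (auto simp: V_def)
  qed
  moreover have "dist (f (\<alpha>' t)) (f (\<alpha> t)) < e" if \<alpha>': "\<alpha>' \<in> V" and t: "t \<in> {0..1}" for \<alpha>' t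
  proof -
    \<comment> \<open>The minimum treats \<open>t = 1\<close>, where the floor would be
      \<open>N + 1\<close>, one beyond the last interval.\<close>
    define k where "k = min N (nat \<lfloor>t * ?M\<rfloor>)"
    have k: "k \<le> N" by (simp add: k_def)
    have "t \<in> I k"
    proof (cases "t = 1")
      case True
      then have "k = N" by (simp add: k_def)
      with True show ?thesis by (simp add: I_def)
    next
      case False
      then have "t * ?M < 1 * ?M" using t by (intro mult_strict_right_mono) auto
      then have "\<lfloor>t * ?M\<rfloor> < int (Suc N)" by (simp only: floor_less_iff) simp
      moreover have pos: "0 \<le> \<lfloor>t * ?M\<rfloor>" using t by simp
      ultimately have "k = nat \<lfloor>t * ?M\<rfloor>" by (simp add: k_def)
      then have "real k = of_int \<lfloor>t * ?M\<rfloor>" using pos by simp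
      then have "real k \<le> t * ?M" "t * ?M \<le> real (Suc k)"
        using floor_correct[of "t * ?M"] by linarith+
      then show ?thesis unfolding I_def atLeastAtMost_iff
        by (simp only: pos_divide_le_eq pos_le_divide_eq of_nat_0_less_iff zero_less_Suc)
    qed
    moreover have "\<alpha>' ` I k \<subseteq> U k" using \<alpha>' k by (auto simp: V_def)
    ultimately have "\<alpha>' t \<in> U k" by blast
    then have "dist (f (\<alpha> (real k / ?M))) (f (\<alpha>' t)) < e / 2" by (simp add: U_def)
    moreover have "dist (f (\<alpha> t)) (f (\<alpha> (real k / ?M))) < e / 2"
      using d(2) mesh[OF \<open>t \<in> I k\<close>] t left sub[OF k] by blast
    ultimately show ?thesis
      using dist_triangle[of "f (\<alpha>' t)" "f (\<alpha> t)" "f (\<alpha> (real k / ?M))"] by (simp add: dist_commute)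
  qed
  ultimately show ?thesis by blast
qed

lemma compact_fun:
  assumes "compact X" shows "compact {f::'a \<Rightarrow> 'b::topological_space. \<forall>a. f a \<in> X}"
proof -
  have "compactin (product_topology (\<lambda>_::'a. euclidean::'b topology) UNIV) (PiE UNIV (\<lambda>_. X))"
    using assms by (simp add: compactin_PiE)
  moreover have "PiE UNIV (\<lambda>_. X) = {f::'a \<Rightarrow> 'b. \<forall>a. f a \<in> X}" by (auto simp: PiE_def)
  ultimately show ?thesis by (simp add: euclidean_product_topology)
qed

lemma cluster_point_closed:
  assumes "inf (nhds x) F \<noteq> bot" "closed T" "\<forall>\<^sub>F y in F. y \<in> T" shows "x \<in> T"
proof (rule ccontr)
  assume "x \<notin> T"
  then have "\<forall>\<^sub>F y in nhds x. y \<in> - T" using assms(2) by (intro eventually_nhds_in_open) auto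
  then have "\<forall>\<^sub>F y in inf (nhds x) F. False"
    using assms(3) unfolding eventually_inf by blast
  with assms(1) show False by (simp add: eventually_False)
qed

definition csum :: "nat \<Rightarrow> (real \<Rightarrow> nat \<Rightarrow> real) \<Rightarrow> real \<Rightarrow> real" where
  "csum n \<beta> t = (\<Sum>i<n. \<beta> t i)"

text \<open>A continuous function starting at 0 whose exponential stays within the distance from 1 realised at \<open>\<plusminus>\<eta>\<close> cannot reach \<open>\<plusminus>\<eta>\<close>.\<close>
lemma lift_close:
  fixes s :: "real \<Rightarrow> real"
  assumes s: "continuous_on {0..1} s" "s 0 = 0" and \<eta>: "\<eta> > 0"
    and close: "\<And>t. t \<in> {0..1} \<Longrightarrow> norm (cis (2 * pi * s t) - 1) < norm (cis (2 * pi * \<eta>) - 1)"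
    and t: "t \<in> {0..1}"
  shows "\<bar>s t\<bar> < \<eta>"
proof (rule ccontr)
  assume "\<not> \<bar>s t\<bar> < \<eta>"
  moreover have "continuous_on {0..t} (\<lambda>t. \<bar>s t\<bar>)"
    by (rule continuous_on_subset[of "{0..1}"]) (use s t in \<open>auto intro!: continuous_intros\<close>)
  ultimately obtain r where r: "0 \<le> r" "r \<le> t" "\<bar>s r\<bar> = \<eta>"
    using IVT'[of "\<lambda>t. \<bar>s t\<bar>" 0 \<eta> t] s \<eta> t by auto
  have "norm (cis (2 * pi * s r) - 1) = norm (cis (2 * pi * \<eta>) - 1)"
  proof (cases "s r = \<eta>")
    case False
    then have "s r = - \<eta>" using r(3) by linarith
    then have "cis (2 * pi * s r) - 1 = cnj (cis (2 * pi * \<eta>) - 1)" by (simp add: cis_cnj)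
    then show ?thesis by (metis complex_mod_cnj)
  qed simp
  with close[of r] r t show False by auto
qed

lemma ecis_toP: "\<beta> \<in> cpaths n \<Longrightarrow> t \<in> {0..1} \<Longrightarrow> ecis (toP \<beta> t) = cis (2 * pi * csum n \<beta> t)"
  by (simp add: toP_apply ecis_zpt cpathsD(1) csum_def)

lemma continuous_total: "\<beta> \<in> cpaths n \<Longrightarrow> continuous_on {0..1} (csum n \<beta>)"
  unfolding csum_def by (intro continuous_on_sum cpathsD(2))

lemma total_0: "\<beta> \<in> cpaths n \<Longrightarrow> csum n \<beta> 0 = 0"
  and total_1: "\<beta> \<in> cpaths n \<Longrightarrow> csum n \<beta> 1 = real n"
  by (simp_all add: csum_def cpathsD)

text \<open>Closeness in the circle lifts to closeness of the real sums because both sums start at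
  0. At time 1 the sums are the dimensions, so being less than 1 apart forces the dimensions to
  agree.\<close>

lemma toP_total_nbhd:
  assumes \<beta>: "\<beta> \<in> cpaths n" and \<eta>: "0 < \<eta>" "\<eta> < 1"
  shows "\<exists>V. openin PP V \<and> toP \<beta> \<in> V \<and>
    (\<forall>\<gamma> m. \<gamma> \<in> cpaths m \<longrightarrow> toP \<gamma> \<in> V \<longrightarrow> m = n \<and> (\<forall>t\<in>{0..1}. \<bar>csum n \<gamma> t - csum n \<beta> t\<bar> < \<eta>))"
proof -
  define e where "e = norm (cis (2 * pi * \<eta>) - 1)"
  have "cis (2 * pi * \<eta>) \<noteq> 1"
  proof
    assume "cis (2 * pi * \<eta>) = 1"
    then have "cos (2 * pi * \<eta>) = 1" by (simp add: complex_eq_iff)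
    then obtain k :: int where "2 * pi * \<eta> = of_int k * 2 * pi" using cos_one_2pi_int by auto
    then have "\<eta> = of_int k" by simp
    with \<eta> show False by simp
  qed
  then have "e > 0" by (simp add: e_def)
  from PP_eval_uniform_nbhd[OF continuous_ecis toP_in_PP[OF \<beta>] this]
  obtain V where V: "openin PP V" "toP \<beta> \<in> V"
    "\<And>\<alpha> t. \<alpha> \<in> V \<Longrightarrow> t \<in> {0..1} \<Longrightarrow> dist (ecis (\<alpha> t)) (ecis (toP \<beta> t)) < e" by blast
  have main: "\<bar>csum m \<gamma> t - csum n \<beta> t\<bar> < \<eta>" if \<gamma>: "\<gamma> \<in> cpaths m" "toP \<gamma> \<in> V" and t: "t \<in> {0..1}" for \<gamma> m t
  proof (rule lift_close[where s = "\<lambda>t. csum m \<gamma> t - csum n \<beta> t", OF _ _ \<eta>(1) _ t])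
    show "continuous_on {0..1} (\<lambda>t. csum m \<gamma> t - csum n \<beta> t)"
      using continuous_total \<beta> \<gamma> by (intro continuous_on_diff) auto
    show "csum m \<gamma> 0 - csum n \<beta> 0 = 0" using total_0 \<beta> \<gamma> by simp
    fix s :: real assume s: "s \<in> {0..1}"
    let ?a = "2 * pi * csum m \<gamma> s" and ?b = "2 * pi * csum n \<beta> s"
    have "cis ?a - cis ?b = cis ?b * (cis (?a - ?b) - 1)"
      by (simp add: right_diff_distrib cis_mult)
    then have "norm (cis ?a - cis ?b) = norm (cis (?a - ?b) - 1)"
      by (simp add: norm_mult)
    moreover have "norm (cis ?a - cis ?b) < e"
      using V(3)[OF \<gamma>(2) s] ecis_toP[OF \<gamma>(1) s] ecis_toP[OF \<beta> s] by (simp add: dist_norm)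
    ultimately show "norm (cis (2 * pi * (csum m \<gamma> s - csum n \<beta> s)) - 1) < norm (cis (2 * pi * \<eta>) - 1)"
      by (simp add: e_def right_diff_distrib)
  qed
  have "m = n" if "\<gamma> \<in> cpaths m" "toP \<gamma> \<in> V" for \<gamma> m
  proof -
    have "\<bar>real m - real n\<bar> < 1"
      using main[OF that, of 1] total_1[OF that(1)] total_1[OF \<beta>] \<eta> by simp
    then show ?thesis by linarith
  qed
  then have "m = n \<and> (\<forall>t\<in>{0..1}. \<bar>csum n \<gamma> t - csum n \<beta> t\<bar> < \<eta>)"
    if "\<gamma> \<in> cpaths m" "toP \<gamma> \<in> V" for \<gamma> m
    using main[OF that] that by simp
  then show ?thesis using V(1,2) by (intro exI[of _ V] conjI allI impI) blast+
qed

text \<open>If every neighbourhood of \<alpha> met the image of \<open>C\<close>, lifts in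
  \<open>C\<close> would cluster, by compactness of monotone functions, at some \<open>b\<close>.
  The control of the sums makes \<open>b\<close> continuous, and then \<open>b\<close> is a lift of
  \<alpha> lying in \<open>C\<close>.\<close>

lemma closed_map_toP: "closed_map (top_of_set all_cpaths) PP toP"
  unfolding closed_map_def
proof (intro allI impI)
  fix C assume C: "closedin (top_of_set all_cpaths) C"
  then obtain CT where CT: "closed CT" "C = all_cpaths \<inter> CT" by (auto simp: closedin_closed)
  have sub: "toP ` C \<subseteq> topspace PP" using CT toP_in_PP by (auto simp: all_cpaths_def)
  have "\<exists>V. openin PP V \<and> \<alpha> \<in> V \<and> V \<subseteq> topspace PP - toP ` C" if \<alpha>: "\<alpha> \<in> topspace PP - toP ` C" for \<alpha>
  proof (rule ccontr)
    assume no: "\<not> ?thesis"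
    obtain \<beta>0 n where \<beta>0: "\<beta>0 \<in> cpaths n" "toP \<beta>0 = \<alpha>"
      using toP_surj \<alpha> unfolding all_cpaths_def by blast
    define NN where "NN = {V. openin PP V \<and> \<alpha> \<in> V}"
    \<comment> \<open>The filter of elements of \<open>C\<close> whose path approaches \<alpha>.
      Filters are used because cluster points in this product need not be reached by
      sequences.\<close>
    define F where "F = (INF V\<in>NN. principal {\<beta> \<in> C. toP \<beta> \<in> V})"
    have ev: "eventually P F \<longleftrightarrow> (\<exists>V\<in>NN. \<forall>\<beta>\<in>C. toP \<beta> \<in> V \<longrightarrow> P \<beta>)" for P
    proof -
      have "eventually P F \<longleftrightarrow> (\<exists>V\<in>NN. eventually P (principal {\<beta> \<in> C. toP \<beta> \<in> V}))"
        unfolding F_def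
      proof (rule eventually_INF_base)
        show "NN \<noteq> {}" using \<alpha> by (auto simp: NN_def)
        fix V W assume "V \<in> NN" "W \<in> NN"
        then have "V \<inter> W \<in> NN" by (auto simp: NN_def)
        then show "\<exists>X\<in>NN. principal {\<beta> \<in> C. toP \<beta> \<in> X} \<le> inf (principal {\<beta> \<in> C. toP \<beta> \<in> V}) (principal {\<beta> \<in> C. toP \<beta> \<in> W})"
          by (intro bexI[of _ "V \<inter> W"]) auto
      qed
      then show ?thesis by (auto simp: eventually_principal)
    qed
    have Fbot: "F \<noteq> bot"
    proof
      assume "F = bot"
      then have "eventually (\<lambda>_. False) F" by simp
      then obtain V where "openin PP V" "\<alpha> \<in> V" "\<forall>\<beta>\<in>C. toP \<beta> \<notin> V" unfolding ev NN_def by blast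
      then show False using no openin_subset by blast
    qed
    have total_ev: "\<forall>\<^sub>F \<beta> in F. \<beta> \<in> cpaths n \<and> (\<forall>t\<in>{0..1}. \<bar>csum n \<beta> t - csum n \<beta>0 t\<bar> < \<eta>)"
      if \<eta>: "0 < \<eta>" "\<eta> < 1" for \<eta>
    proof -
      obtain V where V: "openin PP V" "toP \<beta>0 \<in> V"
        "\<And>\<gamma> m. \<gamma> \<in> cpaths m \<Longrightarrow> toP \<gamma> \<in> V \<Longrightarrow> m = n \<and> (\<forall>t\<in>{0..1}. \<bar>csum n \<gamma> t - csum n \<beta>0 t\<bar> < \<eta>)"
        using toP_total_nbhd[OF \<beta>0(1) \<eta>] by blast
      have "V \<in> NN" using V \<beta>0 by (simp add: NN_def)
      moreover have "\<gamma> \<in> cpaths n \<and> (\<forall>t\<in>{0..1}. \<bar>csum n \<gamma> t - csum n \<beta>0 t\<bar> < \<eta>)"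
        if g: "\<gamma> \<in> C" "toP \<gamma> \<in> V" for \<gamma>
      proof -
        obtain m where "\<gamma> \<in> cpaths m" using g CT by (auto simp: all_cpaths_def)
        then show ?thesis using V(3) g(2) by blast
      qed
      ultimately show ?thesis unfolding ev by blast
    qed
    \<comment> \<open>All conditions on lifts except continuity; each one left is closed for
      pointwise convergence, so \<open>K\<close> is compact. Continuity of the cluster point has to
      be proved separately.\<close>
    define K where "K = {\<beta>::real \<Rightarrow> nat \<Rightarrow> real. \<forall>t. \<beta> t \<in> {x. \<forall>i. x i \<in> {0..1}}} \<inter>
      ((\<Inter>t\<in>{0..1}. \<Inter>i\<in>{n..}. {\<beta>. \<beta> t i = 0}) \<inter>
       (\<Inter>i. \<Inter>s\<in>{0..1}. \<Inter>t\<in>{s..1}. {\<beta>. \<beta> s i \<le> \<beta> t i}) \<inter>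
       (\<Inter>i\<in>{..<n}. {\<beta>. \<beta> 0 i = 0} \<inter> {\<beta>. \<beta> 1 i = 1}) \<inter>
       (\<Inter>t\<in>- {0..1}. \<Inter>i. {\<beta>. \<beta> t i = 0}))"
    have "compact K"
      unfolding K_def
    proof (rule compact_Int_closed)
      show "compact {\<beta>::real \<Rightarrow> nat \<Rightarrow> real. \<forall>t. \<beta> t \<in> {x. \<forall>i. x i \<in> {0..1}}}"
        by (intro compact_fun compact_Icc)
    qed (intro closed_Int closed_INT ballI closed_Collect_eq closed_Collect_le continuous_on_at continuous_on_const)
    have cK: "\<beta> \<in> K" if "\<beta> \<in> cpaths n" for \<beta>
    proof -
      have "\<beta> t i \<in> {0..1}" for t i
        using cpathsD(8,9)[OF that, of t i] cpathsD(6)[OF that, of t] by (cases "t \<in> {0..1}") auto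
      moreover have "\<beta> s i \<le> \<beta> t i" if "s \<in> {0..1}" "t \<in> {s..1}" for s t i
        using cpathsD(11)[OF \<open>\<beta> \<in> cpaths n\<close>] that by auto
      ultimately show ?thesis using cpathsD(4,5,6,7)[OF that] by (auto simp: K_def)
    qed
    have cpaths_ev: "\<forall>\<^sub>F \<beta> in F. \<beta> \<in> cpaths n"
      by (rule eventually_mono[OF total_ev[of "1/2"]]) auto
    then have "\<forall>\<^sub>F \<beta> in F. \<beta> \<in> K"
      by (rule eventually_mono) (rule cK)
    then obtain b where b: "b \<in> K" "inf (nhds b) F \<noteq> bot"
      using \<open>compact K\<close>[unfolded compact_filter] Fbot by blast
    note cluster = cluster_point_closed[OF b(2)]
    have bmono: "b s i \<le> b t i" if "s \<in> {0..1}" "t \<in> {0..1}" "s \<le> t" for s t i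
      using b(1) that by (auto simp: K_def)
    have tot: "csum n b t = csum n \<beta>0 t" if t: "t \<in> {0..1}" for t
    proof (rule ccontr)
      assume ne: "csum n b t \<noteq> csum n \<beta>0 t"
      define \<eta> where "\<eta> = min (1/2) (\<bar>csum n b t - csum n \<beta>0 t\<bar> / 2)"
      have \<eta>: "0 < \<eta>" "\<eta> < 1" using ne by (auto simp: \<eta>_def)
      have "b \<in> {\<beta>. \<bar>csum n \<beta> t - csum n \<beta>0 t\<bar> \<le> \<eta>}"
      proof (rule cluster)
        show "closed {\<beta>. \<bar>csum n \<beta> t - csum n \<beta>0 t\<bar> \<le> \<eta>}"
          unfolding csum_def by (intro closed_Collect_le continuous_intros continuous_on_at)
        show "\<forall>\<^sub>F \<beta> in F. \<beta> \<in> {\<beta>. \<bar>csum n \<beta> t - csum n \<beta>0 t\<bar> \<le> \<eta>}"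
          using total_ev[OF \<eta>] by (rule eventually_mono) (use t in force)
      qed
      then show False using ne by (simp add: \<eta>_def)
    qed
    \<comment> \<open>All coordinates are nondecreasing, so the increment of one is at most the
      increment of the sum, and the sum of \<open>b\<close> is the continuous sum of
      \<beta>0.\<close>
    have close: "\<bar>b t i - b s i\<bar> \<le> \<bar>csum n \<beta>0 t - csum n \<beta>0 s\<bar>" if i: "i < n" and st: "s \<in> {0..1}" "t \<in> {0..1}" for s t i
    proof -
      have *: "\<bar>b t i - b s i\<bar> \<le> \<bar>csum n b t - csum n b s\<bar>" if "s \<in> {0..1}" "t \<in> {0..1}" "s \<le> t" for s t
      proof -
        have "b t i - b s i \<le> (\<Sum>j<n. b t j - b s j)"
          by (rule member_le_sum) (use i bmono[OF that] in auto)
        then show ?thesis using bmono[OF that, of i] by (simp add: csum_def sum_subtractf)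
      qed
      show ?thesis
        using *[of s t] *[of t s] st tot by (cases "s \<le> t") (auto simp: abs_minus_commute)
    qed
    have "continuous_on {0..1} (\<lambda>t. b t i)" for i
    proof (cases "i < n")
      case True
      show ?thesis
        unfolding continuous_on_iff
      proof (intro ballI allI impI)
        fix t e assume t: "t \<in> {0..1::real}" and e: "(0::real) < e"
        then obtain d where d: "d > 0" "\<forall>s\<in>{0..1}. dist s t < d \<longrightarrow> dist (csum n \<beta>0 s) (csum n \<beta>0 t) < e"
          using continuous_total[OF \<beta>0(1)] unfolding continuous_on_iff by blast
        have "dist (b s i) (b t i) < e" if "s \<in> {0..1}" "dist s t < d" for s
          using d(2) close[OF True t that(1)] that by (fastforce simp: dist_real_def)
        with d(1) show "\<exists>d>0. \<forall>s\<in>{0..1}. dist s t < d \<longrightarrow> dist (b s i) (b t i) < e" by blast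
      qed
    next
      case False
      have "continuous_on {0..1} (\<lambda>t. b t i) \<longleftrightarrow> continuous_on {0..1::real} (\<lambda>t. 0::real)"
        by (rule continuous_on_cong) (use b(1) False in \<open>auto simp: K_def\<close>)
      then show ?thesis by simp
    qed
    then have bc: "b \<in> cpaths n"
      using b(1) bmono by (auto simp: K_def cpaths_def cube_def mono_on_def fun_eq_iff)
    have "toP b t = \<alpha> t" if t: "t \<in> {0..1}" for t
    proof (rule ccontr)
      \<comment> \<open>Disjoint neighbourhoods of the two points: lifts along \<open>F\<close> have
        their value at \<open>t\<close> outside the open set \<open>O'\<close>, a closed condition
        inherited by \<open>b\<close>, whereas \<open>b t\<close> lies in \<open>O'\<close>.\<close>
      assume ne: "toP b t \<noteq> \<alpha> t"
      have "\<alpha> t \<in> topspace ZZ" "toP b t \<in> topspace ZZ"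
        using toP_apply[OF \<beta>0(1) t] toP_apply[OF bc t] \<beta>0 cpathsD(1)[OF _ t] bc by auto
      with ne obtain U W where UW: "openin ZZ U" "openin ZZ W" "toP b t \<in> U" "\<alpha> t \<in> W" "disjnt U W"
        using Hausdorff_ZZ unfolding Hausdorff_space_def by blast
      have "openin (top_of_set (cube n)) {x \<in> cube n. zpt n x \<in> U}" using UW(1) by (simp add: openin_ZZ)
      then obtain O' where O': "open O'" "{x \<in> cube n. zpt n x \<in> U} = cube n \<inter> O'" unfolding openin_open by blast
      define V where "V = topspace PP \<inter> {\<alpha>. \<alpha> ` {t} \<subseteq> W}"
      have "openin (compact_open (top_of_set {0..1}) ZZ) {\<alpha>. \<alpha> ` {t} \<subseteq> W}"
        by (rule openin_compact_open[OF _ UW(2)]) (use t in \<open>simp add: compactin_subtopology\<close>)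
      then have "openin PP V" unfolding V_def dpath_space_def by (auto simp: openin_subtopology)
      moreover have "\<alpha> \<in> V" using UW \<alpha> by (simp add: V_def)
      ultimately have "V \<in> NN" by (simp add: NN_def)
      then have "\<forall>\<^sub>F \<beta> in F. toP \<beta> \<in> V" unfolding ev by blast
      with cpaths_ev have "\<forall>\<^sub>F \<beta> in F. \<beta> \<in> (\<lambda>\<beta>. \<beta> t) -` (- O')"
      proof eventually_elim
        case (elim \<beta>)
        then have "\<beta> t \<in> cube n" "zpt n (\<beta> t) \<in> W" using t cpathsD(1) toP_apply by (auto simp: V_def)
        then have "zpt n (\<beta> t) \<notin> U" using UW(5) by (auto simp: disjnt_def)
        then show ?case using O'(2) \<open>\<beta> t \<in> cube n\<close> by auto
      qed
      moreover have "closed ((\<lambda>\<beta>::real \<Rightarrow> nat \<Rightarrow> real. \<beta> t) -` (- O'))"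
        by (rule closed_vimage) (use O'(1) in \<open>auto intro: continuous_on_coord continuous_on_id\<close>)
      ultimately have "b \<in> (\<lambda>\<beta>. \<beta> t) -` (- O')" by (intro cluster)
      moreover have "b t \<in> O'" using O'(2) UW(3) toP_apply[OF bc t] cpathsD(1)[OF bc t] by auto
      ultimately show False by simp
    qed
    moreover have "toP b \<in> extensional {0..1}" "\<alpha> \<in> extensional {0..1}"
      using \<beta>0(2) by (auto simp: toP_def)
    ultimately have "toP b = \<alpha>" by (intro extensionalityI[of _ "{0..1}"])
    moreover have "b \<in> CT"
    proof (rule cluster[OF CT(1)])
      have "topspace PP \<in> NN" using \<alpha> by (simp add: NN_def)
      then show "\<forall>\<^sub>F \<beta> in F. \<beta> \<in> CT" unfolding ev using CT(2) by blast
    qed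
    ultimately show False using \<alpha> CT(2) bc by (auto simp: all_cpaths_def)
  qed
  then have "openin PP (topspace PP - toP ` C)" by (subst openin_subopen) blast
  with sub show "closedin PP (toP ` C)" by (simp add: closedin_def)
qed

lemma quotient_map_toP: "quotient_map (top_of_set all_cpaths) PP toP"
proof (rule continuous_closed_imp_quotient_map[OF continuous_toP closed_map_toP])
  show "toP ` topspace (top_of_set all_cpaths) = topspace PP"
  proof (intro equalityI subsetI)
    fix \<alpha> assume "\<alpha> \<in> topspace PP"
    from toP_surj[OF this] show "\<alpha> \<in> toP ` topspace (top_of_set all_cpaths)" by force
  qed (use toP_in_PP in \<open>auto simp: all_cpaths_def\<close>)
qed

section \<open>Ordering coordinates\<close>

definition arrange :: "nat \<Rightarrow> (nat \<Rightarrow> real) \<Rightarrow> nat list \<Rightarrow> nat \<Rightarrow> real" where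
  "arrange n u L = (\<lambda>j. if j < n then u (L ! j) else 0)"

definition order_list :: "nat \<Rightarrow> (nat \<Rightarrow> real) \<Rightarrow> nat list" where
  "order_list n y = sort_key y [0..<n]"

text \<open>The letters \<open>u i\<close> written in the order of the keys \<open>y i\<close>.
  Resolving ties does not affect the point as long as coordinates with equal keys are not alive
  together.\<close>

definition ordered_pt :: "nat \<Rightarrow> (nat \<Rightarrow> real) \<Rightarrow> (nat \<Rightarrow> real) \<Rightarrow> ((nat \<times> nat) \<times> (nat \<Rightarrow> real)) set" where
  "ordered_pt n u y = zpt n (arrange n u (order_list n y))"

definition live_sep :: "nat \<Rightarrow> (nat \<Rightarrow> real) \<Rightarrow> (nat \<Rightarrow> real) \<Rightarrow> bool" where
  "live_sep n u y \<longleftrightarrow> (\<forall>i<n. \<forall>k<n. i \<noteq> k \<longrightarrow> live (u i) \<longrightarrow> live (u k) \<longrightarrow> y i \<noteq> y k)"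

lemma order_list_props [simp]:
  "length (order_list n y) = n" "distinct (order_list n y)" "set (order_list n y) = {..<n}"
  by (auto simp: order_list_def)

lemma order_list_sorted: "sorted_wrt (\<lambda>i k. y i \<le> y k \<and> i \<noteq> k) (order_list n y)"
proof -
  have "sorted (map y (order_list n y))" by (simp add: order_list_def)
  then show ?thesis
    using order_list_props(2)[of n y]
    by (auto simp: sorted_wrt_iff_nth_less distinct_conv_nth)
qed

lemma sorted_wrt_live:
  assumes "sorted_wrt R L" "set L \<subseteq> {..<n}"
    "\<And>i k. i < n \<Longrightarrow> k < n \<Longrightarrow> R i k \<Longrightarrow> live (u i) \<Longrightarrow> live (u k) \<Longrightarrow> Q i k"
  shows "sorted_wrt Q (filter (\<lambda>i. live (u i)) L)"
  by (rule sorted_wrt_mono_rel[OF _ sorted_wrt_filter[OF assms(1)]]) (use assms in auto)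

lemma sorted_order_list:
  "live_sep n u y \<Longrightarrow> sorted_wrt (\<lambda>i k. y i < y k) (filter (\<lambda>i. live (u i)) (order_list n y))"
  by (rule sorted_wrt_live[OF order_list_sorted]) (auto simp: live_sep_def less_le)

lemma arrange_cube:
  assumes "set L = {..<n}" "length L = n" "\<And>i. i < n \<Longrightarrow> u i \<in> {0..1}"
  shows "arrange n u L \<in> cube n"
  using assms nth_mem[of _ L] by (fastforce simp: cube_def arrange_def)

lemma word_arrange: "length L = n \<Longrightarrow> word n (arrange n u L) = map u (filter (\<lambda>i. live (u i)) L)"
proof -
  assume "length L = n"
  then have "coords n (arrange n u L) = map u L"
    by (auto simp: coords_def arrange_def intro: nth_equalityI)
  then show ?thesis by (simp add: word_def filter_map o_def)
qed

text \<open>Dead letters may stand anywhere: any enumeration in which the alive coordinates have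
  strictly increasing keys gives the same word, because a strictly sorted list is determined by its
  set.\<close>

lemma ordered_pt_eq:
  assumes u: "\<And>i. i < n \<Longrightarrow> u i \<in> {0..1}" and L: "distinct L" "set L = {..<n}"
    and sorted: "sorted_wrt (\<lambda>i k. y i < y k) (filter (\<lambda>i. live (u i)) L)"
  shows "ordered_pt n u y = zpt n (arrange n u L)"
proof -
  have len: "length L = n" using L by (metis card_lessThan distinct_card)
  let ?A = "filter (\<lambda>i. live (u i)) L" and ?B = "filter (\<lambda>i. live (u i)) (order_list n y)"
  have sep: "live_sep n u y"
    unfolding live_sep_def
  proof (intro allI impI)
    fix i k assume *: "i < n" "k < n" "i \<noteq> k" "live (u i)" "live (u k)"
    then obtain p q where "p < length ?A" "?A ! p = i" "q < length ?A" "?A ! q = k"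
      using L(2) by (metis (no_types, lifting) in_set_conv_nth lessThan_iff set_filter mem_Collect_eq)
    with sorted *(3) show "y i \<noteq> y k"
      by (metis (no_types, lifting) less_irrefl linorder_neqE_nat sorted_wrt_nth_less)
  qed
  note B = sorted_order_list[OF sep]
  have AB: "set ?B = set ?A" using L by auto
  have "map y ?B = map y ?A"
    by (rule strict_sorted_equal) (use sorted B AB in \<open>auto simp: sorted_wrt_map simp del: set_filter\<close>)
  moreover have "inj_on y (set ?A \<union> set ?B)"
    using sep L by (auto simp: inj_on_def live_sep_def)
  ultimately have "?B = ?A" by (metis map_inj_on AB Un_absorb)
  then show ?thesis
    unfolding ordered_pt_def
    using zpt_eq_iff[OF arrange_cube arrange_cube, of "order_list n y" n u L n u] u L(2) len word_arrange by simp
qed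

lemma ordered_pt_relabel:
  assumes \<pi>: "bij_betw \<pi> {..<n} {..<n}" and u: "\<And>i. i < n \<Longrightarrow> u i \<in> {0..1}"
    and u': "\<And>i. i < n \<Longrightarrow> u' (\<pi> i) = u i" and y': "\<And>i. i < n \<Longrightarrow> y' (\<pi> i) = y i"
    and sep: "live_sep n u y"
  shows "ordered_pt n u' y' = ordered_pt n u y"
proof -
  let ?L = "order_list n y"
  have "ordered_pt n u' y' = zpt n (arrange n u' (map \<pi> ?L))"
  proof (rule ordered_pt_eq)
    show "u' i \<in> {0..1}" if "i < n" for i
      using that \<pi> u u' unfolding bij_betw_def by (metis imageE lessThan_iff)
    show "distinct (map \<pi> ?L)" "set (map \<pi> ?L) = {..<n}"
      using \<pi> by (simp_all add: distinct_map bij_betw_def)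
    have "filter (\<lambda>i. live (u' i)) (map \<pi> ?L) = map \<pi> (filter (\<lambda>i. live (u i)) ?L)"
      unfolding filter_map using u' by (auto intro!: arg_cong[where f = "map \<pi>"] filter_cong)
    then show "sorted_wrt (\<lambda>i k. y' i < y' k) (filter (\<lambda>i. live (u' i)) (map \<pi> ?L))"
      using sorted_order_list[OF sep] y'
      by (auto simp: sorted_wrt_map intro: sorted_wrt_mono_rel[rotated])
  qed
  also have "arrange n u' (map \<pi> ?L) = arrange n u ?L"
    using u' nth_mem[of _ ?L] by (auto simp: arrange_def)
  finally show ?thesis by (simp add: ordered_pt_def)
qed

lemma continuous_on_arrange:
  "set L = {..<n} \<Longrightarrow> length L = n \<Longrightarrow> (\<And>i. i < n \<Longrightarrow> continuous_on A (\<lambda>a. u a i)) \<Longrightarrow>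
    continuous_on A (\<lambda>a. arrange n (u a) L)"
proof (rule continuous_on_into_fun)
  fix i assume *: "set L = {..<n}" "length L = n" "\<And>i. i < n \<Longrightarrow> continuous_on A (\<lambda>a. u a i)"
  show "continuous_on A (\<lambda>a. arrange n (u a) L i)"
    using * nth_mem[of i L] by (cases "i < n") (auto simp: arrange_def)
qed

lemma openin_pos:
  fixes f :: "'a::topological_space \<Rightarrow> real"
  assumes "continuous_on A f" shows "openin (top_of_set A) {a \<in> A. 0 < f a}"
proof -
  have "{a \<in> A. 0 < f a} = A \<inter> f -` {0<..}" by auto
  then show ?thesis using continuous_openin_preimage_gen[OF assms, of "{0<..}"] by simp
qed

text \<open>The function \<open>w\<close> certifies that coordinates with equal ordering values are not alive at the same time, robustly.\<close>
lemma continuous_ordered_pt: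
  fixes u y :: "'t::topological_space \<Rightarrow> nat \<Rightarrow> real"
  assumes u: "\<And>i. i < n \<Longrightarrow> continuous_on A (\<lambda>a. u a i)" "\<And>a i. a \<in> A \<Longrightarrow> i < n \<Longrightarrow> u a i \<in> {0..1}"
    and y: "\<And>i. i < n \<Longrightarrow> continuous_on A (\<lambda>a. y a i)"
    and w: "\<And>i k. i < n \<Longrightarrow> k < n \<Longrightarrow> i \<noteq> k \<Longrightarrow> continuous_on A (\<lambda>a. w a i k :: real)"
      "\<And>a i k. a \<in> A \<Longrightarrow> i < n \<Longrightarrow> k < n \<Longrightarrow> i \<noteq> k \<Longrightarrow> live (u a i) \<Longrightarrow> live (u a k) \<Longrightarrow> w a i k \<le> 0"
      "\<And>a i k. a \<in> A \<Longrightarrow> i < n \<Longrightarrow> k < n \<Longrightarrow> i \<noteq> k \<Longrightarrow> y a i = y a k \<Longrightarrow> w a i k > 0"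
  shows "continuous_map (top_of_set A) ZZ (\<lambda>a. ordered_pt n (u a) (y a))"
proof (rule continuous_into_ZZ)
  fix a assume a: "a \<in> A"
  \<comment> \<open>Where the keys differ at \<open>a\<close>, their order persists nearby; where
    they agree, positivity of \<open>w\<close> persists and excludes that both coordinates are
    alive. So the enumeration chosen at \<open>a\<close> serves a whole neighbourhood. The case
    \<open>y a i > y a k\<close> is covered by the pair with \<open>i\<close> and \<open>k\<close>
    exchanged.\<close>
  define N where "N i k = (if i = k then A else if y a i < y a k then {b \<in> A. 0 < y b k - y b i}
      else if y a i = y a k then {b \<in> A. 0 < w b i k} else A)" for i k
  have N: "openin (top_of_set A) (N i k)" "a \<in> N i k" if "i < n" "k < n" for i k
  proof -
    show "openin (top_of_set A) (N i k)"
    proof -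
      have "openin (top_of_set A) {b \<in> A. 0 < y b k - y b i}"
        using that y by (intro openin_pos continuous_on_diff)
      moreover have "i \<noteq> k \<Longrightarrow> openin (top_of_set A) {b \<in> A. 0 < w b i k}"
        using that w(1) by (intro openin_pos)
      ultimately show ?thesis by (simp add: N_def)
    qed
    show "a \<in> N i k" unfolding N_def using a that w(3) by auto
  qed
  define M where "M = A \<inter> (\<Inter>i\<in>{..<n}. \<Inter>k\<in>{..<n}. N i k)"
  have "openin (top_of_set A) (\<Inter>i\<in>{..<n}. \<Inter>k\<in>{..<n}. N i k)" if "n \<noteq> 0"
    using that N(1) by (intro openin_INT2) auto
  then have M: "openin (top_of_set A) M" "a \<in> M"
    using N(2) a by (cases "n = 0"; auto simp: M_def)+
  let ?L = "order_list n (y a)"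
  have "ordered_pt n (u b) (y b) = zpt n (arrange n (u b) ?L)" if b: "b \<in> M" for b
  proof (rule ordered_pt_eq)
    have "b \<in> A" using b by (simp add: M_def)
    show "u b i \<in> {0..1}" if "i < n" for i using u(2) \<open>b \<in> A\<close> that by blast
    show "sorted_wrt (\<lambda>i k. y b i < y b k) (filter (\<lambda>i. live (u b i)) ?L)"
    proof (rule sorted_wrt_live[OF order_list_sorted])
      fix i k assume ik: "i < n" "k < n" "y a i \<le> y a k \<and> i \<noteq> k" "live (u b i)" "live (u b k)"
      then have "w b i k \<le> 0" using w(2)[OF \<open>b \<in> A\<close>] by blast
      moreover have "b \<in> N i k" using b ik by (auto simp: M_def)
      ultimately show "y b i < y b k" using ik(3) by (auto simp: N_def split: if_splits)
    qed simp
  qed simp_all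
  moreover have "continuous_on M (\<lambda>b. arrange n (u b) ?L)"
    by (rule continuous_on_arrange) (use continuous_on_subset[OF u(1), of _ M] in \<open>auto simp: M_def\<close>)
  moreover have "arrange n (u b) ?L \<in> cube n" if "b \<in> M" for b
    by (rule arrange_cube) (use that u(2) in \<open>auto simp: M_def\<close>)
  ultimately show "\<exists>N m v. openin (top_of_set A) N \<and> a \<in> N \<and> continuous_on N v \<and> v ` N \<subseteq> cube m \<and>
      (\<forall>b\<in>N. ordered_pt n (u b) (y b) = zpt m (v b))"
    using M by (intro exI[of _ M] exI[of _ n] exI[of _ "\<lambda>b. arrange n (u b) ?L"]) auto
qed

definition list_path :: "nat \<Rightarrow> (real \<Rightarrow> nat \<Rightarrow> real) \<Rightarrow> nat list \<Rightarrow> real \<Rightarrow> nat \<Rightarrow> real" where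
  "list_path n u L = (\<lambda>t. if t \<in> {0..1} then arrange n (u t) L else (\<lambda>_. 0))"

lemma list_path_cpaths:
  assumes L: "set L = {..<n}" "length L = n"
    and u: "\<And>i. i < n \<Longrightarrow> continuous_on {0..1} (\<lambda>t. u t i)" "\<And>i. i < n \<Longrightarrow> mono_on {0..1} (\<lambda>t. u t i)"
      "\<And>i. i < n \<Longrightarrow> u 0 i = 0" "\<And>i. i < n \<Longrightarrow> u 1 i = 1"
  shows "list_path n u L \<in> cpaths n"
proof -
  have L': "L ! j < n" if "j < n" for j using nth_mem[of j L] L that by auto
  have rng: "u t i \<in> {0..1}" if "i < n" "t \<in> {0..1}" for t i
    using mono_onD[OF u(2)[OF that(1)], of 0 t] mono_onD[OF u(2)[OF that(1)], of t 1] u(3,4) that by auto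
  have eq: "list_path n u L t j = (if j < n then u t (L ! j) else 0)" if "t \<in> {0..1}" for t j
    using that by (simp add: list_path_def arrange_def)
  have "continuous_on {0..1} (\<lambda>t. list_path n u L t j)" for j
  proof -
    have "continuous_on {0..1} (\<lambda>t. list_path n u L t j) \<longleftrightarrow> continuous_on {0..1} (\<lambda>t. if j < n then u t (L ! j) else 0)"
      by (rule continuous_on_cong) (use eq in auto)
    then show ?thesis using u(1) L' by (cases "j < n") auto
  qed
  moreover have "mono_on {0..1} (\<lambda>t. list_path n u L t j)" for j
    using u(2)[OF L', of j] eq by (auto simp: mono_on_def)
  ultimately show ?thesis
    using rng L' u(3,4) by (auto simp: cpaths_def eq cube_def) (auto simp: list_path_def arrange_def)
qed

section \<open>Steep strands\<close>

text \<open>On [0,1] the line stays between 1/4 and 3/4, so a strand is alive when it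
  crosses.\<close>

definition kap :: "real \<Rightarrow> real" where
  "kap t = 3/4 - t/2"

text \<open>Here \<open>v\<close> is the height of a strand above the line. Slope 1 gives the strand
  back; a larger \<open>lam\<close> magnifies the height and leaves the crossing in place.\<close>

definition ramp :: "real \<Rightarrow> real \<Rightarrow> real \<Rightarrow> real" where
  "ramp lam v t = max 0 (min 1 (kap t + lam * v))"

text \<open>Abstracts the difference of a strand and the line: a zero at \<open>x\<close> and growth
  at rate at least 1/2. The condition is convex for fixed \<open>x\<close>, which permits linear
  interpolation of strands.\<close>

definition steep :: "(real \<Rightarrow> real) \<Rightarrow> real \<Rightarrow> bool" where
  "steep g x \<longleftrightarrow> 0 < x \<and> x < 1 \<and> g x = 0 \<and> continuous_on {0..1} g \<and>
     (\<forall>s t. 0 \<le> s \<longrightarrow> s \<le> t \<longrightarrow> t \<le> 1 \<longrightarrow> (t - s) / 2 \<le> g t - g s)"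

lemma steepD:
  assumes "steep g x"
  shows "0 < x" "x < 1" "g x = 0" "continuous_on {0..1} g"
    "0 \<le> s \<Longrightarrow> s \<le> t \<Longrightarrow> t \<le> 1 \<Longrightarrow> (t - s) / 2 \<le> g t - g s"
  using assms by (auto simp: steep_def)

lemma steep_abs: "steep g x \<Longrightarrow> t \<in> {0..1} \<Longrightarrow> \<bar>t - x\<bar> / 2 \<le> \<bar>g t\<bar>"
  using steepD(5)[of g x x t] steepD(5)[of g x t x] steepD(1-3)[of g x] by (cases "x \<le> t") auto

lemma steep_unique: "steep g x \<Longrightarrow> steep g y \<Longrightarrow> x = y"
  using steep_abs[of g x y] steepD[of g y] by auto

lemma steep_cong:
  assumes "\<And>t. t \<in> {0..1} \<Longrightarrow> g t = h t" "steep g x" shows "steep h x"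
proof -
  have "continuous_on {0..1} h" by (rule continuous_on_eq[OF steepD(4)[OF assms(2)] assms(1)])
  then show ?thesis using assms steepD[OF assms(2)] by (auto simp: steep_def)
qed

lemma steep_line: "0 < x \<Longrightarrow> x < 1 \<Longrightarrow> steep (\<lambda>t. (t - x) / 2) x"
  by (auto simp: steep_def diff_divide_distrib intro!: continuous_intros)

lemma steep_combination:
  assumes "steep g x" "0 \<le> \<tau>" "\<tau> \<le> 1" shows "steep (\<lambda>t. (1 - \<tau>) * g t + \<tau> * ((t - x) / 2)) x"
  unfolding steep_def
proof (intro conjI allI impI)
  show "continuous_on {0..1} (\<lambda>t. (1 - \<tau>) * g t + \<tau> * ((t - x) / 2))"
    using steepD(4)[OF assms(1)] by (intro continuous_intros) auto
  fix s t :: real assume st: "0 \<le> s" "s \<le> t" "t \<le> 1"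
  have "(1 - \<tau>) * ((t - s) / 2) \<le> (1 - \<tau>) * (g t - g s)"
    using steepD(5)[OF assms(1) st] assms by (intro mult_left_mono) auto
  then show "(t - s) / 2 \<le> (1 - \<tau>) * g t + \<tau> * ((t - x) / 2) - ((1 - \<tau>) * g s + \<tau> * ((s - x) / 2))"
    by (simp add: field_simps)
qed (use steepD[OF assms(1)] in auto)

lemma ramp_range [simp]: "0 \<le> ramp lam v t" "ramp lam v t \<le> 1"
  by (auto simp: ramp_def)

lemma kap_bounds: "t \<in> {0..1} \<Longrightarrow> 1/4 \<le> kap t \<and> kap t \<le> 3/4"
  by (auto simp: kap_def)

lemma live_kap: "t \<in> {0..1} \<Longrightarrow> live (kap t)"
  using kap_bounds[of t] by (auto simp: live_def)

lemma ramp_zero: "t \<in> {0..1} \<Longrightarrow> ramp lam 0 t = kap t"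
  using kap_bounds[of t] by (auto simp: ramp_def)

lemma ramp_live_near:
  assumes g: "steep g x" and t: "t \<in> {0..1}" and lam: "0 \<le> lam" and l: "live (ramp lam (g t) t)"
  shows "lam * \<bar>t - x\<bar> < 2"
proof -
  have "\<bar>lam * g t\<bar> < 1" using l kap_bounds[OF t] by (auto simp: ramp_def live_def split: if_splits)
  then have "lam * \<bar>g t\<bar> < 1" using lam by (simp add: abs_mult)
  moreover have "lam * (\<bar>t - x\<bar> / 2) \<le> lam * \<bar>g t\<bar>" using steep_abs[OF g t] lam by (rule mult_left_mono)
  ultimately show ?thesis by simp
qed

text \<open>An alive ramp satisfies \<open>lam * \<bar>g t\<bar> < 1\<close>, and
  \<open>\<bar>g t\<bar>\<close> is at least half the distance of \<open>t\<close> from the crossing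
  time. Both crossings are thus less than \<open>2 / lam\<close> from \<open>t\<close>.\<close>

lemma ramp_live_pair:
  assumes "steep g x" "steep h z" "t \<in> {0..1}" "0 \<le> lam" "live (ramp lam (g t) t)" "live (ramp lam (h t) t)"
  shows "lam * \<bar>x - z\<bar> < 4"
proof -
  have "lam * \<bar>x - z\<bar> \<le> lam * (\<bar>t - x\<bar> + \<bar>t - z\<bar>)" using assms(4) by (intro mult_left_mono) auto
  also have "\<dots> < 4"
    using ramp_live_near[OF assms(1,3,4,5)] ramp_live_near[OF assms(2,3,4,6)] by (simp add: distrib_left)
  finally show ?thesis .
qed

text \<open>For \<open>lam\<close> at least 1 the growth of \<open>lam * g\<close> outweighs the
  descent of the line at rate 1/2.\<close>

lemma ramp_mono:
  assumes g: "steep g x" and lam: "1 \<le> lam"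
  shows "continuous_on {0..1} (\<lambda>t. ramp lam (g t) t)" "mono_on {0..1} (\<lambda>t. ramp lam (g t) t)"
proof -
  show "continuous_on {0..1} (\<lambda>t. ramp lam (g t) t)"
    unfolding ramp_def kap_def using steepD(4)[OF g] by (intro continuous_intros) auto
  show "mono_on {0..1} (\<lambda>t. ramp lam (g t) t)"
  proof (rule mono_onI)
    fix s t :: real assume st: "s \<in> {0..1}" "t \<in> {0..1}" "s \<le> t"
    have "1 * ((t - s) / 2) \<le> lam * (g t - g s)"
      using steepD(5)[OF g, of s t] st lam by (intro mult_mono) auto
    then have "kap s + lam * g s \<le> kap t + lam * g t" by (simp add: kap_def field_simps)
    then show "ramp lam (g s) s \<le> ramp lam (g t) t" by (auto simp: ramp_def)
  qed
qed

text \<open>Steepness puts \<open>g\<close> below \<open>- x / 2\<close> at time 0 and above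
  \<open>(1 - x) / 2\<close> at time 1; the slope turns these into a drop and a rise of at least 1,
  enough to reach the clamped values.\<close>

lemma ramp_ends:
  assumes g: "steep g x" and lam: "1 \<le> lam" "2 \<le> lam * x" "2 \<le> lam * (1 - x)"
  shows "ramp lam (g 0) 0 = 0" "ramp lam (g 1) 1 = 1"
proof -
  have "g 0 \<le> - x / 2" using steepD(5)[OF g, of 0 x] steepD[OF g] by simp
  then have "lam * g 0 \<le> lam * (- x / 2)" using lam(1) by (intro mult_left_mono) auto
  then show "ramp lam (g 0) 0 = 0" using lam(2) by (simp add: ramp_def kap_def)
  have "(1 - x) / 2 \<le> g 1" using steepD(5)[OF g, of x 1] steepD[OF g] by simp
  then have "lam * ((1 - x) / 2) \<le> lam * g 1" using lam(1) by (intro mult_left_mono) auto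
  then show "ramp lam (g 1) 1 = 1" using lam(3) by (simp add: ramp_def kap_def)
qed

text \<open>The bounds make the ramps nondecreasing, let them run from 0 to 1, and keep strands with
  equal key from being alive together; the 4 is the bound of \<open>ramp_live_pair\<close>.\<close>

definition admissible :: "nat \<Rightarrow> real \<Rightarrow> (nat \<Rightarrow> real) \<Rightarrow> (nat \<Rightarrow> real) \<Rightarrow> bool" where
  "admissible n lam x y \<longleftrightarrow> 1 \<le> lam \<and> (\<forall>i<n. 0 < x i \<and> x i < 1 \<and> 2 \<le> lam * x i \<and> 2 \<le> lam * (1 - x i)) \<and>
     (\<forall>i<n. \<forall>k<n. i \<noteq> k \<longrightarrow> y i = y k \<longrightarrow> 4 < lam * \<bar>x i - x k\<bar>)"

lemma admissible_mono:
  assumes "admissible n lam x y" "lam \<le> mu" shows "admissible n mu x y"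
proof -
  have *: "c \<le> lam * v \<Longrightarrow> 0 \<le> v \<Longrightarrow> c \<le> mu * v" "c < lam * v \<Longrightarrow> 0 \<le> v \<Longrightarrow> c < mu * v" for c v :: real
    using assms(2) mult_right_mono[of lam mu v] by linarith+
  show ?thesis
    using assms unfolding admissible_def
    by (intro conjI allI impI; elim conjE) (auto intro!: *)
qed

definition ramps :: "nat \<Rightarrow> real \<Rightarrow> (nat \<Rightarrow> real \<Rightarrow> real) \<Rightarrow> real \<Rightarrow> nat \<Rightarrow> real" where
  "ramps n lam g t i = ramp lam (g i t) t"

definition ramp_path_of :: "nat \<Rightarrow> real \<Rightarrow> (nat \<Rightarrow> real \<Rightarrow> real) \<Rightarrow> (nat \<Rightarrow> real) \<Rightarrow>
    real \<Rightarrow> ((nat \<times> nat) \<times> (nat \<Rightarrow> real)) set" where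
  "ramp_path_of n lam g y = (\<lambda>t\<in>{0..1}. ordered_pt n (ramps n lam g t) y)"

lemma live_sep_ramps:
  assumes "admissible n lam x y" "\<And>i. i < n \<Longrightarrow> steep (g i) (x i)" "t \<in> {0..1}"
  shows "live_sep n (ramps n lam g t) y"
  using assms ramp_live_pair[OF assms(2) assms(2) assms(3), of _ _ lam]
  unfolding live_sep_def ramps_def admissible_def by (meson less_asym order_trans zero_le_one)

lemma list_path_ramps:
  assumes "admissible n lam x y" "\<And>i. i < n \<Longrightarrow> steep (g i) (x i)" "set L = {..<n}" "length L = n"
  shows "list_path n (ramps n lam g) L \<in> cpaths n"
  by (rule list_path_cpaths) (use ramp_mono[OF assms(2)] ramp_ends[OF assms(2)] assms in \<open>auto simp: ramps_def admissible_def\<close>)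

lemma ramp_path_of_eq:
  assumes "admissible n lam x y" "\<And>i. i < n \<Longrightarrow> steep (g i) (x i)"
  shows "ramp_path_of n lam g y = toP (list_path n (ramps n lam g) (order_list n y))"
proof -
  have B: "list_path n (ramps n lam g) (order_list n y) \<in> cpaths n"
    by (rule list_path_ramps[OF assms(1)]) (use assms(2) in auto)
  show ?thesis
    unfolding ramp_path_of_def toP_def deg_cpaths[OF B]
    by (intro restrict_ext) (simp add: ordered_pt_def list_path_def)
qed

lemma ramp_path_of_in_PP:
  assumes "admissible n lam x y" "\<And>i. i < n \<Longrightarrow> steep (g i) (x i)"
  shows "ramp_path_of n lam g y \<in> topspace PP"
proof -
  have "list_path n (ramps n lam g) (order_list n y) \<in> cpaths n"
    by (rule list_path_ramps[OF assms(1)]) (use assms(2) in auto)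
  moreover have "ramp_path_of n lam g y = toP (list_path n (ramps n lam g) (order_list n y))"
    by (rule ramp_path_of_eq[OF assms(1)]) (rule assms(2))
  ultimately show ?thesis using toP_in_PP by simp
qed

lemma continuous_ramp_path_of:
  fixes g :: "'t::topological_space \<Rightarrow> nat \<Rightarrow> real \<Rightarrow> real"
  assumes adm: "\<And>a. a \<in> A \<Longrightarrow> admissible n (lam a) (x a) (y a)"
    and steep: "\<And>a i. a \<in> A \<Longrightarrow> i < n \<Longrightarrow> steep (g a i) (x a i)"
    and cont: "continuous_on A lam" "\<And>i. i < n \<Longrightarrow> continuous_on A (\<lambda>a. x a i)"
      "\<And>i. i < n \<Longrightarrow> continuous_on A (\<lambda>a. y a i)"
      "\<And>i. i < n \<Longrightarrow> continuous_on (A \<times> {0..1}) (\<lambda>(a, t). g a i t)"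
  shows "continuous_map (top_of_set A) PP (\<lambda>a. ramp_path_of n (lam a) (g a) (y a))"
proof (rule continuous_into_PP)
  let ?B = "A \<times> {0..1::real}"
  have fst: "continuous_on ?B (\<lambda>p. f (fst p))" if "continuous_on A f" for f :: "'t \<Rightarrow> real"
    by (rule continuous_on_compose2[OF that]) (auto intro: continuous_intros)
  have "continuous_map (top_of_set ?B) ZZ (\<lambda>p. ordered_pt n (ramps n (lam (fst p)) (g (fst p)) (snd p)) (y (fst p)))"
  \<comment> \<open>This certificate is negative for strands alive together, by
    \<open>ramp_live_pair\<close>, and positive at equal keys, by admissibility.\<close>
  proof (rule continuous_ordered_pt[where w = "\<lambda>p i k. lam (fst p) * \<bar>x (fst p) i - x (fst p) k\<bar> - 4"])
    fix i assume i: "i < n"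
    show "continuous_on ?B (\<lambda>p. ramps n (lam (fst p)) (g (fst p)) (snd p) i)"
      using cont(4)[OF i] fst[OF cont(1)] unfolding ramps_def ramp_def kap_def case_prod_unfold
      by (intro continuous_intros) auto
    show "continuous_on ?B (\<lambda>p. y (fst p) i)" using fst[OF cont(3)[OF i]] .
  next
    fix i k assume "i < n" "k < n"
    then show "continuous_on ?B (\<lambda>p. lam (fst p) * \<bar>x (fst p) i - x (fst p) k\<bar> - 4)"
      by (intro continuous_intros fst cont)
  next
    fix p i k assume *: "p \<in> ?B" "i < n" "k < n" "i \<noteq> k"
    then have p: "fst p \<in> A" "snd p \<in> {0..1}" by auto
    note adm' = adm[OF p(1), unfolded admissible_def]
    show "lam (fst p) * \<bar>x (fst p) i - x (fst p) k\<bar> - 4 \<le> 0"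
      if "live (ramps n (lam (fst p)) (g (fst p)) (snd p) i)" "live (ramps n (lam (fst p)) (g (fst p)) (snd p) k)"
    proof -
      have "0 \<le> lam (fst p)" using adm' by simp
      from ramp_live_pair[OF steep[OF p(1) *(2)] steep[OF p(1) *(3)] p(2) this] that
      show ?thesis by (simp add: ramps_def)
    qed
    show "lam (fst p) * \<bar>x (fst p) i - x (fst p) k\<bar> - 4 > 0" if "y (fst p) i = y (fst p) k"
      using adm' * that by simp
  qed (simp add: ramps_def)
  then show "continuous_map (top_of_set ?B) ZZ (\<lambda>(a, t). ramp_path_of n (lam a) (g a) (y a) t)"
    by (rule continuous_map_eq) (auto simp: ramp_path_of_def)
  show "ramp_path_of n (lam a) (g a) (y a) \<in> topspace PP" if "a \<in> A" for a
    by (rule ramp_path_of_in_PP[OF adm[OF that]]) (rule steep[OF that])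
qed

lemma ramp_path_of_relabel:
  assumes \<pi>: "bij_betw \<pi> {..<n} {..<n}" and adm: "admissible n lam x y" and g: "\<And>i. i < n \<Longrightarrow> steep (g i) (x i)"
    and g': "\<And>i t. i < n \<Longrightarrow> t \<in> {0..1} \<Longrightarrow> g' (\<pi> i) t = g i t" and y': "\<And>i. i < n \<Longrightarrow> y' (\<pi> i) = y i"
  shows "ramp_path_of n lam g' y' = ramp_path_of n lam g y"
  unfolding ramp_path_of_def
  by (intro restrict_ext ordered_pt_relabel[OF \<pi>] live_sep_ramps[OF adm g])
    (use g' y' in \<open>auto simp: ramps_def\<close>)

section \<open>A continuous symmetric choice of admissible slope\<close>

definition gapd :: "(nat \<Rightarrow> real) \<Rightarrow> (nat \<Rightarrow> real) \<Rightarrow> nat \<Rightarrow> nat \<Rightarrow> real" where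
  "gapd x y i k = max \<bar>x i - x k\<bar> \<bar>y i - y k\<bar>"

text \<open>Every lower bound demanded by admissibility is dominated by one summand; a sum is both
  continuous and independent of labels. Using the larger of the two coordinate distances keeps the
  terms finite when crossing times coincide, while at equal keys it is the distance of the crossing
  times; 8 makes the required bound 4 strict.\<close>

definition slope :: "nat \<Rightarrow> (nat \<Rightarrow> real) \<Rightarrow> (nat \<Rightarrow> real) \<Rightarrow> real" where
  "slope n x y = 4 + (\<Sum>i<n. 2 / x i + 2 / (1 - x i)) + (\<Sum>i<n. \<Sum>k<n. if i = k then 0 else 8 / gapd x y i k)"

definition distinct_pts :: "nat \<Rightarrow> (nat \<Rightarrow> real) \<Rightarrow> (nat \<Rightarrow> real) \<Rightarrow> bool" where
  "distinct_pts n x y \<longleftrightarrow> (\<forall>i<n. 0 < x i \<and> x i < 1) \<and> (\<forall>i<n. \<forall>k<n. i \<noteq> k \<longrightarrow> x i = x k \<longrightarrow> y i \<noteq> y k)"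

lemma gapd_pos: "distinct_pts n x y \<Longrightarrow> i < n \<Longrightarrow> k < n \<Longrightarrow> i \<noteq> k \<Longrightarrow> gapd x y i k > 0"
  by (auto simp: gapd_def distinct_pts_def less_max_iff_disj)

lemma double_sum_ge:
  fixes f :: "nat \<Rightarrow> nat \<Rightarrow> real"
  assumes "\<And>i k. i < n \<Longrightarrow> k < n \<Longrightarrow> 0 \<le> f i k" "i < n" "k < n"
  shows "f i k \<le> (\<Sum>i<n. \<Sum>k<n. f i k)"
proof -
  have "f i k \<le> (\<Sum>k<n. f i k)" using assms by (intro member_le_sum) auto
  also have "\<dots> \<le> (\<Sum>i<n. \<Sum>k<n. f i k)"
    by (rule member_le_sum[where f = "\<lambda>i. \<Sum>k<n. f i k"]) (use assms in \<open>auto intro: sum_nonneg\<close>)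
  finally show ?thesis .
qed

lemma admissible_slope:
  assumes d: "distinct_pts n x y" shows "admissible n (slope n x y) x y"
proof -
  let ?S = "\<Sum>i<n. 2 / x i + 2 / (1 - x i)" and ?T = "\<Sum>i<n. \<Sum>k<n. if i = k then 0 else 8 / gapd x y i k"
  have x: "0 < x i" "x i < 1" if "i < n" for i using d that by (auto simp: distinct_pts_def)
  have nn: "0 \<le> 2 / x i + 2 / (1 - x i)" if "i < n" for i using x[OF that] by simp
  have nn': "0 \<le> (if i = k then 0 else 8 / gapd x y i k)" if "i < n" "k < n" for i k
    using gapd_pos[OF d that] by (auto intro: less_imp_le)
  have S: "0 \<le> ?S" using nn by (intro sum_nonneg) auto
  have T: "0 \<le> ?T" by (intro sum_nonneg nn') auto
  have "2 \<le> slope n x y * x i \<and> 2 \<le> slope n x y * (1 - x i)" if i: "i < n" for i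
  proof -
    have "2 / x i + 2 / (1 - x i) \<le> ?S" by (rule member_le_sum) (use nn i in auto)
    moreover have "0 \<le> 2 / x i" "0 \<le> 2 / (1 - x i)" using x[OF i] by auto
    ultimately have "2 / x i \<le> slope n x y" "2 / (1 - x i) \<le> slope n x y" using T unfolding slope_def by linarith+
    then show ?thesis using x[OF i] by (simp add: pos_divide_le_eq)
  qed
  moreover have "4 < slope n x y * \<bar>x i - x k\<bar>" if ik: "i < n" "k < n" "i \<noteq> k" "y i = y k" for i k
  proof -
    have "(if i = k then 0 else 8 / gapd x y i k) \<le> ?T"
      by (rule double_sum_ge[where f = "\<lambda>i k. if i = k then 0 else 8 / gapd x y i k", OF _ ik(1,2)]) (rule nn')
    then have "8 / gapd x y i k \<le> ?T" using ik(3) by simp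
    then have "8 / gapd x y i k \<le> slope n x y" using S by (simp add: slope_def)
    then have "8 \<le> slope n x y * gapd x y i k" using gapd_pos[OF d ik(1-3)] by (simp add: pos_divide_le_eq)
    then show ?thesis using ik(4) by (simp add: gapd_def)
  qed
  ultimately show ?thesis
    using S T x by (auto simp: admissible_def slope_def)
qed

lemma slope_relabel:
  assumes \<pi>: "bij_betw \<pi> {..<n} {..<n}" and x': "\<And>i. i < n \<Longrightarrow> x' (\<pi> i) = x i" and y': "\<And>i. i < n \<Longrightarrow> y' (\<pi> i) = y i"
  shows "slope n x' y' = slope n x y"
proof -
  have re: "(\<Sum>i<n. f i) = (\<Sum>i<n. f (\<pi> i))" for f :: "nat \<Rightarrow> real"
    using sum.reindex_bij_betw[OF \<pi>, of f] by simp
  have inj: "\<pi> i = \<pi> k \<longleftrightarrow> i = k" if "i < n" "k < n" for i k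
    using \<pi> that by (auto simp: bij_betw_def inj_on_def)
  have "(\<Sum>i<n. 2 / x' i + 2 / (1 - x' i)) = (\<Sum>i<n. 2 / x i + 2 / (1 - x i))"
    by (subst re) (simp add: x')
  moreover have "(\<Sum>i<n. \<Sum>k<n. if i = k then 0 else 8 / gapd x' y' i k) =
     (\<Sum>i<n. \<Sum>k<n. if \<pi> i = \<pi> k then 0 else 8 / gapd x' y' (\<pi> i) (\<pi> k))"
    by (subst re, rule sum.cong[OF refl], rule re)
  moreover have "\<dots> = (\<Sum>i<n. \<Sum>k<n. if i = k then 0 else 8 / gapd x y i k)"
    by (intro sum.cong refl) (simp add: inj x' y' gapd_def)
  ultimately show ?thesis by (simp add: slope_def)
qed

lemma continuous_slope:
  fixes x y :: "'t::topological_space \<Rightarrow> nat \<Rightarrow> real"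
  assumes "\<And>i. i < n \<Longrightarrow> continuous_on A (\<lambda>a. x a i)" "\<And>i. i < n \<Longrightarrow> continuous_on A (\<lambda>a. y a i)"
    "\<And>a. a \<in> A \<Longrightarrow> distinct_pts n (x a) (y a)"
  shows "continuous_on A (\<lambda>a. slope n (x a) (y a))"
proof -
  have x: "x a i \<noteq> 0" "1 - x a i \<noteq> 0" if "a \<in> A" "i < n" for a i
    using assms(3)[OF that(1)] that by (auto simp: distinct_pts_def)
  have "continuous_on A (\<lambda>a. if i = k then 0 else 8 / gapd (x a) (y a) i k)" if "i < n" "k < n" for i k
  proof (cases "i = k")
    case False
    have "gapd (x a) (y a) i k \<noteq> 0" if "a \<in> A" for a
      using gapd_pos[OF assms(3)[OF that] \<open>i < n\<close> \<open>k < n\<close> False] by simp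
    then show ?thesis
      using False assms(1,2) that by (auto simp: gapd_def intro!: continuous_intros)
  qed simp
  then show ?thesis
    unfolding slope_def using assms(1) x by (intro continuous_intros) auto
qed

section \<open>Crossing points and levels\<close>

text \<open>A tent around 1/2 that is positive on all values of the line, between 1/4 and 3/4, and
  vanishes near 0 and 1.\<close>

definition theta :: "real \<Rightarrow> real" where
  "theta u = max 0 (3/8 - \<bar>u - 1/2\<bar>)"

lemma theta_nonneg [simp]: "0 \<le> theta u"
  by (simp add: theta_def)

lemma theta_dead: "\<not> live u \<Longrightarrow> theta u = 0"
  by (auto simp: theta_def live_def)

lemma theta_kap: "t \<in> {0..1} \<Longrightarrow> 0 < theta (kap t)"
proof -
  assume "t \<in> {0..1}"
  then have "\<bar>kap t - 1/2\<bar> \<le> 1/4" using kap_bounds[of t] by (intro abs_leI) auto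
  then show ?thesis by (simp add: theta_def less_max_iff_disj)
qed

lemma continuous_on_theta: "continuous_on A f \<Longrightarrow> continuous_on A (\<lambda>a. theta (f a))"
  unfolding theta_def by (intro continuous_intros) auto

definition sg :: "nat \<Rightarrow> nat \<Rightarrow> real" where
  "sg i k = (if k < i then 1 else if i < k then -1 else 0)"

definition cross :: "(real \<Rightarrow> nat \<Rightarrow> real) \<Rightarrow> nat \<Rightarrow> real" where
  "cross \<beta> i = (SOME x. steep (\<lambda>t. \<beta> t i - kap t) x)"

text \<open>A weighted count of the strands before \<open>i\<close> minus those after it, taken when
  \<open>i\<close> crosses. The weights vanish on dead strands, so only the order that the path
  itself determines enters.\<close>

definition lev :: "nat \<Rightarrow> (real \<Rightarrow> nat \<Rightarrow> real) \<Rightarrow> nat \<Rightarrow> real" where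
  "lev n \<beta> i = (\<Sum>k<n. sg i k * theta (\<beta> (cross \<beta> i) k))"

lemma steep_cross:
  assumes \<beta>: "\<beta> \<in> cpaths n" and i: "i < n"
  shows "steep (\<lambda>t. \<beta> t i - kap t) (cross \<beta> i)"
proof -
  have cont: "continuous_on {0..1} (\<lambda>t. \<beta> t i - kap t)"
    unfolding kap_def using cpathsD(2)[OF \<beta>] by (intro continuous_intros) auto
  have ends: "\<beta> 0 i - kap 0 = -3/4" "\<beta> 1 i - kap 1 = 3/4"
    using cpathsD(4,5)[OF \<beta> i] by (auto simp: kap_def)
  obtain x where x: "0 \<le> x" "x \<le> 1" "\<beta> x i - kap x = 0"
    using IVT'[of "\<lambda>t. \<beta> t i - kap t" 0 0 1] cont ends by auto
  have "x \<noteq> 0" "x \<noteq> 1" using x(3) ends by auto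
  moreover have "(t - s) / 2 \<le> (\<beta> t i - kap t) - (\<beta> s i - kap s)" if "0 \<le> s" "s \<le> t" "t \<le> 1" for s t
    using cpathsD(11)[OF \<beta>, of s t i] that by (simp add: kap_def field_simps)
  ultimately have "steep (\<lambda>t. \<beta> t i - kap t) x"
    using x cont by (simp add: steep_def)
  then show ?thesis unfolding cross_def by (rule someI)
qed

lemma cross_bounds:
  assumes "\<beta> \<in> cpaths n" "i < n"
  shows "0 < cross \<beta> i" "cross \<beta> i < 1" "cross \<beta> i \<in> {0..1}" "\<beta> (cross \<beta> i) i = kap (cross \<beta> i)"
  using steepD(1-3)[OF steep_cross[OF assms]] by auto

lemma cross_eqI: "\<beta> \<in> cpaths n \<Longrightarrow> i < n \<Longrightarrow> steep (\<lambda>t. \<beta> t i - kap t) x \<Longrightarrow> cross \<beta> i = x"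
  using steep_unique steep_cross by blast

text \<open>Steepness bounds the displacement of the crossing time by twice the change of the strand
  at the single time \<open>cross \<gamma> i\<close>, which pointwise convergence controls.\<close>

lemma continuous_on_cross:
  assumes i: "i < n" shows "continuous_on (cpaths n) (\<lambda>\<beta>. cross \<beta> i)"
  unfolding continuous_on_def
proof
  fix \<gamma> assume \<gamma>: "\<gamma> \<in> cpaths n"
  let ?x = "cross \<gamma> i"
  have "((\<lambda>\<beta>. cross \<beta> i - ?x) \<longlongrightarrow> 0) (at \<gamma> within cpaths n)"
  proof (rule Lim_null_comparison)
    show "\<forall>\<^sub>F \<beta> in at \<gamma> within cpaths n. norm (cross \<beta> i - ?x) \<le> 2 * \<bar>\<beta> ?x i - \<gamma> ?x i\<bar>"
    proof -
      have "norm (cross \<beta> i - ?x) \<le> 2 * \<bar>\<beta> ?x i - \<gamma> ?x i\<bar>" if "\<beta> \<in> cpaths n" for \<beta>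
        using steep_abs[OF steep_cross[OF that i] cross_bounds(3)[OF \<gamma> i]] cross_bounds(4)[OF \<gamma> i] by auto
      then show ?thesis by (auto simp: eventually_at_filter)
    qed
    have "continuous_on (cpaths n) (\<lambda>\<beta>. 2 * \<bar>\<beta> ?x i - \<gamma> ?x i\<bar>)"
      by (intro continuous_intros continuous_on_at)
    from bspec[OF this[unfolded continuous_on_def] \<gamma>]
    show "((\<lambda>\<beta>. 2 * \<bar>\<beta> ?x i - \<gamma> ?x i\<bar>) \<longlongrightarrow> 0) (at \<gamma> within cpaths n)" by simp
  qed
  then show "((\<lambda>\<beta>. cross \<beta> i) \<longlongrightarrow> ?x) (at \<gamma> within cpaths n)" by (simp add: LIM_zero_iff)
qed

lemma continuous_on_at_cross:
  assumes "i < n" shows "continuous_on (cpaths n) (\<lambda>\<beta>. \<beta> (cross \<beta> i) k)"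
proof -
  have "continuous_on (cpaths n) (\<lambda>\<beta>. (\<lambda>(\<beta>, t). \<beta> t k) (\<beta>, cross \<beta> i))"
    by (rule continuous_on_compose2[OF continuous_on_eval])
      (use cross_bounds(3)[OF _ assms] in \<open>auto intro!: continuous_on_Pair continuous_on_id continuous_on_cross[OF assms]\<close>)
  then show ?thesis by simp
qed

lemma continuous_on_lev: "i < n \<Longrightarrow> continuous_on (cpaths n) (\<lambda>\<beta>. lev n \<beta> i)"
  unfolding lev_def by (intro continuous_intros continuous_on_theta continuous_on_at_cross)

text \<open>At a common crossing time both levels use the same weights, and \<open>sg\<close>
  increases with its first index. The increase is strict at the index \<open>i\<close>, whose strand
  lies on the line and has positive weight.\<close>

lemma lev_less:
  assumes \<beta>: "\<beta> \<in> cpaths n" and ik: "i < k" "k < n" and eq: "cross \<beta> i = cross \<beta> k"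
  shows "lev n \<beta> i < lev n \<beta> k"
  unfolding lev_def eq
proof (rule sum_strict_mono_ex1)
  show "\<forall>j\<in>{..<n}. sg i j * theta (\<beta> (cross \<beta> k) j) \<le> sg k j * theta (\<beta> (cross \<beta> k) j)"
    using ik by (auto simp: sg_def intro!: mult_right_mono)
  have "0 < theta (\<beta> (cross \<beta> k) i)"
    using cross_bounds[OF \<beta>, of i] ik eq theta_kap[of "cross \<beta> k"] by simp
  then show "\<exists>j\<in>{..<n}. sg i j * theta (\<beta> (cross \<beta> k) j) < sg k j * theta (\<beta> (cross \<beta> k) j)"
    using ik by (intro bexI[of _ i]) (auto simp: sg_def)
qed simp

lemma distinct_pts_cross: "\<beta> \<in> cpaths n \<Longrightarrow> distinct_pts n (cross \<beta>) (lev n \<beta>)"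
  unfolding distinct_pts_def using cross_bounds lev_less
  by (metis less_irrefl linorder_neqE_nat)

text \<open>Positive only if one of the strands is alive when the other crosses; then the path
  determines their order.\<close>

definition overlap :: "(real \<Rightarrow> nat \<Rightarrow> real) \<Rightarrow> nat \<Rightarrow> nat \<Rightarrow> real" where
  "overlap \<beta> i k = theta (\<beta> (cross \<beta> i) k) + theta (\<beta> (cross \<beta> k) i)"

text \<open>The overlap makes this quantity independent of the order of strands that are never alive together.\<close>
definition sep_gap :: "nat \<Rightarrow> (real \<Rightarrow> nat \<Rightarrow> real) \<Rightarrow> nat \<Rightarrow> nat \<Rightarrow> real" where
  "sep_gap n \<beta> i k = max \<bar>cross \<beta> i - cross \<beta> k\<bar> (min (overlap \<beta> i k) (sg k i * (lev n \<beta> k - lev n \<beta> i)))"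

text \<open>Additional slope after which strands alive together have levels in the order of their
  positions. Admissibility only excludes equal levels.\<close>

definition extra :: "nat \<Rightarrow> (real \<Rightarrow> nat \<Rightarrow> real) \<Rightarrow> real" where
  "extra n \<beta> = (\<Sum>i<n. \<Sum>k<n. if i = k then 0 else 4 / sep_gap n \<beta> i k)"

text \<open>If the crossing times differ, the first entry of the maximum is positive. If they
  coincide, each strand is on the line when the other crosses, so the overlap is positive and
  \<open>lev_less\<close> gives the sign of the level difference.\<close>

lemma sep_gap_pos:
  assumes \<beta>: "\<beta> \<in> cpaths n" and ik: "i < n" "k < n" "i \<noteq> k"
  shows "0 < sep_gap n \<beta> i k"
proof (cases "cross \<beta> i = cross \<beta> k")
  case True
  have "0 < theta (\<beta> (cross \<beta> i) k)"
    using True cross_bounds[OF \<beta> ik(2)] theta_kap by simp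
  then have "0 < overlap \<beta> i k" by (simp add: overlap_def add_pos_nonneg)
  moreover have "0 < sg k i * (lev n \<beta> k - lev n \<beta> i)"
    using lev_less[OF \<beta>, of i k] lev_less[OF \<beta>, of k i] ik True by (cases "i < k") (auto simp: sg_def)
  ultimately show ?thesis by (simp add: sep_gap_def less_max_iff_disj)
qed (simp add: sep_gap_def less_max_iff_disj)

lemma extra_ge:
  assumes \<beta>: "\<beta> \<in> cpaths n" and ik: "i < n" "k < n" "i \<noteq> k"
  shows "4 / sep_gap n \<beta> i k \<le> extra n \<beta>"
proof -
  have "(if i = k then 0 else 4 / sep_gap n \<beta> i k) \<le> extra n \<beta>"
    unfolding extra_def
    by (rule double_sum_ge[where f = "\<lambda>i k. if i = k then 0 else 4 / sep_gap n \<beta> i k", OF _ ik(1,2)])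
      (use sep_gap_pos[OF \<beta>] in \<open>auto intro: less_imp_le\<close>)
  with ik show ?thesis by simp
qed

lemma extra_nonneg: "\<beta> \<in> cpaths n \<Longrightarrow> 0 \<le> extra n \<beta>"
  unfolding extra_def by (intro sum_nonneg) (use sep_gap_pos in \<open>auto intro: less_imp_le\<close>)

lemma continuous_on_extra: "continuous_on (cpaths n) (extra n)"
proof -
  have "continuous_on (cpaths n) (\<lambda>\<beta>. if i = k then 0 else 4 / sep_gap n \<beta> i k)" if ik: "i < n" "k < n" for i k
  proof (cases "i = k")
    case False
    have "continuous_on (cpaths n) (\<lambda>\<beta>. sep_gap n \<beta> i k)"
      unfolding sep_gap_def overlap_def using ik
      by (intro continuous_intros continuous_on_theta continuous_on_at_cross continuous_on_cross continuous_on_lev)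
    moreover have "sep_gap n \<beta> i k \<noteq> 0" if "\<beta> \<in> cpaths n" for \<beta>
      using sep_gap_pos[OF that ik False] by simp
    ultimately show ?thesis using False by (auto intro!: continuous_intros)
  qed simp
  then show ?thesis unfolding extra_def by (intro continuous_intros) auto
qed

text \<open>Crossing times depend on single strands. In the levels, a pair whose order may be
  exchanged has weight 0. In the separation, zero overlap leaves only the difference of crossing
  times.\<close>

lemma relabel_invariants:
  assumes \<beta>: "\<beta> \<in> cpaths n" and \<gamma>: "\<gamma> \<in> cpaths n" and \<pi>: "bij_betw \<pi> {..<n} {..<n}"
    and same: "\<forall>i<n. \<forall>t\<in>{0..1}. \<gamma> t (\<pi> i) = \<beta> t i"
    and order: "\<forall>i<n. \<forall>k<n. \<forall>t\<in>{0..1}. live (\<beta> t i) \<longrightarrow> live (\<beta> t k) \<longrightarrow> (i < k \<longleftrightarrow> \<pi> i < \<pi> k)"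
  shows "\<And>i. i < n \<Longrightarrow> cross \<gamma> (\<pi> i) = cross \<beta> i"
    "\<And>i. i < n \<Longrightarrow> lev n \<gamma> (\<pi> i) = lev n \<beta> i"
    "extra n \<gamma> = extra n \<beta>"
proof -
  have lt: "\<pi> i < n" if "i < n" for i using \<pi> that by (auto simp: bij_betw_def)
  have re: "(\<Sum>i<n. f i) = (\<Sum>i<n. f (\<pi> i))" for f :: "nat \<Rightarrow> real"
    using sum.reindex_bij_betw[OF \<pi>, of f] by simp
  have inj: "\<pi> i = \<pi> k \<longleftrightarrow> i = k" if "i < n" "k < n" for i k
    using \<pi> that by (auto simp: bij_betw_def inj_on_def)
  show cr: "cross \<gamma> (\<pi> i) = cross \<beta> i" if "i < n" for i
    by (rule cross_eqI[OF \<gamma> lt[OF that]], rule steep_cong[OF _ steep_cross[OF \<beta> that]])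
      (use same that in auto)
  have val: "\<gamma> (cross \<gamma> (\<pi> i)) (\<pi> k) = \<beta> (cross \<beta> i) k" if "i < n" "k < n" for i k
    using cr[OF that(1)] same that cross_bounds(3)[OF \<beta> that(1)] by simp
  have sgs: "sg (\<pi> i) (\<pi> k) = sg i k" if "i < n" "k < n" "live (\<beta> (cross \<beta> i) k)" for i k
  proof -
    have t: "cross \<beta> i \<in> {0..1}" "live (\<beta> (cross \<beta> i) i)"
      using cross_bounds[OF \<beta> that(1)] live_kap by auto
    then show ?thesis using order that by (auto simp: sg_def)
  qed
  show lv: "lev n \<gamma> (\<pi> i) = lev n \<beta> i" if "i < n" for i
    unfolding lev_def
  proof (subst re, rule sum.cong[OF refl])
    fix k assume "k \<in> {..<n}"
    then show "sg (\<pi> i) (\<pi> k) * theta (\<gamma> (cross \<gamma> (\<pi> i)) (\<pi> k)) = sg i k * theta (\<beta> (cross \<beta> i) k)"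
      using val[OF that] sgs[OF that] theta_dead by (cases "live (\<beta> (cross \<beta> i) k)") auto
  qed
  have gap: "sep_gap n \<gamma> (\<pi> i) (\<pi> k) = sep_gap n \<beta> i k" if ik: "i < n" "k < n" for i k
  proof -
    have ov: "overlap \<gamma> (\<pi> i) (\<pi> k) = overlap \<beta> i k" using val ik by (simp add: overlap_def)
    show ?thesis
    proof (cases "live (\<beta> (cross \<beta> i) k) \<or> live (\<beta> (cross \<beta> k) i)")
      case True
      \<comment> \<open>The order may be known at only one of the two crossings; antisymmetry of
        \<open>sg\<close> transfers it to the pair in either order.\<close>
      have "sg k' i' = - sg i' k'" for i' k' by (simp add: sg_def)
      then have "sg (\<pi> k) (\<pi> i) = sg k i" using True sgs[of i k] sgs[of k i] ik by metis
      then show ?thesis using ov cr lv ik by (simp add: sep_gap_def)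
    next
      case False
      then have "overlap \<beta> i k = 0" by (simp add: overlap_def theta_dead)
      then have "sep_gap n \<beta> i k = \<bar>cross \<beta> i - cross \<beta> k\<bar>" "sep_gap n \<gamma> (\<pi> i) (\<pi> k) = \<bar>cross \<gamma> (\<pi> i) - cross \<gamma> (\<pi> k)\<bar>"
        using ov by (auto simp: sep_gap_def max_def min_def)
      then show ?thesis using cr ik by simp
    qed
  qed
  have "extra n \<gamma> = (\<Sum>i<n. \<Sum>k<n. if \<pi> i = \<pi> k then 0 else 4 / sep_gap n \<gamma> (\<pi> i) (\<pi> k))"
    unfolding extra_def by (subst re, rule sum.cong[OF refl], rule re)
  also have "\<dots> = extra n \<beta>"
    unfolding extra_def by (intro sum.cong refl) (simp add: inj gap)
  finally show "extra n \<gamma> = extra n \<beta>" .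
qed

section \<open>Configurations\<close>

text \<open>With \<open>logit\<close> a homeomorphism between the line and the open unit interval,
  exchanging first coordinates of points and crossing times.\<close>

definition expit :: "real \<Rightarrow> real" where
  "expit z = 1 / (1 + exp (- z))"

definition logit :: "real \<Rightarrow> real" where
  "logit x = ln (x / (1 - x))"

lemma expit_bounds: "0 < expit z" "expit z < 1"
  by (simp_all add: expit_def add_pos_pos)

lemma logit_expit [simp]: "logit (expit z) = z"
proof -
  have "1 + exp (- z) \<noteq> 0" using exp_gt_zero[of "- z"] by linarith
  then have "expit z / (1 - expit z) = exp z"
    by (simp add: expit_def field_simps exp_minus)
  then show ?thesis by (simp add: logit_def)
qed

lemma expit_logit [simp]:
  assumes "0 < x" "x < 1" shows "expit (logit x) = x"
proof -
  have "exp (- logit x) = (1 - x) / x" using assms by (simp add: logit_def exp_minus)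
  then have "1 + exp (- logit x) = 1 / x" using assms by (simp add: field_simps)
  then show ?thesis by (simp add: expit_def)
qed

lemma expit_inj: "expit a = expit b \<longleftrightarrow> a = b"
  by (metis logit_expit)

lemma continuous_on_expit: "continuous_on A f \<Longrightarrow> continuous_on A (\<lambda>a. expit (f a))"
  unfolding expit_def
  by (intro continuous_intros) (auto simp: add_nonneg_eq_0_iff)

lemma continuous_on_logit:
  "continuous_on A f \<Longrightarrow> (\<And>a. a \<in> A \<Longrightarrow> 0 < f a \<and> f a < 1) \<Longrightarrow> continuous_on A (\<lambda>a. logit (f a))"
  unfolding logit_def by (intro continuous_intros) fastforce+

abbreviation UC :: "(nat \<times> (real \<times> real) set) topology" where
  "UC \<equiv> sum_topology UConf UNIV"

text \<open>The coproduct of the ordered configuration spaces, as a subspace of a product with the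
  discrete factor \<open>nat\<close>, so that continuity on it can be treated with
  \<open>continuous_on\<close>.\<close>

definition ord_conf :: "(nat \<times> (nat \<Rightarrow> real \<times> real)) set" where
  "ord_conf = Sigma UNIV OConf"

definition toUC :: "nat \<times> (nat \<Rightarrow> real \<times> real) \<Rightarrow> nat \<times> (real \<times> real) set" where
  "toUC p = (fst p, snd p ` {..<fst p})"

lemma topspace_quot: "topspace (quot_topology X q) = q ` topspace X"
proof -
  have "{x \<in> topspace X. q x \<in> q ` topspace X} = topspace X" by blast
  then have "openin (quot_topology X q) (q ` topspace X)" by (simp add: openin_quot_topology)
  moreover have "topspace (quot_topology X q) \<subseteq> q ` topspace X"
    using openin_topspace[of "quot_topology X q"] unfolding openin_quot_topology by blast
  ultimately show ?thesis using openin_subset by blast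
qed

lemma openin_slices:
  fixes A :: "nat \<Rightarrow> 'b::topological_space set"
  shows "openin (top_of_set (Sigma UNIV A)) W \<longleftrightarrow>
    W \<subseteq> Sigma UNIV A \<and> (\<forall>n. openin (top_of_set (A n)) {f. (n, f) \<in> W})"
proof
  assume "openin (top_of_set (Sigma UNIV A)) W"
  then obtain T where T: "open T" "W = Sigma UNIV A \<inter> T" unfolding openin_open by blast
  have "openin (top_of_set (A n)) {f. (n, f) \<in> W}" for n
  proof -
    have "open (Pair n -` T)" by (rule open_vimage[OF T(1)]) (auto intro: continuous_intros)
    moreover have "{f. (n, f) \<in> W} = A n \<inter> Pair n -` T" using T(2) by auto
    ultimately show ?thesis unfolding openin_open by blast
  qed
  with T show "W \<subseteq> Sigma UNIV A \<and> (\<forall>n. openin (top_of_set (A n)) {f. (n, f) \<in> W})" by auto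
next
  assume W: "W \<subseteq> Sigma UNIV A \<and> (\<forall>n. openin (top_of_set (A n)) {f. (n, f) \<in> W})"
  then have "\<forall>n. \<exists>T. open T \<and> {f. (n, f) \<in> W} = A n \<inter> T" unfolding openin_open by blast
  then obtain T where T: "\<And>n. open (T n)" "\<And>n. {f. (n, f) \<in> W} = A n \<inter> T n" by metis
  have "open (\<Union>n. {n} \<times> T n)" by (intro open_UN ballI open_Times T) (simp add: open_discrete)
  moreover have "W = Sigma UNIV A \<inter> (\<Union>n. {n} \<times> T n)" using W T(2) by blast
  ultimately show "openin (top_of_set (Sigma UNIV A)) W" unfolding openin_open by blast
qed

lemma topspace_UC: "topspace UC = toUC ` ord_conf"
proof -
  have "topspace (UConf n) = (\<lambda>f. f ` {..<n}) ` OConf n" for n by (simp add: UConf_def topspace_quot)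
  then show ?thesis by (auto simp: toUC_def ord_conf_def image_iff) blast+
qed

lemma quotient_map_toUC: "quotient_map (top_of_set ord_conf) UC toUC"
  unfolding quotient_map_def
proof (intro conjI allI impI)
  show "toUC ` topspace (top_of_set ord_conf) = topspace UC" unfolding topspace_UC by simp
  fix U assume U: "U \<subseteq> topspace UC"
  have "openin UC U \<longleftrightarrow> (\<forall>n. openin (top_of_set (OConf n)) {f \<in> OConf n. (n, f ` {..<n}) \<in> U})"
    using U unfolding openin_sum_topology by (auto simp: UConf_def openin_quot_topology topspace_quot)
  also have "\<dots> \<longleftrightarrow> openin (top_of_set ord_conf) {p \<in> topspace (top_of_set ord_conf). toUC p \<in> U}"
    unfolding ord_conf_def openin_slices by (auto simp: toUC_def)
  finally show "openin (top_of_set ord_conf) {p \<in> topspace (top_of_set ord_conf). toUC p \<in> U} = openin UC U" ..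
qed

lemma continuous_map_local:
  fixes A :: "'t::topological_space set"
  assumes "\<And>a. a \<in> A \<Longrightarrow> \<exists>N. openin (top_of_set A) N \<and> a \<in> N \<and> continuous_map (top_of_set N) Y h"
  shows "continuous_map (top_of_set A) Y h"
  unfolding continuous_map_def
proof (intro conjI allI impI)
  show "h \<in> topspace (top_of_set A) \<rightarrow> topspace Y"
    using assms by (fastforce simp: continuous_map_def)
  fix U assume U: "openin Y U"
  show "openin (top_of_set A) {a \<in> topspace (top_of_set A). h a \<in> U}"
  proof (subst openin_subopen, intro ballI)
    fix a assume a: "a \<in> {a \<in> topspace (top_of_set A). h a \<in> U}"
    then obtain N where N: "openin (top_of_set A) N" "a \<in> N" "continuous_map (top_of_set N) Y h"
      using assms[of a] by auto
    have "openin (top_of_set N) {b \<in> N. h b \<in> U}" using N(3) U by (auto simp: continuous_map_def)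
    then have "openin (top_of_set A) {b \<in> N. h b \<in> U}" using N(1) openin_trans by blast
    then show "\<exists>T. openin (top_of_set A) T \<and> a \<in> T \<and> T \<subseteq> {a \<in> topspace (top_of_set A). h a \<in> U}"
      using N(2) a openin_imp_subset[OF N(1)] by (intro exI[of _ "{b \<in> N. h b \<in> U}"]) auto
  qed
qed

section \<open>Descent along quotient maps\<close>

lemma descend_map:
  fixes S :: "'t::topological_space set"
  assumes q: "quotient_map (top_of_set S) Y q" and h: "continuous_map (top_of_set S) Z h"
    and inv: "\<And>x x'. x \<in> S \<Longrightarrow> x' \<in> S \<Longrightarrow> q x = q x' \<Longrightarrow> h x = h x'"
  obtains k where "continuous_map Y Z k" "\<And>x. x \<in> S \<Longrightarrow> k (q x) = h x"
proof -
  define k where "k y = h (SOME x. x \<in> S \<and> q x = y)" for y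
  have k: "k (q x) = h x" if "x \<in> S" for x
  proof -
    have "(SOME x'. x' \<in> S \<and> q x' = q x) \<in> S \<and> q (SOME x'. x' \<in> S \<and> q x' = q x) = q x"
      by (rule someI[of _ x]) (use that in simp)
    then show ?thesis unfolding k_def using inv that by blast
  qed
  have "continuous_map (top_of_set S) Z (k \<circ> q)"
    by (rule continuous_map_eq[OF h]) (simp add: k)
  then have "continuous_map Y Z k" by (rule continuous_compose_quotient_map[OF q])
  with k that show thesis by blast
qed

text \<open>Multiplying by the compact Hausdorff interval preserves quotient maps, so homotopies
  descend like maps.\<close>

lemma descend_homotopy:
  fixes S :: "'t::topological_space set"
  assumes q: "quotient_map (top_of_set S) Y q" and h: "continuous_map (top_of_set ({0..1::real} \<times> S)) Z h"
    and inv: "\<And>\<tau> x x'. x \<in> S \<Longrightarrow> x' \<in> S \<Longrightarrow> q x = q x' \<Longrightarrow> \<tau> \<in> {0..1} \<Longrightarrow> h (\<tau>, x) = h (\<tau>, x')"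
  obtains k where "continuous_map (prod_topology (top_of_set {0..1}) Y) Z k"
    "\<And>\<tau> x. \<tau> \<in> {0..1} \<Longrightarrow> x \<in> S \<Longrightarrow> k (\<tau>, q x) = h (\<tau>, x)"
proof -
  let ?q = "\<lambda>(\<tau>, x). (\<tau>, q x)" and ?I = "top_of_set {0..1::real}"
  have "quotient_map (prod_topology ?I (top_of_set S)) (prod_topology ?I Y) ?q"
  proof (rule quotient_map_prod_right[OF _ _ q])
    have "compact_space ?I" by (simp add: compact_space_subtopology)
    moreover show "Hausdorff_space ?I \<or> regular_space ?I" by (simp add: Hausdorff_space_subtopology)
    ultimately show "locally_compact_space ?I" using compact_imp_locally_compact_space by blast
  qed
  then have "quotient_map (top_of_set ({0..1} \<times> S)) (prod_topology ?I Y) ?q"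
    by (simp add: prod_topology_subtopology_eu)
  then obtain k where k: "continuous_map (prod_topology ?I Y) Z k" "\<And>p. p \<in> {0..1} \<times> S \<Longrightarrow> k (?q p) = h p"
  proof (rule descend_map[OF _ h])
    fix p p' :: "real \<times> 't" assume p: "p \<in> {0..1} \<times> S" "p' \<in> {0..1} \<times> S" "?q p = ?q p'"
    obtain \<tau> x where x: "p = (\<tau>, x)" by (cases p)
    obtain \<tau>' x' where x': "p' = (\<tau>', x')" by (cases p')
    have "\<tau>' = \<tau>" "x \<in> S" "x' \<in> S" "q x = q x'" "\<tau> \<in> {0..1}" using p by (simp_all add: x x')
    then show "h p = h p'" unfolding x x' using inv by blast
  qed (rule that)
  have "k (\<tau>, q x) = h (\<tau>, x)" if "\<tau> \<in> {0..1}" "x \<in> S" for \<tau> x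
    using k(2)[of "(\<tau>, x)"] that by simp
  then show thesis by (rule that[OF k(1)])
qed

definition conf_fun :: "nat \<Rightarrow> (real \<Rightarrow> nat \<Rightarrow> real) \<Rightarrow> nat \<Rightarrow> real \<times> real" where
  "conf_fun n \<beta> = (\<lambda>i. if i < n then (logit (cross \<beta> i), lev n \<beta> i) else 0)"

lemma conf_fun_OConf:
  assumes \<beta>: "\<beta> \<in> cpaths n" shows "conf_fun n \<beta> \<in> OConf n"
proof -
  have "inj_on (conf_fun n \<beta>) {..<n}"
  proof (rule inj_onI)
    fix i k assume ik: "i \<in> {..<n}" "k \<in> {..<n}" "conf_fun n \<beta> i = conf_fun n \<beta> k"
    then have "expit (logit (cross \<beta> i)) = expit (logit (cross \<beta> k))" "lev n \<beta> i = lev n \<beta> k"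
      by (auto simp: conf_fun_def)
    then have "cross \<beta> i = cross \<beta> k" using cross_bounds[OF \<beta>] ik by simp
    then show "i = k" using distinct_pts_cross[OF \<beta>] ik \<open>lev n \<beta> i = lev n \<beta> k\<close>
      by (auto simp: distinct_pts_def)
  qed
  then show ?thesis by (simp add: OConf_def conf_fun_def)
qed

lemma toUC_relabel:
  assumes "bij_betw \<pi> {..<n} {..<n}" "\<And>i. i < n \<Longrightarrow> f' (\<pi> i) = f i"
  shows "toUC (n, f') = toUC (n, f)"
proof -
  have "f' ` {..<n} = (\<lambda>i. f' (\<pi> i)) ` {..<n}"
    using assms(1) by (metis bij_betw_imp_surj_on image_image)
  also have "\<dots> = f ` {..<n}" using assms(2) by (intro image_cong) auto
  finally show ?thesis by (simp add: toUC_def)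
qed

lemma toUC_eqE:
  assumes f: "f \<in> OConf n" and f': "f' \<in> OConf m" and eq: "toUC (n, f) = toUC (m, f')"
  obtains \<pi> where "m = n" "bij_betw \<pi> {..<n} {..<n}" "\<And>i. i < n \<Longrightarrow> f' (\<pi> i) = f i"
proof -
  have mn: "m = n" and im: "f ` {..<n} = f' ` {..<n}" using eq by (auto simp: toUC_def)
  have b: "bij_betw f {..<n} (f ` {..<n})" "bij_betw f' {..<n} (f ` {..<n})"
    using f f' mn im by (auto simp: OConf_def bij_betw_def)
  define \<pi> where "\<pi> = inv_into {..<n} f' \<circ> f"
  have "bij_betw \<pi> {..<n} {..<n}"
    unfolding \<pi>_def by (rule bij_betw_trans[OF b(1) bij_betw_inv_into[OF b(2)]])
  moreover have "f' (\<pi> i) = f i" if "i < n" for i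
    unfolding \<pi>_def o_def by (rule f_inv_into_f) (use im that in blast)
  ultimately show thesis using that mn by blast
qed

lemma toP_eqE:
  assumes \<beta>: "\<beta> \<in> cpaths n" and \<gamma>: "\<gamma> \<in> cpaths m" and eq: "toP \<beta> = toP \<gamma>"
  obtains \<pi> where "m = n" "bij_betw \<pi> {..<n} {..<n}" "\<And>i t. i < n \<Longrightarrow> t \<in> {0..1} \<Longrightarrow> \<gamma> t (\<pi> i) = \<beta> t i"
    "\<And>i. i < n \<Longrightarrow> cross \<gamma> (\<pi> i) = cross \<beta> i" "\<And>i. i < n \<Longrightarrow> lev n \<gamma> (\<pi> i) = lev n \<beta> i"
    "extra n \<gamma> = extra n \<beta>"
proof -
  obtain \<pi> where \<pi>: "bij_betw \<pi> {..<n} {..<m}" "\<forall>i<n. \<forall>t\<in>{0..1}. \<gamma> t (\<pi> i) = \<beta> t i"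
    "\<forall>i<n. \<forall>k<n. \<forall>t\<in>{0..1}. live (\<beta> t i) \<longrightarrow> live (\<beta> t k) \<longrightarrow> (i < k \<longleftrightarrow> \<pi> i < \<pi> k)"
    using cpath_rigidity[OF assms] by blast
  have mn: "m = n" using bij_betw_same_card[OF \<pi>(1)] by simp
  note \<gamma>' = \<gamma>[unfolded mn] and \<pi>' = \<pi>(1)[unfolded mn]
  show thesis
    by (rule that[OF mn \<pi>']) (use \<pi>(2) relabel_invariants[OF \<beta> \<gamma>' \<pi>' \<pi>(2,3)] in auto)
qed

section \<open>The two comparison maps\<close>

definition conf_of :: "(real \<Rightarrow> nat \<Rightarrow> real) \<Rightarrow> nat \<times> (nat \<Rightarrow> real \<times> real)" where
  "conf_of \<beta> = (deg \<beta>, conf_fun (deg \<beta>) \<beta>)"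

lemma conf_of_cpaths: "\<beta> \<in> cpaths n \<Longrightarrow> conf_of \<beta> = (n, conf_fun n \<beta>)"
  by (simp add: conf_of_def deg_cpaths)

lemma continuous_on_conf_fun: "continuous_on (cpaths n) (conf_fun n)"
proof (rule continuous_on_into_fun)
  fix i show "continuous_on (cpaths n) (\<lambda>\<beta>. conf_fun n \<beta> i)"
    unfolding conf_fun_def
    by (cases "i < n")
      (auto intro!: continuous_on_Pair continuous_on_logit continuous_on_cross continuous_on_lev simp: cross_bounds)
qed

lemma continuous_conf_of: "continuous_map (top_of_set all_cpaths) (top_of_set ord_conf) conf_of"
proof (rule continuous_map_local)
  fix \<beta> assume "\<beta> \<in> all_cpaths"
  then obtain n where \<beta>: "\<beta> \<in> cpaths n" by (auto simp: all_cpaths_def)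
  have "continuous_on (cpaths n) (\<lambda>\<beta>. (n, conf_fun n \<beta>))"
    by (intro continuous_on_Pair continuous_on_const continuous_on_conf_fun)
  then have "continuous_map (top_of_set (cpaths n)) (top_of_set ord_conf) (\<lambda>\<beta>. (n, conf_fun n \<beta>))"
    using conf_fun_OConf by (auto simp: continuous_map_in_subtopology ord_conf_def)
  then have "continuous_map (top_of_set (cpaths n)) (top_of_set ord_conf) conf_of"
    by (rule continuous_map_eq) (simp add: conf_of_cpaths)
  then show "\<exists>N. openin (top_of_set all_cpaths) N \<and> \<beta> \<in> N \<and> continuous_map (top_of_set N) (top_of_set ord_conf) conf_of"
    using \<beta> openin_cpaths by blast
qed

lemma conf_of_toP:
  assumes "\<beta> \<in> all_cpaths" "\<gamma> \<in> all_cpaths" "toP \<beta> = toP \<gamma>"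
  shows "toUC (conf_of \<beta>) = toUC (conf_of \<gamma>)"
proof -
  obtain n m where B: "\<beta> \<in> cpaths n" "\<gamma> \<in> cpaths m" using assms by (auto simp: all_cpaths_def)
  obtain \<pi> where \<pi>: "m = n" "bij_betw \<pi> {..<n} {..<n}"
    "\<And>i. i < n \<Longrightarrow> cross \<gamma> (\<pi> i) = cross \<beta> i" "\<And>i. i < n \<Longrightarrow> lev n \<gamma> (\<pi> i) = lev n \<beta> i"
    using toP_eqE[OF B assms(3)] by metis
  have "\<pi> i < n" if "i < n" for i using \<pi>(2) that by (auto simp: bij_betw_def)
  then have "toUC (n, conf_fun n \<gamma>) = toUC (n, conf_fun n \<beta>)"
    by (intro toUC_relabel[OF \<pi>(2)]) (simp add: conf_fun_def \<pi>(3,4))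
  then show ?thesis using conf_of_cpaths[OF B(1)] conf_of_cpaths[OF B(2)] \<pi>(1) by simp
qed

definition cx :: "(nat \<Rightarrow> real \<times> real) \<Rightarrow> nat \<Rightarrow> real" where
  "cx f i = expit (fst (f i))"

definition cy :: "(nat \<Rightarrow> real \<times> real) \<Rightarrow> nat \<Rightarrow> real" where
  "cy f i = snd (f i)"

definition conf_slope :: "nat \<Rightarrow> (nat \<Rightarrow> real \<times> real) \<Rightarrow> real" where
  "conf_slope n f = slope n (cx f) (cy f)"

text \<open>The heights \<open>(t - x) / 2\<close> grow at the minimal rate 1/2. With
  \<open>lam = 1\<close> they would exactly cancel the descent of the line; all steepness comes from
  the slope.\<close>

definition conf_path :: "nat \<times> (nat \<Rightarrow> real \<times> real) \<Rightarrow> real \<Rightarrow> ((nat \<times> nat) \<times> (nat \<Rightarrow> real)) set" where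
  "conf_path p = ramp_path_of (fst p) (conf_slope (fst p) (snd p)) (\<lambda>i t. (t - cx (snd p) i) / 2) (cy (snd p))"

lemma distinct_pts_conf: "f \<in> OConf n \<Longrightarrow> distinct_pts n (cx f) (cy f)"
  unfolding distinct_pts_def cx_def cy_def expit_inj
  by (auto simp: expit_bounds OConf_def inj_on_def prod_eq_iff)

lemma admissible_conf: "f \<in> OConf n \<Longrightarrow> admissible n (conf_slope n f) (cx f) (cy f)"
  unfolding conf_slope_def by (intro admissible_slope distinct_pts_conf)

lemma steep_cx: "steep (\<lambda>t. (t - cx f i) / 2) (cx f i)"
  by (rule steep_line) (simp_all add: cx_def expit_bounds)

lemma openin_conf_piece: "openin (top_of_set ord_conf) ({n} \<times> OConf n)"
  unfolding ord_conf_def openin_slices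
proof (intro conjI allI)
  fix m have "{f. (m, f) \<in> {n} \<times> OConf n} = (if m = n then OConf n else {})" by auto
  then show "openin (top_of_set (OConf m)) {f. (m, f) \<in> {n} \<times> OConf n}" by simp
qed auto

lemma continuous_on_snd_coord:
  fixes A :: "('a::topological_space \<times> ('i \<Rightarrow> 'b::topological_space)) set"
  shows "continuous_on A (\<lambda>p. snd p i)"
  by (rule continuous_on_coord) (rule continuous_on_snd[OF continuous_on_id])

lemma continuous_on_cx: "continuous_on A (\<lambda>p. f p i) \<Longrightarrow> continuous_on A (\<lambda>p. cx (f p) i)"
  and continuous_on_cy: "continuous_on A (\<lambda>p. f p i) \<Longrightarrow> continuous_on A (\<lambda>p. cy (f p) i)"
  unfolding cx_def cy_def by (intro continuous_on_expit continuous_intros; assumption)+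

lemma continuous_on_conf_slope:
  assumes "\<And>i. i < n \<Longrightarrow> continuous_on A (\<lambda>p. f p i)" "\<And>p. p \<in> A \<Longrightarrow> f p \<in> OConf n"
  shows "continuous_on A (\<lambda>p. conf_slope n (f p))"
  unfolding conf_slope_def
  by (intro continuous_slope continuous_on_cx continuous_on_cy distinct_pts_conf assms)

lemma continuous_conf_path: "continuous_map (top_of_set ord_conf) PP conf_path"
proof (rule continuous_map_local)
  fix p assume "p \<in> ord_conf"
  then obtain n where p: "p \<in> {n} \<times> OConf n" by (auto simp: ord_conf_def)
  let ?N = "{n} \<times> OConf n"
  have "continuous_map (top_of_set ?N) PP
    (\<lambda>p. ramp_path_of n (conf_slope n (snd p)) (\<lambda>i t. (t - cx (snd p) i) / 2) (cy (snd p)))"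
  proof (rule continuous_ramp_path_of[where x = "\<lambda>p. cx (snd p)"])
    show "continuous_on ?N (\<lambda>p. conf_slope n (snd p))"
      by (intro continuous_on_conf_slope continuous_on_snd_coord) auto
    show "continuous_on (?N \<times> {0..1}) (\<lambda>(a, t). (t - cx (snd a) i) / 2)" for i
    proof -
      have "continuous_on (?N \<times> {0..1::real}) (\<lambda>p. cx (snd (fst p)) i)"
        by (rule continuous_on_compose2[of ?N "\<lambda>p. cx (snd p) i"])
          (auto intro!: continuous_on_cx continuous_on_snd_coord continuous_intros)
      then show ?thesis unfolding case_prod_unfold by (intro continuous_intros) auto
    qed
  qed (auto intro!: continuous_on_cx continuous_on_cy continuous_on_snd_coord admissible_conf steep_cx)
  then have "continuous_map (top_of_set ?N) PP conf_path"
    by (rule continuous_map_eq) (auto simp: conf_path_def)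
  then show "\<exists>N. openin (top_of_set ord_conf) N \<and> p \<in> N \<and> continuous_map (top_of_set N) PP conf_path"
    using p openin_conf_piece by blast
qed

lemma conf_path_toUC:
  assumes "p \<in> ord_conf" "q \<in> ord_conf" "toUC p = toUC q" shows "conf_path p = conf_path q"
proof -
  obtain n f m f' where p: "p = (n, f)" "q = (m, f')" "f \<in> OConf n" "f' \<in> OConf m"
    using assms by (auto simp: ord_conf_def)
  obtain \<pi> where \<pi>: "m = n" "bij_betw \<pi> {..<n} {..<n}" "\<And>i. i < n \<Longrightarrow> f' (\<pi> i) = f i"
    using toUC_eqE[OF p(3,4)] assms(3) p by blast
  have eq: "conf_slope n f' = conf_slope n f"
    unfolding conf_slope_def by (rule slope_relabel[OF \<pi>(2)]) (simp_all add: cx_def cy_def \<pi>(3))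
  have "ramp_path_of n (conf_slope n f) (\<lambda>i t. (t - cx f' i) / 2) (cy f') =
      ramp_path_of n (conf_slope n f) (\<lambda>i t. (t - cx f i) / 2) (cy f)"
    by (rule ramp_path_of_relabel[OF \<pi>(2) admissible_conf[OF p(3)]]) (auto simp: cx_def cy_def \<pi>(3) steep_cx[unfolded cx_def])
  then show ?thesis using eq p \<pi>(1) by (simp add: conf_path_def)
qed

section \<open>Homotopy from the identity of the path space\<close>

text \<open>The coordinates keep their order in the lift instead of being sorted by level; only the
  slope changes.\<close>

definition steepened :: "nat \<Rightarrow> real \<Rightarrow> (real \<Rightarrow> nat \<Rightarrow> real) \<Rightarrow> real \<Rightarrow> ((nat \<times> nat) \<times> (nat \<Rightarrow> real)) set" where
  "steepened n lam \<beta> = (\<lambda>t\<in>{0..1}. zpt n (arrange n (ramps n lam (\<lambda>i t. \<beta> t i - kap t) t) [0..<n]))"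

lemma steepened_in_PP:
  assumes \<beta>: "\<beta> \<in> cpaths n" and lam: "1 \<le> lam" shows "steepened n lam \<beta> \<in> topspace PP"
proof -
  let ?\<gamma> = "list_path n (ramps n lam (\<lambda>i t. \<beta> t i - kap t)) [0..<n]"
  have \<gamma>: "?\<gamma> \<in> cpaths n"
  proof (rule list_path_cpaths)
    fix i assume i: "i < n"
    show "continuous_on {0..1} (\<lambda>t. ramps n lam (\<lambda>i t. \<beta> t i - kap t) t i)"
      "mono_on {0..1} (\<lambda>t. ramps n lam (\<lambda>i t. \<beta> t i - kap t) t i)"
      unfolding ramps_def using ramp_mono[OF steep_cross[OF \<beta> i] lam] by auto
    show "ramps n lam (\<lambda>i t. \<beta> t i - kap t) 0 i = 0" "ramps n lam (\<lambda>i t. \<beta> t i - kap t) 1 i = 1"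
      using lam cpathsD(4,5)[OF \<beta> i] by (auto simp: ramps_def ramp_def kap_def)
  qed auto
  have "steepened n lam \<beta> = toP ?\<gamma>"
    unfolding steepened_def toP_def deg_cpaths[OF \<gamma>] by (intro restrict_ext) (simp add: list_path_def)
  then show ?thesis using toP_in_PP[OF \<gamma>] by simp
qed

lemma filter_live_map:
  "\<lbrakk>set l \<subseteq> {0..1}; \<not> live (\<phi> 0); \<not> live (\<phi> 1)\<rbrakk> \<Longrightarrow> filter live (map \<phi> l) = filter live (map \<phi> (filter live l))"
  by (induction l) (auto simp: live_dead[simplified])

text \<open>Steepening applies to each letter a function that keeps 0 and 1 dead, so the new word is
  a function of the old word and the time. Hence it does not depend on the chosen lift.\<close>

lemma word_steepened:
  assumes \<beta>: "\<beta> \<in> cpaths n" and lam: "1 \<le> lam" and t: "t \<in> {0..1}"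
  shows "word n (arrange n (ramps n lam (\<lambda>i t. \<beta> t i - kap t) t) [0..<n]) =
    filter live (map (\<lambda>v. ramp lam (v - kap t) t) (word n (\<beta> t)))"
proof -
  have k: "0 \<le> kap t" "kap t \<le> 1" using kap_bounds[OF t] by auto
  have "coords n (arrange n (ramps n lam (\<lambda>i t. \<beta> t i - kap t) t) [0..<n]) =
      map (\<lambda>v. ramp lam (v - kap t) t) (coords n (\<beta> t))"
    by (auto simp: coords_def arrange_def ramps_def)
  moreover have "kap t + lam * (0 - kap t) \<le> 0" using mult_right_mono[OF lam k(1)] by (simp add: algebra_simps)
  moreover have "1 \<le> kap t + lam * (1 - kap t)" using mult_right_mono[OF lam, of "1 - kap t"] k by (simp add: algebra_simps)
  ultimately show ?thesis
    unfolding word_def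
    by (simp only:) (rule filter_live_map, rule set_coords[OF cpathsD(1)[OF \<beta> t]], auto simp: ramp_def live_def)
qed

lemma steepened_cong:
  assumes \<beta>: "\<beta> \<in> cpaths n" and \<gamma>: "\<gamma> \<in> cpaths n" and eq: "toP \<beta> = toP \<gamma>" and lam: "1 \<le> lam"
  shows "steepened n lam \<beta> = steepened n lam \<gamma>"
  unfolding steepened_def
proof (rule restrict_ext)
  fix t :: real assume t: "t \<in> {0..1}"
  have "word n (\<beta> t) = word n (\<gamma> t)"
    using eq toP_apply[OF \<beta> t] toP_apply[OF \<gamma> t] wof_zpt by metis
  moreover have "arrange n (ramps n lam g t) [0..<n] \<in> cube n" for g
    by (rule arrange_cube) (auto simp: ramps_def)
  ultimately show "zpt n (arrange n (ramps n lam (\<lambda>i t. \<beta> t i - kap t) t) [0..<n]) =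
      zpt n (arrange n (ramps n lam (\<lambda>i t. \<gamma> t i - kap t) t) [0..<n])"
    using word_steepened[OF \<beta> lam t] word_steepened[OF \<gamma> lam t] zpt_eq_iff by simp
qed

definition full_slope :: "nat \<Rightarrow> (real \<Rightarrow> nat \<Rightarrow> real) \<Rightarrow> real" where
  "full_slope n \<beta> = slope n (cross \<beta>) (lev n \<beta>) + extra n \<beta>"

lemma admissible_cross: "\<beta> \<in> cpaths n \<Longrightarrow> admissible n (slope n (cross \<beta>) (lev n \<beta>)) (cross \<beta>) (lev n \<beta>)"
  by (intro admissible_slope distinct_pts_cross)

lemma full_slope_ge_1: "\<beta> \<in> cpaths n \<Longrightarrow> 1 \<le> full_slope n \<beta>"
  using admissible_cross[of \<beta> n] extra_nonneg[of \<beta> n] by (simp add: full_slope_def admissible_def)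

lemma continuous_on_slope_cross: "continuous_on (cpaths n) (\<lambda>\<beta>. slope n (cross \<beta>) (lev n \<beta>))"
  by (intro continuous_slope continuous_on_cross continuous_on_lev distinct_pts_cross)

definition steepen_homotopy :: "real \<times> (real \<Rightarrow> nat \<Rightarrow> real) \<Rightarrow> real \<Rightarrow> ((nat \<times> nat) \<times> (nat \<Rightarrow> real)) set" where
  "steepen_homotopy p = (let n = deg (snd p) in
     steepened n (1 + fst p * (full_slope n (snd p) - 1)) (snd p))"

text \<open>Heights are interpolated linearly to \<open>(t - x) / 2\<close> with crossing times and
  levels fixed. The extra slope, needed at the start to match the order of positions, is removed on
  the way; admissibility survives because \<open>extra\<close> is nonnegative.\<close>

definition straighten_homotopy :: "real \<times> (real \<Rightarrow> nat \<Rightarrow> real) \<Rightarrow> real \<Rightarrow> ((nat \<times> nat) \<times> (nat \<Rightarrow> real)) set" where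
  "straighten_homotopy p = (let n = deg (snd p); \<tau> = fst p; \<beta> = snd p in
     ramp_path_of n (slope n (cross \<beta>) (lev n \<beta>) + (1 - \<tau>) * extra n \<beta>)
       (\<lambda>i t. (1 - \<tau>) * (\<beta> t i - kap t) + \<tau> * ((t - cross \<beta> i) / 2)) (lev n \<beta>))"

lemma openin_cylinder_piece:
  "openin (top_of_set ({0..1::real} \<times> all_cpaths)) ({0..1} \<times> cpaths n)"
  by (simp add: openin_Times openin_cpaths)

lemma continuous_on_eval_cylinder:
  "continuous_on (({0..1::real} \<times> cpaths n) \<times> {0..1}) (\<lambda>q. snd (fst q) (snd q) i)"
proof -
  have "continuous_on (({0..1::real} \<times> cpaths n) \<times> {0..1}) (\<lambda>q. (\<lambda>(\<beta>, t). \<beta> t i) (snd (fst q), snd q))"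
    by (rule continuous_on_compose2[OF continuous_on_eval[of n]])
      (intro continuous_on_Pair continuous_on_snd continuous_on_fst continuous_on_id, auto)
  then show ?thesis by simp
qed

lemma continuous_on_snd_comp:
  "continuous_on B f \<Longrightarrow> continuous_on (A \<times> B) (\<lambda>p. f (snd p))"
  by (rule continuous_on_compose2[of B f]) (auto intro!: continuous_intros)

lemma continuous_on_fst_comp:
  "continuous_on A f \<Longrightarrow> continuous_on (A \<times> B) (\<lambda>p. f (fst p))"
  by (rule continuous_on_compose2[of A f]) (auto intro!: continuous_intros)

lemma steepen_slope_ge_1:
  assumes "\<beta> \<in> cpaths n" "0 \<le> \<tau>" shows "1 \<le> 1 + \<tau> * (full_slope n \<beta> - 1)"
  using full_slope_ge_1[OF assms(1)] assms(2) by simp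

lemma continuous_on_ramp:
  "continuous_on A l \<Longrightarrow> continuous_on A v \<Longrightarrow> continuous_on A t \<Longrightarrow> continuous_on A (\<lambda>a. ramp (l a) (v a) (t a))"
  unfolding ramp_def kap_def by (intro continuous_intros) auto

lemma continuous_steepen:
  "continuous_map (top_of_set ({0..1} \<times> all_cpaths)) PP steepen_homotopy"
proof (rule continuous_map_local)
  fix p :: "real \<times> _" assume "p \<in> {0..1} \<times> all_cpaths"
  then obtain n where p: "p \<in> {0..1} \<times> cpaths n" by (auto simp: all_cpaths_def)
  let ?N = "{0..1::real} \<times> cpaths n" and ?lam = "\<lambda>p. 1 + fst p * (full_slope n (snd p) - 1)"
  have lam: "continuous_on ?N ?lam"
    unfolding full_slope_def
    by (intro continuous_intros continuous_on_snd_comp continuous_on_slope_cross continuous_on_extra)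
  have "continuous_map (top_of_set ?N) PP (\<lambda>p. steepened n (?lam p) (snd p))"
  proof (rule continuous_into_PP)
    have "continuous_map (top_of_set (?N \<times> {0..1})) ZZ
      (\<lambda>q. zpt n (arrange n (ramps n (?lam (fst q)) (\<lambda>i t. snd (fst q) t i - kap t) (snd q)) [0..<n]))"
    proof -
      let ?v = "\<lambda>q. arrange n (ramps n (?lam (fst q)) (\<lambda>i t. snd (fst q) t i - kap t) (snd q)) [0..<n]"
      have "continuous_on (?N \<times> {0..1}) ?v"
      proof (rule continuous_on_arrange)
        fix i assume "i < n"
        have l: "continuous_on (?N \<times> {0..1::real}) (\<lambda>q. ?lam (fst q))" by (rule continuous_on_fst_comp[OF lam])
        have v: "continuous_on (?N \<times> {0..1::real}) (\<lambda>q. snd (fst q) (snd q) i - kap (snd q))"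
          using continuous_on_eval_cylinder[of n i] unfolding kap_def by (intro continuous_intros) auto
        show "continuous_on (?N \<times> {0..1}) (\<lambda>q. ramps n (?lam (fst q)) (\<lambda>i t. snd (fst q) t i - kap t) (snd q) i)"
          unfolding ramps_def by (rule continuous_on_ramp[OF l v]) (intro continuous_intros)
      qed auto
      moreover have "?v q \<in> cube n" for q by (rule arrange_cube) (auto simp: ramps_def)
      ultimately have "continuous_map (top_of_set (?N \<times> {0..1})) (top_of_set (cube n)) ?v"
        by (auto simp: continuous_map_in_subtopology)
      from continuous_map_compose[OF this continuous_zpt] show ?thesis by (simp add: o_def)
    qed
    then show "continuous_map (top_of_set (?N \<times> {0..1})) ZZ (\<lambda>(p, t). steepened n (?lam p) (snd p) t)"
      by (rule continuous_map_eq) (auto simp: steepened_def)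
    show "steepened n (?lam p) (snd p) \<in> topspace PP" if "p \<in> ?N" for p
      using that steepened_in_PP steepen_slope_ge_1 by auto
  qed
  then have "continuous_map (top_of_set ?N) PP steepen_homotopy"
    by (rule continuous_map_eq) (auto simp: steepen_homotopy_def deg_cpaths)
  then show "\<exists>N. openin (top_of_set ({0..1} \<times> all_cpaths)) N \<and> p \<in> N \<and> continuous_map (top_of_set N) PP steepen_homotopy"
    using p openin_cylinder_piece by blast
qed

lemma continuous_straighten:
  "continuous_map (top_of_set ({0..1} \<times> all_cpaths)) PP straighten_homotopy"
proof (rule continuous_map_local)
  fix p :: "real \<times> _" assume "p \<in> {0..1} \<times> all_cpaths"
  then obtain n where p: "p \<in> {0..1} \<times> cpaths n" by (auto simp: all_cpaths_def)
  let ?N = "{0..1::real} \<times> cpaths n"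
  have "continuous_map (top_of_set ?N) PP (\<lambda>p. ramp_path_of n
     (slope n (cross (snd p)) (lev n (snd p)) + (1 - fst p) * extra n (snd p))
     (\<lambda>i t. (1 - fst p) * (snd p t i - kap t) + fst p * ((t - cross (snd p) i) / 2)) (lev n (snd p)))"
  proof (rule continuous_ramp_path_of[where x = "\<lambda>p. cross (snd p)"])
    fix p assume p: "p \<in> ?N"
    then have \<beta>: "snd p \<in> cpaths n" by auto
    have "0 \<le> (1 - fst p) * extra n (snd p)" using p extra_nonneg[OF \<beta>] by auto
    then show "admissible n (slope n (cross (snd p)) (lev n (snd p)) + (1 - fst p) * extra n (snd p))
        (cross (snd p)) (lev n (snd p))"
      by (intro admissible_mono[OF admissible_cross[OF \<beta>]]) simp
    show "steep (\<lambda>t. (1 - fst p) * (snd p t i - kap t) + fst p * ((t - cross (snd p) i) / 2)) (cross (snd p) i)"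
      if "i < n" for i
      using steep_combination[OF steep_cross[OF \<beta> that]] p by auto
  next
    show "continuous_on ?N (\<lambda>p. slope n (cross (snd p)) (lev n (snd p)) + (1 - fst p) * extra n (snd p))"
      by (intro continuous_intros continuous_on_snd_comp continuous_on_slope_cross continuous_on_extra)
  next
    fix i assume i: "i < n"
    show cr: "continuous_on ?N (\<lambda>p. cross (snd p) i)"
      by (rule continuous_on_snd_comp[OF continuous_on_cross[OF i]])
    show "continuous_on ?N (\<lambda>p. lev n (snd p) i)"
      by (rule continuous_on_snd_comp[OF continuous_on_lev[OF i]])
    have "continuous_on (?N \<times> {0..1::real}) (\<lambda>q. cross (snd (fst q)) i)"
      by (rule continuous_on_fst_comp[OF cr])
    then show "continuous_on (?N \<times> {0..1}) (\<lambda>(p, t). (1 - fst p) * (snd p t i - kap t) + fst p * ((t - cross (snd p) i) / 2))"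
      using continuous_on_eval_cylinder[of n i] unfolding case_prod_unfold kap_def
      by (intro continuous_intros) auto
  qed
  then have "continuous_map (top_of_set ?N) PP straighten_homotopy"
    by (rule continuous_map_eq) (auto simp: straighten_homotopy_def deg_cpaths)
  then show "\<exists>N. openin (top_of_set ({0..1} \<times> all_cpaths)) N \<and> p \<in> N \<and> continuous_map (top_of_set N) PP straighten_homotopy"
    using p openin_cylinder_piece by blast
qed

lemma homotopies_toP:
  assumes "\<beta> \<in> all_cpaths" "\<gamma> \<in> all_cpaths" "toP \<beta> = toP \<gamma>" and \<tau>: "\<tau> \<in> {0..1}"
  shows "steepen_homotopy (\<tau>, \<beta>) = steepen_homotopy (\<tau>, \<gamma>)"
    "straighten_homotopy (\<tau>, \<beta>) = straighten_homotopy (\<tau>, \<gamma>)"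
proof -
  obtain n m where B: "\<beta> \<in> cpaths n" "\<gamma> \<in> cpaths m" using assms by (auto simp: all_cpaths_def)
  obtain \<pi> where \<pi>: "m = n" "bij_betw \<pi> {..<n} {..<n}" "\<And>i t. i < n \<Longrightarrow> t \<in> {0..1} \<Longrightarrow> \<gamma> t (\<pi> i) = \<beta> t i"
    "\<And>i. i < n \<Longrightarrow> cross \<gamma> (\<pi> i) = cross \<beta> i" "\<And>i. i < n \<Longrightarrow> lev n \<gamma> (\<pi> i) = lev n \<beta> i"
    "extra n \<gamma> = extra n \<beta>"
    using toP_eqE[OF B assms(3)] by blast
  note G = B(2)[unfolded \<pi>(1)]
  have sl: "slope n (cross \<gamma>) (lev n \<gamma>) = slope n (cross \<beta>) (lev n \<beta>)"
    by (rule slope_relabel[OF \<pi>(2)]) (use \<pi> in auto)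
  have dg: "deg \<beta> = n" "deg \<gamma> = n" using deg_cpaths B(1) G by auto
  have "1 \<le> 1 + \<tau> * (full_slope n \<beta> - 1)" using steepen_slope_ge_1[OF B(1)] \<tau> by simp
  then show "steepen_homotopy (\<tau>, \<beta>) = steepen_homotopy (\<tau>, \<gamma>)"
    using steepened_cong[OF B(1) G assms(3)] sl \<pi>(6) by (simp add: steepen_homotopy_def dg full_slope_def)
  let ?lam = "slope n (cross \<beta>) (lev n \<beta>) + (1 - \<tau>) * extra n \<beta>"
  have "0 \<le> (1 - \<tau>) * extra n \<beta>" using \<tau> extra_nonneg[OF B(1)] by auto
  then have adm: "admissible n ?lam (cross \<beta>) (lev n \<beta>)"
    by (intro admissible_mono[OF admissible_cross[OF B(1)]]) simp
  have "ramp_path_of n ?lam (\<lambda>i t. (1 - \<tau>) * (\<gamma> t i - kap t) + \<tau> * ((t - cross \<gamma> i) / 2)) (lev n \<gamma>) =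
    ramp_path_of n ?lam (\<lambda>i t. (1 - \<tau>) * (\<beta> t i - kap t) + \<tau> * ((t - cross \<beta> i) / 2)) (lev n \<beta>)"
    by (rule ramp_path_of_relabel[OF \<pi>(2) adm])
      (use \<pi> \<tau> steep_combination[OF steep_cross[OF B(1)]] in auto)
  then show "straighten_homotopy (\<tau>, \<beta>) = straighten_homotopy (\<tau>, \<gamma>)"
    using sl \<pi>(6) by (simp add: straighten_homotopy_def dg)
qed

lemma arrange_upt: "arrange n u [0..<n] = (\<lambda>j. if j < n then u j else 0)"
  by (auto simp: arrange_def)

text \<open>At slope 1 the line cancels, and clamping to [0,1] does not change the strand.\<close>

lemma steepen_0:
  assumes \<beta>: "\<beta> \<in> cpaths n" shows "steepen_homotopy (0, \<beta>) = toP \<beta>"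
proof -
  have "arrange n (ramps n 1 (\<lambda>i t. \<beta> t i - kap t) t) [0..<n] = \<beta> t" if t: "t \<in> {0..1}" for t
    using cpathsD(7,8,9)[OF \<beta> t] by (auto simp: arrange_upt ramps_def ramp_def fun_eq_iff)
  then have "steepened n 1 \<beta> = toP \<beta>"
    unfolding steepened_def toP_def deg_cpaths[OF \<beta>] by (intro restrict_ext) simp
  then show ?thesis by (simp add: steepen_homotopy_def deg_cpaths[OF \<beta>])
qed

text \<open>At the full slope two strands alive at the same time have levels in the order of their positions.\<close>
lemma steepen_1_straighten_0:
  assumes \<beta>: "\<beta> \<in> cpaths n" shows "steepen_homotopy (1, \<beta>) = straighten_homotopy (0, \<beta>)"
proof -
  let ?lam = "full_slope n \<beta>" and ?g = "\<lambda>i t. \<beta> t i - kap t"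
  have "zpt n (arrange n (ramps n ?lam ?g t) [0..<n]) = ordered_pt n (ramps n ?lam ?g t) (lev n \<beta>)"
    if t: "t \<in> {0..1}" for t
  proof (rule ordered_pt_eq[symmetric])
    show "sorted_wrt (\<lambda>i k. lev n \<beta> i < lev n \<beta> k) (filter (\<lambda>i. live (ramps n ?lam ?g t i)) [0..<n])"
    proof (rule sorted_wrt_live[where R = "(<)" and n = n])
      fix i k assume ik: "i < n" "k < n" "i < k" "live (ramps n ?lam ?g t i)" "live (ramps n ?lam ?g t k)"
      have pos: "0 < sep_gap n \<beta> i k" using sep_gap_pos[OF \<beta> ik(1,2)] ik(3) by simp
      have "?lam * \<bar>cross \<beta> i - cross \<beta> k\<bar> < 4"
        using ramp_live_pair[OF steep_cross[OF \<beta> ik(1)] steep_cross[OF \<beta> ik(2)] t, of ?lam] ik full_slope_ge_1[OF \<beta>]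
        by (simp add: ramps_def)
      moreover have "4 / sep_gap n \<beta> i k \<le> ?lam"
        using extra_ge[OF \<beta> ik(1,2)] ik(3) admissible_cross[OF \<beta>] by (simp add: full_slope_def admissible_def)
      then have "4 \<le> ?lam * sep_gap n \<beta> i k" using pos by (simp add: pos_divide_le_eq)
      \<comment> \<open>Alive together, the strands cross too close for the difference of crossing
        times to attain the maximum in \<open>sep_gap\<close>; the entry with the level difference
        must be the positive one.\<close>
      ultimately have "?lam * \<bar>cross \<beta> i - cross \<beta> k\<bar> < ?lam * sep_gap n \<beta> i k" by linarith
      then have "\<bar>cross \<beta> i - cross \<beta> k\<bar> < sep_gap n \<beta> i k"
        using full_slope_ge_1[OF \<beta>] by (simp add: mult_less_cancel_left)
      then have "0 < sg k i * (lev n \<beta> k - lev n \<beta> i)"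
        using pos by (auto simp: sep_gap_def max_def min_def split: if_splits)
      then show "lev n \<beta> i < lev n \<beta> k" using ik(3) by (simp add: sg_def)
    qed auto
  qed (auto simp: ramps_def)
  then have "steepened n ?lam \<beta> = ramp_path_of n ?lam ?g (lev n \<beta>)"
    unfolding steepened_def ramp_path_of_def by (intro restrict_ext)
  then show ?thesis
    by (simp add: steepen_homotopy_def straighten_homotopy_def deg_cpaths[OF \<beta>] full_slope_def)
qed

lemma straighten_1:
  assumes \<beta>: "\<beta> \<in> cpaths n" shows "straighten_homotopy (1, \<beta>) = conf_path (conf_of \<beta>)"
proof -
  \<comment> \<open>The identity serves as a relabelling, because
    \<open>cx (conf_fun n \<beta>)\<close> and \<open>cross \<beta>\<close> are only known to agree
    at indices below \<open>n\<close>.\<close>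
  have id: "bij_betw (\<lambda>i. i) {..<n} {..<n}" by (simp add: bij_betw_def)
  have cx: "cx (conf_fun n \<beta>) i = cross \<beta> i" and cy: "cy (conf_fun n \<beta>) i = lev n \<beta> i" if "i < n" for i
    using cross_bounds[OF \<beta> that] that by (auto simp: cx_def cy_def conf_fun_def)
  have "conf_slope n (conf_fun n \<beta>) = slope n (cross \<beta>) (lev n \<beta>)"
    unfolding conf_slope_def by (rule slope_relabel[OF id]) (auto simp: cx cy)
  moreover have "ramp_path_of n (slope n (cross \<beta>) (lev n \<beta>)) (\<lambda>i t. (t - cx (conf_fun n \<beta>) i) / 2) (cy (conf_fun n \<beta>)) =
      ramp_path_of n (slope n (cross \<beta>) (lev n \<beta>)) (\<lambda>i t. (t - cross \<beta> i) / 2) (lev n \<beta>)"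
    by (rule ramp_path_of_relabel[OF id admissible_cross[OF \<beta>]]) (auto simp: cx cy intro!: steep_line cross_bounds[OF \<beta>])
  ultimately show ?thesis
    by (simp add: straighten_homotopy_def deg_cpaths[OF \<beta>] conf_of_cpaths[OF \<beta>] conf_path_def)
qed

section \<open>Homotopy from the identity of the configuration space\<close>

text \<open>The levels obtained after passing to strands and back, in the original labels: the sign
  of the level difference stands for the order of positions after sorting.\<close>

definition new_lev :: "nat \<Rightarrow> (nat \<Rightarrow> real \<times> real) \<Rightarrow> nat \<Rightarrow> real" where
  "new_lev n f i = (\<Sum>k<n. sgn (cy f i - cy f k) * theta (ramp (conf_slope n f) ((cx f i - cx f k) / 2) (cx f i)))"

lemma cx_in: "cx f i \<in> {0..1}"
  using expit_bounds[of "fst (f i)"] by (simp add: cx_def)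

text \<open>At its own crossing time strand \<open>i\<close> is alive; were strand \<open>k\<close>
  alive too, their crossing times would be closer than admissibility permits at equal level.\<close>

lemma conf_dead:
  assumes f: "f \<in> OConf n" and ik: "i < n" "k < n" "i \<noteq> k" "cy f i = cy f k"
  shows "\<not> live (ramp (conf_slope n f) ((cx f i - cx f k) / 2) (cx f i))"
proof
  assume l: "live (ramp (conf_slope n f) ((cx f i - cx f k) / 2) (cx f i))"
  have lam: "1 \<le> conf_slope n f" "4 < conf_slope n f * \<bar>cx f i - cx f k\<bar>"
    using admissible_conf[OF f] ik by (auto simp: admissible_def)
  have "live (ramp (conf_slope n f) ((cx f i - cx f i) / 2) (cx f i))"
    using ramp_zero[OF cx_in] live_kap[OF cx_in] by simp
  then show False
    using ramp_live_pair[OF steep_cx[of f i] steep_cx[of f k] cx_in, of "conf_slope n f" f i] l lam by auto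
qed

text \<open>The sign jumps only at zeros of \<open>a\<close>; there \<open>b\<close> vanishes, and a
  bounded factor times a null function tends to 0.\<close>

lemma continuous_on_sgn_mult:
  fixes a b :: "'a::topological_space \<Rightarrow> real"
  assumes a: "continuous_on A a" and b: "continuous_on A b" and ab: "\<And>x. x \<in> A \<Longrightarrow> a x = 0 \<Longrightarrow> b x = 0"
  shows "continuous_on A (\<lambda>x. sgn (a x) * b x)"
  unfolding continuous_on_def
proof
  fix x assume x: "x \<in> A"
  have lim: "(a \<longlongrightarrow> a x) (at x within A)" "(b \<longlongrightarrow> b x) (at x within A)"
    using a b x by (auto simp: continuous_on_def)
  show "((\<lambda>x. sgn (a x) * b x) \<longlongrightarrow> sgn (a x) * b x) (at x within A)"
  proof (cases "a x = 0")
    case True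
    have "((\<lambda>x. sgn (a x) * b x) \<longlongrightarrow> 0) (at x within A)"
    proof (rule Lim_null_comparison)
      show "\<forall>\<^sub>F y in at x within A. norm (sgn (a y) * b y) \<le> \<bar>b y\<bar>"
        by (rule always_eventually) (auto simp: abs_mult sgn_if)
      show "((\<lambda>y. \<bar>b y\<bar>) \<longlongrightarrow> 0) (at x within A)"
        using tendsto_rabs[OF lim(2)] ab[OF x True] by simp
    qed
    then show ?thesis using True by simp
  next
    case False
    then show ?thesis by (intro tendsto_mult tendsto_sgn lim)
  qed
qed

lemma continuous_on_new_lev:
  assumes f: "\<And>i. i < n \<Longrightarrow> continuous_on A (\<lambda>p. f p i)" "\<And>p. p \<in> A \<Longrightarrow> f p \<in> OConf n" and i: "i < n"
  shows "continuous_on A (\<lambda>p. new_lev n (f p) i)"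
  unfolding new_lev_def
proof (rule continuous_on_sum)
  fix k assume "k \<in> {..<n}"
  then have k: "k < n" by simp
  let ?b = "\<lambda>p. theta (ramp (conf_slope n (f p)) ((cx (f p) i - cx (f p) k) / 2) (cx (f p) i))"
  show "continuous_on A (\<lambda>p. sgn (cy (f p) i - cy (f p) k) * ?b p)"
  proof (cases "i = k")
    case False
    show ?thesis
    proof (rule continuous_on_sgn_mult)
      show "continuous_on A (\<lambda>p. cy (f p) i - cy (f p) k)"
        by (intro continuous_on_diff continuous_on_cy f(1) i k)
      have "continuous_on A (\<lambda>p. cx (f p) i)" "continuous_on A (\<lambda>p. cx (f p) k)"
        by (intro continuous_on_cx f(1) i k)+
      then show "continuous_on A ?b"
        by (intro continuous_on_theta continuous_on_ramp continuous_on_conf_slope f continuous_on_divide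
            continuous_on_diff continuous_on_const) auto
      show "?b p = 0" if "p \<in> A" "cy (f p) i - cy (f p) k = 0" for p
        using conf_dead[OF f(2)[OF that(1)] i k False] that(2) theta_dead by simp
    qed
  qed simp
qed

definition strands :: "nat \<Rightarrow> (nat \<Rightarrow> real \<times> real) \<Rightarrow> real \<Rightarrow> nat \<Rightarrow> real" where
  "strands n f = list_path n (ramps n (conf_slope n f) (\<lambda>i t. (t - cx f i) / 2)) (order_list n (cy f))"

lemma strands_cpaths: "f \<in> OConf n \<Longrightarrow> strands n f \<in> cpaths n"
  unfolding strands_def by (rule list_path_ramps[OF admissible_conf]) (auto simp: steep_cx)

lemma conf_path_strands: "f \<in> OConf n \<Longrightarrow> conf_path (n, f) = toP (strands n f)"
  unfolding conf_path_def strands_def fst_conv snd_conv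
  by (rule ramp_path_of_eq[OF admissible_conf]) (auto simp: steep_cx)

lemma strands_apply:
  "t \<in> {0..1} \<Longrightarrow> j < n \<Longrightarrow>
    strands n f t j = ramp (conf_slope n f) ((t - cx f (order_list n (cy f) ! j)) / 2) t"
  by (simp add: strands_def list_path_def arrange_def ramps_def)

lemma order_list_bij: "bij_betw (\<lambda>j. order_list n y ! j) {..<n} {..<n}"
  by (rule bij_betw_nth) simp_all

lemma order_list_less:
  assumes "j < l" "l < n" shows "y (order_list n y ! j) \<le> y (order_list n y ! l)" "order_list n y ! j \<noteq> order_list n y ! l"
  using sorted_wrt_nth_less[OF order_list_sorted, of j l n y] assms by auto

lemma cross_strands:
  assumes f: "f \<in> OConf n" and j: "j < n"
  shows "cross (strands n f) j = cx f (order_list n (cy f) ! j)"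
proof -
  let ?x = "cx f (order_list n (cy f) ! j)"
  have "strands n f ?x j = kap ?x"
    using strands_apply[OF cx_in j] ramp_zero[OF cx_in] by simp
  then show ?thesis
    using steep_abs[OF steep_cross[OF strands_cpaths[OF f] j], of ?x] cx_in by simp
qed

text \<open>Strands are sorted by level, so the order of positions is the sign of the level
  difference, except for ties. Tied strands are dead at each other's crossing and have weight
  0.\<close>

lemma lev_strands:
  assumes f: "f \<in> OConf n" and j: "j < n"
  shows "lev n (strands n f) j = new_lev n f (order_list n (cy f) ! j)"
proof -
  let ?L = "order_list n (cy f)"
  let ?r = "\<lambda>k. ramp (conf_slope n f) ((cx f (?L ! j) - cx f k) / 2) (cx f (?L ! j))"
  have lt: "?L ! k < n" if "k < n" for k using nth_mem[of k ?L] that by simp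
  have "sg j k * theta (?r (?L ! k)) = sgn (cy f (?L ! j) - cy f (?L ! k)) * theta (?r (?L ! k))" if k: "k < n" for k
  proof (cases "j = k \<or> \<not> live (?r (?L ! k))")
    case False
    then have "?L ! j \<noteq> ?L ! k" using order_list_less(2)[of j k n "cy f"] order_list_less(2)[of k j n "cy f"] j k
      by (metis linorder_neqE_nat)
    then have "cy f (?L ! j) \<noteq> cy f (?L ! k)" using conf_dead[OF f lt[OF j] lt[OF k]] False by blast
    then show ?thesis
      using order_list_less(1)[of j k n "cy f"] order_list_less(1)[of k j n "cy f"] j k False
      by (cases "j < k") (auto simp: sg_def sgn_if)
  qed (auto simp: sg_def theta_dead)
  then have "(\<Sum>k<n. sg j k * theta (?r (?L ! k))) =
      (\<Sum>k<n. sgn (cy f (?L ! j) - cy f (?L ! k)) * theta (?r (?L ! k)))"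
    by (intro sum.cong) auto
  also have "\<dots> = new_lev n f (?L ! j)"
    unfolding new_lev_def
    by (rule sum.reindex_bij_betw[OF order_list_bij, of "\<lambda>k. sgn (cy f (?L ! j) - cy f k) * theta (?r k)"])
  finally show ?thesis
    unfolding lev_def cross_strands[OF f j] by (simp add: strands_apply[OF cx_in])
qed

text \<open>After sorting, \<open>i\<close> precedes \<open>k\<close>, and the two strands cross
  simultaneously, so \<open>lev_less\<close> applies to the lift.\<close>

lemma new_lev_less:
  assumes f: "f \<in> OConf n" and ik: "i < n" "k < n" and eq: "cx f i = cx f k" and less: "cy f i < cy f k"
  shows "new_lev n f i < new_lev n f k"
proof -
  let ?L = "order_list n (cy f)"
  obtain j l where jl: "j < n" "?L ! j = i" "l < n" "?L ! l = k"
    using order_list_bij[of n "cy f"] ik unfolding bij_betw_def by (metis imageE lessThan_iff)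
  have "j < l"
  proof (rule ccontr)
    assume "\<not> j < l"
    then have "l = j \<or> l < j" by auto
    then show False using order_list_less(1)[of l j n "cy f"] jl less by auto
  qed
  then show ?thesis
    using lev_less[OF strands_cpaths[OF f], of j l] cross_strands[OF f] lev_strands[OF f] jl eq by simp
qed

section \<open>Interpolation between old and new levels\<close>

definition mix :: "real \<times> nat \<times> (nat \<Rightarrow> real \<times> real) \<Rightarrow> nat \<times> (nat \<Rightarrow> real \<times> real)" where
  "mix p = (let \<tau> = fst p; n = fst (snd p); f = snd (snd p) in
     (n, \<lambda>i. if i < n then (fst (f i), (1 - \<tau>) * cy f i + \<tau> * new_lev n f i) else 0))"

text \<open>First coordinates do not move, so a collision could only involve points with equal first
  coordinate. For these the old and new levels are in the same strict order, which every convex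
  combination keeps.\<close>

lemma mix_in:
  assumes \<tau>: "\<tau> \<in> {0..1}" and f: "f \<in> OConf n" shows "mix (\<tau>, n, f) \<in> ord_conf"
proof -
  have less: "(1 - \<tau>) * cy f i + \<tau> * new_lev n f i < (1 - \<tau>) * cy f k + \<tau> * new_lev n f k"
    if "i < n" "k < n" "fst (f i) = fst (f k)" "cy f i < cy f k" for i k
  proof -
    have "new_lev n f i < new_lev n f k" using new_lev_less[OF f] that by (simp add: cx_def)
    then show ?thesis
      using \<tau> that(4) by (cases "\<tau> = 0") (auto intro!: add_le_less_mono mult_left_mono mult_strict_left_mono)
  qed
  have "inj_on (\<lambda>i. (fst (f i), (1 - \<tau>) * cy f i + \<tau> * new_lev n f i)) {..<n}"
  proof (rule inj_onI)
    fix i k assume ik: "i \<in> {..<n}" "k \<in> {..<n}"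
      "(fst (f i), (1 - \<tau>) * cy f i + \<tau> * new_lev n f i) = (fst (f k), (1 - \<tau>) * cy f k + \<tau> * new_lev n f k)"
    have "\<not> cy f i < cy f k" using less[of i k] ik by auto
    moreover have "\<not> cy f k < cy f i" using less[of k i] ik by auto
    ultimately have "cy f i = cy f k" by simp
    then have "f i = f k" using ik by (simp add: cy_def prod_eq_iff)
    then show "i = k" using f ik by (auto simp: OConf_def inj_on_def)
  qed
  then have "inj_on (\<lambda>i. if i < n then (fst (f i), (1 - \<tau>) * cy f i + \<tau> * new_lev n f i) else 0) {..<n}"
    by (simp add: inj_on_def)
  then show ?thesis by (simp add: mix_def ord_conf_def OConf_def)
qed

lemma continuous_mix:
  "continuous_map (top_of_set ({0..1} \<times> ord_conf)) (top_of_set ord_conf) mix"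
proof (rule continuous_map_local)
  fix p :: "real \<times> _" assume "p \<in> {0..1} \<times> ord_conf"
  then obtain n where p: "p \<in> {0..1} \<times> ({n} \<times> OConf n)" by (auto simp: ord_conf_def)
  let ?N = "{0..1::real} \<times> ({n} \<times> OConf n)"
  have c: "continuous_on ?N (\<lambda>p. snd (snd p) i)" for i
    by (rule continuous_on_snd_comp[OF continuous_on_snd_coord])
  have "continuous_on ?N (\<lambda>p. if i < n then (fst (snd (snd p) i),
      (1 - fst p) * cy (snd (snd p)) i + fst p * new_lev n (snd (snd p)) i) else 0)" for i
  proof (cases "i < n")
    case True
    have "continuous_on ?N (\<lambda>p. new_lev n (snd (snd p)) i)"
      by (rule continuous_on_new_lev) (use c True in auto)
    moreover have "continuous_on ?N (\<lambda>p. cy (snd (snd p)) i)" by (rule continuous_on_cy[OF c])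
    ultimately show ?thesis using True c[of i]
      by (simp) (intro continuous_on_Pair continuous_on_fst continuous_intros; assumption)
  qed simp
  then have "continuous_on ?N (\<lambda>p. (n, \<lambda>i. if i < n then (fst (snd (snd p) i),
      (1 - fst p) * cy (snd (snd p)) i + fst p * new_lev n (snd (snd p)) i) else 0))"
    by (intro continuous_on_Pair continuous_on_const continuous_on_into_fun)
  then have "continuous_on ?N mix"
    by (rule continuous_on_eq) (auto simp: mix_def fun_eq_iff)
  then have "continuous_map (top_of_set ?N) (top_of_set ord_conf) mix"
    using mix_in by (auto simp: continuous_map_in_subtopology)
  moreover have "openin (top_of_set ({0..1::real} \<times> ord_conf)) ?N"
    by (simp add: openin_Times openin_conf_piece)
  ultimately show "\<exists>N. openin (top_of_set ({0..1} \<times> ord_conf)) N \<and> p \<in> N \<and> continuous_map (top_of_set N) (top_of_set ord_conf) mix"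
    using p by blast
qed

lemma mix_toUC:
  assumes pq: "p \<in> ord_conf" "q \<in> ord_conf" "toUC p = toUC q"
  shows "toUC (mix (\<tau>, p)) = toUC (mix (\<tau>, q))"
proof -
  obtain n f m f' where p: "p = (n, f)" "q = (m, f')" "f \<in> OConf n" "f' \<in> OConf m"
    using pq by (auto simp: ord_conf_def)
  obtain \<pi> where \<pi>: "m = n" "bij_betw \<pi> {..<n} {..<n}" "\<And>i. i < n \<Longrightarrow> f' (\<pi> i) = f i"
    using toUC_eqE[OF p(3,4)] pq p by blast
  have lt: "\<pi> i < n" if "i < n" for i using \<pi>(2) that by (auto simp: bij_betw_def)
  have c: "cx f' (\<pi> i) = cx f i" "cy f' (\<pi> i) = cy f i" if "i < n" for i
    using \<pi>(3)[OF that] by (simp_all add: cx_def cy_def)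
  have "conf_slope n f' = conf_slope n f"
    unfolding conf_slope_def by (rule slope_relabel[OF \<pi>(2)]) (simp_all add: c)
  then have "new_lev n f' (\<pi> i) = new_lev n f i" if "i < n" for i
    unfolding new_lev_def
    by (subst sum.reindex_bij_betw[OF \<pi>(2), symmetric]) (use that c in \<open>auto intro!: sum.cong\<close>)
  then have "toUC (mix (\<tau>, n, f')) = toUC (mix (\<tau>, n, f))"
    unfolding mix_def Let_def fst_conv snd_conv
    by (intro toUC_relabel[OF \<pi>(2)]) (simp add: lt \<pi>(3) c)
  then show ?thesis using p \<pi>(1) by simp
qed

lemma mix_0: "f \<in> OConf n \<Longrightarrow> mix (0, n, f) = (n, f)"
  by (auto simp: mix_def cy_def OConf_def fun_eq_iff)

text \<open>The lift lists the points sorted by level, so the two ordered configurations differ by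
  the permutation \<open>order_list n (cy f)\<close>, which the unordered configuration
  forgets.\<close>

lemma mix_1:
  assumes f: "f \<in> OConf n" shows "toUC (mix (1, n, f)) = toUC (conf_of (strands n f))"
proof -
  let ?L = "order_list n (cy f)" and ?h = "\<lambda>i. (fst (f i), new_lev n f i)"
  have "conf_fun n (strands n f) j = ?h (?L ! j)" if "j < n" for j
    using that cross_strands[OF f that] lev_strands[OF f that] by (simp add: conf_fun_def cx_def)
  then have "conf_fun n (strands n f) ` {..<n} = (\<lambda>j. ?h (?L ! j)) ` {..<n}"
    by (intro image_cong) auto
  also have "\<dots> = ?h ` ((\<lambda>j. ?L ! j) ` {..<n})"
    by (simp only: image_image)
  also have "(\<lambda>j. ?L ! j) ` {..<n} = {..<n}"
    by (rule bij_betw_imp_surj_on[OF order_list_bij])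
  also have "?h ` {..<n} = snd (mix (1, n, f)) ` {..<n}"
    by (intro image_cong) (auto simp: mix_def)
  finally show ?thesis
    by (simp add: toUC_def conf_of_cpaths[OF strands_cpaths[OF f]]) (simp add: mix_def)
qed

theorem theorem1p1:
  shows "dpath_space Zcubes Zface 0 0 homotopy_equivalent_space sum_topology UConf UNIV"
proof -
  have "continuous_map (top_of_set all_cpaths) UC (toUC \<circ> conf_of)"
    by (rule continuous_map_compose[OF continuous_conf_of quotient_imp_continuous_map[OF quotient_map_toUC]])
  then obtain F where F: "continuous_map PP UC F"
    "\<And>\<beta>. \<beta> \<in> all_cpaths \<Longrightarrow> F (toP \<beta>) = toUC (conf_of \<beta>)"
  proof (rule descend_map[OF quotient_map_toP], unfold o_def)
    show "toUC (conf_of \<beta>) = toUC (conf_of \<gamma>)"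
      if "\<beta> \<in> all_cpaths" "\<gamma> \<in> all_cpaths" "toP \<beta> = toP \<gamma>" for \<beta> \<gamma>
      by (rule conf_of_toP[OF that])
  qed (rule that)
  obtain G where G: "continuous_map UC PP G" "\<And>p. p \<in> ord_conf \<Longrightarrow> G (toUC p) = conf_path p"
    by (rule descend_map[OF quotient_map_toUC continuous_conf_path]) (rule conf_path_toUC, assumption+, rule that)
  obtain H1 where H1: "continuous_map (prod_topology (top_of_set {0..1}) PP) PP H1"
    "\<And>\<tau> \<beta>. \<tau> \<in> {0..1} \<Longrightarrow> \<beta> \<in> all_cpaths \<Longrightarrow> H1 (\<tau>, toP \<beta>) = steepen_homotopy (\<tau>, \<beta>)"
    by (rule descend_homotopy[OF quotient_map_toP continuous_steepen]) (rule homotopies_toP(1), assumption+, rule that)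
  obtain H2 where H2: "continuous_map (prod_topology (top_of_set {0..1}) PP) PP H2"
    "\<And>\<tau> \<beta>. \<tau> \<in> {0..1} \<Longrightarrow> \<beta> \<in> all_cpaths \<Longrightarrow> H2 (\<tau>, toP \<beta>) = straighten_homotopy (\<tau>, \<beta>)"
    by (rule descend_homotopy[OF quotient_map_toP continuous_straighten]) (rule homotopies_toP(2), assumption+, rule that)
  have "continuous_map (top_of_set ({0..1} \<times> ord_conf)) UC (toUC \<circ> mix)"
    by (rule continuous_map_compose[OF continuous_mix quotient_imp_continuous_map[OF quotient_map_toUC]])
  then obtain H3 where H3: "continuous_map (prod_topology (top_of_set {0..1}) UC) UC H3"
    "\<And>\<tau> p. \<tau> \<in> {0..1} \<Longrightarrow> p \<in> ord_conf \<Longrightarrow> H3 (\<tau>, toUC p) = toUC (mix (\<tau>, p))"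
  proof (rule descend_homotopy[OF quotient_map_toUC], unfold o_def)
    show "toUC (mix (\<tau>, p)) = toUC (mix (\<tau>, q))"
      if "p \<in> ord_conf" "q \<in> ord_conf" "toUC p = toUC q" for \<tau> p q
      by (rule mix_toUC[OF that])
  qed (rule that)
  have PP: "\<exists>n \<beta>. \<beta> \<in> cpaths n \<and> \<beta> \<in> all_cpaths \<and> \<alpha> = toP \<beta>" if "\<alpha> \<in> topspace PP" for \<alpha>
    using toP_surj[OF that] by (auto simp: all_cpaths_def)
  have "homotopic_with (\<lambda>_. True) PP PP id (\<lambda>\<alpha>. H1 (1, \<alpha>))"
  proof (subst homotopic_with, simp, intro exI conjI ballI)
    show "H1 (0, \<alpha>) = id \<alpha>" if "\<alpha> \<in> topspace PP" for \<alpha>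
      using PP[OF that] H1(2) steepen_0 by fastforce
  qed (use H1(1) in auto)
  \<comment> \<open>Straightening starts where steepening ends, so the two homotopies can be
    concatenated.\<close>
  moreover have "homotopic_with (\<lambda>_. True) PP PP (\<lambda>\<alpha>. H1 (1, \<alpha>)) (G \<circ> F)"
  proof (subst homotopic_with, simp, intro exI conjI ballI)
    fix \<alpha> assume "\<alpha> \<in> topspace PP"
    then obtain n \<beta> where \<beta>: "\<beta> \<in> cpaths n" "\<beta> \<in> all_cpaths" "\<alpha> = toP \<beta>" using PP by blast
    show "H2 (0, \<alpha>) = H1 (1, \<alpha>)" using H1(2)[of 1 \<beta>] H2(2)[of 0 \<beta>] \<beta> steepen_1_straighten_0[OF \<beta>(1)] by simp
    have "conf_of \<beta> \<in> ord_conf"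
      using conf_of_cpaths[OF \<beta>(1)] conf_fun_OConf[OF \<beta>(1)] by (simp add: ord_conf_def)
    then show "H2 (1, \<alpha>) = (G \<circ> F) \<alpha>"
      using H2(2)[of 1 \<beta>] \<beta> straighten_1[OF \<beta>(1)] F(2)[OF \<beta>(2)] G(2) by simp
  qed (use H2(1) in auto)
  ultimately have GF: "homotopic_with (\<lambda>_. True) PP PP (G \<circ> F) id"
    using homotopic_with_trans homotopic_with_symD by blast
  have "homotopic_with (\<lambda>_. True) UC UC id (F \<circ> G)"
  proof (subst homotopic_with, simp, intro exI conjI ballI)
    fix P assume "P \<in> topspace UC"
    then obtain n f where f: "f \<in> OConf n" "(n, f) \<in> ord_conf" "P = toUC (n, f)"
      unfolding topspace_UC by (auto simp: ord_conf_def)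
    show "H3 (0, P) = id P" using H3(2)[of 0 "(n, f)"] f mix_0[OF f(1)] by simp
    have "strands n f \<in> all_cpaths" using strands_cpaths[OF f(1)] by (auto simp: all_cpaths_def)
    then show "H3 (1, P) = (F \<circ> G) P"
      using H3(2)[of 1 "(n, f)"] f mix_1[OF f(1)] G(2)[OF f(2)] conf_path_strands[OF f(1)] F(2) by simp
  qed (use H3(1) in auto)
  then have FG: "homotopic_with (\<lambda>_. True) UC UC (F \<circ> G) id" by (rule homotopic_with_symD)
  show ?thesis
    unfolding homotopy_equivalent_space_def using F(1) G(1) GF FG by blast
qed

end
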